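(* Let $\mathcal{K}$ be a 2-category and $T$ a 2-monad on $\mathcal{K}$. Let $(\mathcal{A},\Sigma)$ be a PIE indexing pair, and let $\overline{F}:\mathcal{A}\to T\text{-}Alg_\ell$ be a 2-functor; write $F=U_\ell\overline{F}$ and $\overline{F}(f)=(F(f),\overline{F(f)})$ for each arrow $f$ of $\mathcal{A}$. Assume that $\overline{F(f_A)}$ is an invertible 2-cell for each $A\in\mathcal{A}$. Then the forgetful 2-functor $U_\ell:T\text{-}Alg_\ell\to\mathcal{K}$ creates the $\sigma$-s-oplimit of $\overline{F}$ (with respect to $\Sigma$). The projections $\{\pi_{A_0}\}_{A_0\in\mathcal{A}_0}$ of the lifted limit are strict, and they jointly detect strictness (and pseudoness).
   Context: **$T\text{-}Alg_\ell$.** Objects: strict $T$-algebras $(A,a:TA\to A)$. Arrows $(A,a)\to(B,b)$: lax morphisms $(f,\overline{f})$, with $f:A\to B$ in $\mathcal{K}$ and $\overline{f}:b\,Tf\Rightarrow f\,a$ a 2-cell, subject to the usual coherence conditions: with $i,m$ the unit and multiplication of $T$, $\overline{f}\,i_A=id_f$ and $\overline{f}\,m_A=(\overline{f}\,Ta)\circ(b\,T\overline{f})$. Composition: $\overline{gf}=(g\,\overline{f})\circ(\overline{g}\,Tf)$. 2-cells $(f,\overline{f})\Rightarrow(g,\overline{g})$: 2-cells $\alpha:f\Rightarrow g$ of $\mathcal{K}$ with $(\alpha\,a)\circ\overline{f}=\overline{g}\circ(b\,T\alpha)$. A morphism is strict (resp. pseudo) if $\overline{f}$ is an identity (resp. invertible).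 A family of morphisms $p_i:L\to A_i$ jointly detects strictness (resp. pseudoness) if any morphism $z:Z\to L$ such that all composites $p_iz$ are strict (resp. pseudo) is itself strict (resp. pseudo). **Indexing pairs.** An indexing pair $(\mathcal{A},\Sigma)$ is a 2-category $\mathcal{A}$ with a family $\Sigma$ of its arrows, closed under composition and containing all identities. It is PIE if, in the 1-subcategory of $\mathcal{A}$ given by all objects of $\mathcal{A}$ and the arrows of $\Sigma$, each connected component has an initial object. $\mathcal{A}_0$ denotes the family of these initial objects (one for each component), and for $A\in\mathcal{A}$, $f_A:A_0\to A$ denotes the unique arrow in $\Sigma$ to $A$ from the initial object $A_0\in\mathcal{A}_0$ of its component. **$\sigma$-s-oplimits.** Let $F:\mathcal{A}\to\mathcal{B}$ be a 2-functor and $E\in\mathcal{B}$. An op-lax cone for $F$ with vertex $E$ consists of arrows $\theta_A:E\to FA$ and 2-cells $\theta_f:\theta_B\Rightarrow Ff\,\theta_A$ (for $f:A\to B$) such that $\theta_{id_A}=id_{\theta_A}$; $\theta_{gf}=Fg\,\theta_f\circ\theta_g$ for $A\xrightarrow{f}B\xrightarrow{g}C$; and $\theta_g=F\gamma\,\theta_A\circ\theta_f$ for $\gamma:f\Rightarrow g:A\to B$. A morphism $\alpha:\theta\to\theta'$ is a family $\alpha_A:\theta_A\Rightarrow\theta'_A$ with $Ff\,\alpha_A\circ\theta_f=\theta'_f\circ\alpha_B$. A $\sigma$-s-opcone is an op-lax cone with $\theta_f$ an identity for every $f\in\Sigma$ (full subcategory). The $\sigma$-s-oplimit of $F$ with respect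 to $\Sigma$ is a universal $\sigma$-s-opcone $\pi$ with vertex $L$: for each $E$, composition with $\pi$ is an isomorphism of categories from $\mathcal{B}(E,L)$ to the category of $\sigma$-s-opcones with vertex $E$. The arrows $\pi_A$ are the projections. **Creation.** $U_\ell$ creates the $\sigma$-s-oplimit of $\overline{F}$ means: if the $\sigma$-s-oplimit of $F=U_\ell\overline{F}$ exists in $\mathcal{K}$, then the $\sigma$-s-oplimit of $\overline{F}$ exists in $T\text{-}Alg_\ell$ and is preserved by $U_\ell$. The assertions about projections refer to the lifted limit cone (i.e. the limit cone in $\mathcal{K}$ lifts to a limit cone in $T\text{-}Alg_\ell$ with those properties). *)

theory Defs
  imports Main "HOL-Library.FuncSet"
begin

section \<open>Categories\<close>

record ('o, 'm) cat =
  Ob :: "'o set"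
  Arr :: "'m set"
  Dom :: "'m \<Rightarrow> 'o"
  Cod :: "'m \<Rightarrow> 'o"
  Id :: "'o \<Rightarrow> 'm"
  Comp :: "'m \<Rightarrow> 'm \<Rightarrow> 'm" (infixl \<open>\<cdot>\<index>\<close> 70)

definition Hom :: "('o, 'm, 'z) cat_scheme \<Rightarrow> 'o \<Rightarrow> 'o \<Rightarrow> 'm set" where
  "Hom C A B = {f \<in> Arr C. Dom C f = A \<and> Cod C f = B}"

locale category =
  fixes C :: "('o, 'm, 'z) cat_scheme" (structure)
  assumes dom_ob: "f \<in> Arr C \<Longrightarrow> Dom C f \<in> Ob C"
    and cod_ob: "f \<in> Arr C \<Longrightarrow> Cod C f \<in> Ob C"
    and id_hom: "A \<in> Ob C \<Longrightarrow> Id C A \<in> Hom C A A"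
    and comp_hom: "\<lbrakk>f \<in> Arr C; g \<in> Arr C; Cod C f = Dom C g\<rbrakk>
          \<Longrightarrow> g \<cdot> f \<in> Hom C (Dom C f) (Cod C g)"
    and id_right: "f \<in> Arr C \<Longrightarrow> f \<cdot> Id C (Dom C f) = f"
    and id_left: "f \<in> Arr C \<Longrightarrow> Id C (Cod C f) \<cdot> f = f"
    and comp_assoc: "\<lbrakk>f \<in> Arr C; g \<in> Arr C; h \<in> Arr C; Cod C f = Dom C g; Cod C g = Dom C h\<rbrakk>
          \<Longrightarrow> (h \<cdot> g) \<cdot> f = h \<cdot> (g \<cdot> f)"

definition functor_between ::
  "('o, 'm, 'z) cat_scheme \<Rightarrow> ('p, 'n, 'y) cat_scheme \<Rightarrow> ('o \<Rightarrow> 'p) \<Rightarrow> ('m \<Rightarrow> 'n) \<Rightarrow> bool" where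
  "functor_between C D fo fa \<longleftrightarrow>
     (\<forall>A \<in> Ob C. fo A \<in> Ob D \<and> fa (Id C A) = Id D (fo A)) \<and>
     (\<forall>f \<in> Arr C. fa f \<in> Hom D (fo (Dom C f)) (fo (Cod C f))) \<and>
     (\<forall>f \<in> Arr C. \<forall>g \<in> Arr C. Cod C f = Dom C g \<longrightarrow>
        fa (g \<cdot>\<^bsub>C\<^esub> f) = fa g \<cdot>\<^bsub>D\<^esub> fa f)"

definition cat_iso ::
  "('o, 'm, 'z) cat_scheme \<Rightarrow> ('p, 'n, 'y) cat_scheme \<Rightarrow> ('o \<Rightarrow> 'p) \<Rightarrow> ('m \<Rightarrow> 'n) \<Rightarrow> bool" where
  "cat_iso C D fo fa \<longleftrightarrow>
     functor_between C D fo fa \<and> bij_betw fo (Ob C) (Ob D) \<and> bij_betw fa (Arr C) (Arr D)"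

definition full_sub :: "('o, 'm, 'z) cat_scheme \<Rightarrow> 'o set \<Rightarrow> ('o, 'm) cat" where
  "full_sub C P = \<lparr>Ob = P \<inter> Ob C, Arr = {f \<in> Arr C. Dom C f \<in> P \<and> Cod C f \<in> P},
     Dom = Dom C, Cod = Cod C, Id = Id C, Comp = Comp C\<rparr>"

definition initial_ob :: "('o, 'm, 'z) cat_scheme \<Rightarrow> 'o \<Rightarrow> bool" where
  "initial_ob C X \<longleftrightarrow> X \<in> Ob C \<and> (\<forall>Y \<in> Ob C. \<exists>!f. f \<in> Hom C X Y)"

text \<open>Two objects are connected if they are joined by a finite zigzag of arrows.\<close>

definition connected_rel :: "('o, 'm, 'z) cat_scheme \<Rightarrow> ('o \<times> 'o) set" where
  "connected_rel C =
     (let R = {(Dom C f, Cod C f) |f. f \<in> Arr C} in (R \<union> R\<inverse>)\<^sup>* \<inter> (Ob C \<times> Ob C))"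

definition components :: "('o, 'm, 'z) cat_scheme \<Rightarrow> 'o set set" where
  "components C = Ob C // connected_rel C"

section \<open>2-categories, 2-functors and 2-monads\<close>

text \<open>Arguments of all compositions are in applicative order: \<open>\<beta> \<odot> \<alpha>\<close> is \<open>\<alpha>\<close> followed
  vertically by \<open>\<beta>\<close>, and \<open>\<beta> \<star> \<alpha>\<close> is \<open>\<alpha>\<close> followed horizontally by \<open>\<beta>\<close>.\<close>

record ('o, 'm, 'c) two_cat = "('o, 'm) cat" +
  Cell :: "'c set"
  Src :: "'c \<Rightarrow> 'm"
  Trg :: "'c \<Rightarrow> 'm"
  Id2 :: "'m \<Rightarrow> 'c"
  VComp :: "'c \<Rightarrow> 'c \<Rightarrow> 'c" (infixl \<open>\<odot>\<index>\<close> 65)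
  HComp :: "'c \<Rightarrow> 'c \<Rightarrow> 'c" (infixl \<open>\<star>\<index>\<close> 70)

definition Hom2 :: "('o, 'm, 'c, 'z) two_cat_scheme \<Rightarrow> 'm \<Rightarrow> 'm \<Rightarrow> 'c set" where
  "Hom2 K f g = {\<alpha> \<in> Cell K. Src K \<alpha> = f \<and> Trg K \<alpha> = g}"

abbreviation whisker_left :: "('o, 'm, 'c, 'z) two_cat_scheme \<Rightarrow> 'm \<Rightarrow> 'c \<Rightarrow> 'c"
    (infixr \<open>\<rhd>\<index>\<close> 70) where
  "g \<rhd>\<^bsub>K\<^esub> \<alpha> \<equiv> Id2 K g \<star>\<^bsub>K\<^esub> \<alpha>"

abbreviation whisker_right :: "('o, 'm, 'c, 'z) two_cat_scheme \<Rightarrow> 'c \<Rightarrow> 'm \<Rightarrow> 'c"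
    (infixl \<open>\<lhd>\<index>\<close> 70) where
  "\<alpha> \<lhd>\<^bsub>K\<^esub> f \<equiv> \<alpha> \<star>\<^bsub>K\<^esub> Id2 K f"

text \<open>All arrows and 2-cells under vertical composition: the disjoint union of the
  hom-categories.\<close>

definition vert_cat :: "('o, 'm, 'c, 'z) two_cat_scheme \<Rightarrow> ('m, 'c) cat" where
  "vert_cat K = \<lparr>Ob = Arr K, Arr = Cell K, Dom = Src K, Cod = Trg K, Id = Id2 K, Comp = VComp K\<rparr>"

definition hom_cat :: "('o, 'm, 'c, 'z) two_cat_scheme \<Rightarrow> 'o \<Rightarrow> 'o \<Rightarrow> ('m, 'c) cat" where
  "hom_cat K A B = full_sub (vert_cat K) (Hom K A B)"

locale two_category = category K for K :: "('o, 'm, 'c, 'z) two_cat_scheme" (structure) +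
  assumes vert_category: "category (vert_cat K)"
    and cell_dom: "\<alpha> \<in> Cell K \<Longrightarrow> Dom K (Src K \<alpha>) = Dom K (Trg K \<alpha>)"
    and cell_cod: "\<alpha> \<in> Cell K \<Longrightarrow> Cod K (Src K \<alpha>) = Cod K (Trg K \<alpha>)"
    and hcomp_hom: "\<lbrakk>\<alpha> \<in> Cell K; \<beta> \<in> Cell K; Cod K (Src K \<alpha>) = Dom K (Src K \<beta>)\<rbrakk>
          \<Longrightarrow> \<beta> \<star> \<alpha> \<in> Hom2 K (Src K \<beta> \<cdot> Src K \<alpha>) (Trg K \<beta> \<cdot> Trg K \<alpha>)"
    and hcomp_id2: "\<lbrakk>f \<in> Arr K; g \<in> Arr K; Cod K f = Dom K g\<rbrakk>
          \<Longrightarrow> Id2 K g \<star> Id2 K f = Id2 K (g \<cdot> f)"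
    and interchange: "\<lbrakk>\<alpha> \<in> Cell K; \<alpha>' \<in> Cell K; \<beta> \<in> Cell K; \<beta>' \<in> Cell K;
          Trg K \<alpha> = Src K \<alpha>'; Trg K \<beta> = Src K \<beta>'; Cod K (Src K \<alpha>) = Dom K (Src K \<beta>)\<rbrakk>
          \<Longrightarrow> (\<beta>' \<odot> \<beta>) \<star> (\<alpha>' \<odot> \<alpha>) = (\<beta>' \<star> \<alpha>') \<odot> (\<beta> \<star> \<alpha>)"
    and hcomp_id_right: "\<alpha> \<in> Cell K \<Longrightarrow> \<alpha> \<star> Id2 K (Id K (Dom K (Src K \<alpha>))) = \<alpha>"
    and hcomp_id_left: "\<alpha> \<in> Cell K \<Longrightarrow> Id2 K (Id K (Cod K (Src K \<alpha>))) \<star> \<alpha> = \<alpha>"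
    and hcomp_assoc: "\<lbrakk>\<alpha> \<in> Cell K; \<beta> \<in> Cell K; \<gamma> \<in> Cell K;
          Cod K (Src K \<alpha>) = Dom K (Src K \<beta>); Cod K (Src K \<beta>) = Dom K (Src K \<gamma>)\<rbrakk>
          \<Longrightarrow> (\<gamma> \<star> \<beta>) \<star> \<alpha> = \<gamma> \<star> (\<beta> \<star> \<alpha>)"

definition identity_cell :: "('o, 'm, 'c, 'z) two_cat_scheme \<Rightarrow> 'c \<Rightarrow> bool" where
  "identity_cell K \<alpha> \<longleftrightarrow> (\<exists>f \<in> Arr K. \<alpha> = Id2 K f)"

definition invertible_cell :: "('o, 'm, 'c, 'z) two_cat_scheme \<Rightarrow> 'c \<Rightarrow> bool" where
  "invertible_cell K \<alpha> \<longleftrightarrow> \<alpha> \<in> Cell K \<and>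
     (\<exists>\<beta> \<in> Hom2 K (Trg K \<alpha>) (Src K \<alpha>).
        \<beta> \<odot>\<^bsub>K\<^esub> \<alpha> = Id2 K (Src K \<alpha>) \<and> \<alpha> \<odot>\<^bsub>K\<^esub> \<beta> = Id2 K (Trg K \<alpha>))"

record ('o, 'm, 'c, 'p, 'n, 'd) two_fun =
  FOb :: "'o \<Rightarrow> 'p"
  FArr :: "'m \<Rightarrow> 'n"
  FCell :: "'c \<Rightarrow> 'd"

definition two_functor :: "('o, 'm, 'c, 'z) two_cat_scheme \<Rightarrow> ('p, 'n, 'd, 'y) two_cat_scheme
    \<Rightarrow> ('o, 'm, 'c, 'p, 'n, 'd, 'w) two_fun_scheme \<Rightarrow> bool" where
  "two_functor A B F \<longleftrightarrow>
     functor_between A B (FOb F) (FArr F) \<and>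
     functor_between (vert_cat A) (vert_cat B) (FArr F) (FCell F) \<and>
     (\<forall>\<alpha> \<in> Cell A. \<forall>\<beta> \<in> Cell A. Cod A (Src A \<alpha>) = Dom A (Src A \<beta>) \<longrightarrow>
        FCell F (\<beta> \<star>\<^bsub>A\<^esub> \<alpha>) = FCell F \<beta> \<star>\<^bsub>B\<^esub> FCell F \<alpha>)"

definition two_fun_id :: "('o, 'm, 'c, 'o, 'm, 'c) two_fun" where
  "two_fun_id = \<lparr>FOb = (\<lambda>A. A), FArr = (\<lambda>f. f), FCell = (\<lambda>\<alpha>. \<alpha>)\<rparr>"

definition two_fun_comp :: "('p, 'n, 'd, 'q, 'k, 'e, 'y) two_fun_scheme
    \<Rightarrow> ('o, 'm, 'c, 'p, 'n, 'd, 'z) two_fun_scheme \<Rightarrow> ('o, 'm, 'c, 'q, 'k, 'e) two_fun" where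
  "two_fun_comp G F = \<lparr>FOb = (\<lambda>A. FOb G (FOb F A)), FArr = (\<lambda>f. FArr G (FArr F f)),
     FCell = (\<lambda>\<alpha>. FCell G (FCell F \<alpha>))\<rparr>"

definition two_natural :: "('o, 'm, 'c, 'z) two_cat_scheme \<Rightarrow> ('p, 'n, 'd, 'y) two_cat_scheme
    \<Rightarrow> ('o, 'm, 'c, 'p, 'n, 'd, 'w) two_fun_scheme \<Rightarrow> ('o, 'm, 'c, 'p, 'n, 'd, 'v) two_fun_scheme
    \<Rightarrow> ('o \<Rightarrow> 'n) \<Rightarrow> bool" where
  "two_natural A B F G t \<longleftrightarrow>
     (\<forall>X \<in> Ob A. t X \<in> Hom B (FOb F X) (FOb G X)) \<and>
     (\<forall>f \<in> Arr A. FArr G f \<cdot>\<^bsub>B\<^esub> t (Dom A f) = t (Cod A f) \<cdot>\<^bsub>B\<^esub> FArr F f) \<and>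
     (\<forall>\<alpha> \<in> Cell A. FCell G \<alpha> \<lhd>\<^bsub>B\<^esub> t (Dom A (Src A \<alpha>)) = t (Cod A (Src A \<alpha>)) \<rhd>\<^bsub>B\<^esub> FCell F \<alpha>)"

record ('o, 'm, 'c) monad_data = "('o, 'm, 'c, 'o, 'm, 'c) two_fun" +
  Unit :: "'o \<Rightarrow> 'm"
  Mult :: "'o \<Rightarrow> 'm"

definition two_monad :: "('o, 'm, 'c) two_cat \<Rightarrow> ('o, 'm, 'c) monad_data \<Rightarrow> bool" where
  "two_monad K T \<longleftrightarrow>
     two_functor K K T \<and>
     two_natural K K two_fun_id T (Unit T) \<and>
     two_natural K K (two_fun_comp T T) T (Mult T) \<and>
     (\<forall>A \<in> Ob K.
        Mult T A \<cdot>\<^bsub>K\<^esub> Unit T (FOb T A) = Id K (FOb T A) \<and>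
        Mult T A \<cdot>\<^bsub>K\<^esub> FArr T (Unit T A) = Id K (FOb T A) \<and>
        Mult T A \<cdot>\<^bsub>K\<^esub> Mult T (FOb T A) = Mult T A \<cdot>\<^bsub>K\<^esub> FArr T (Mult T A))"

section \<open>The 2-category of strict algebras and lax morphisms\<close>

text \<open>An algebra is a pair \<open>(A, a)\<close>.  Since \<open>(f, f\<^sub>c)\<close> does not determine the algebra structures
  at its ends, arrows carry their domain and codomain; likewise 2-cells carry their source and
  target arrows.\<close>

record ('o, 'm, 'c) lax_mor =
  lax_dom :: "'o \<times> 'm"
  lax_cod :: "'o \<times> 'm"
  lax_arr :: 'm
  lax_cell :: 'c

record ('o, 'm, 'c) alg_cell =
  alg_src :: "('o, 'm, 'c) lax_mor"
  alg_trg :: "('o, 'm, 'c) lax_mor"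
  alg_under :: 'c

definition algebras :: "('o, 'm, 'c) two_cat \<Rightarrow> ('o, 'm, 'c) monad_data \<Rightarrow> ('o \<times> 'm) set" where
  "algebras K T = {(A, a). A \<in> Ob K \<and> a \<in> Hom K (FOb T A) A \<and>
     a \<cdot>\<^bsub>K\<^esub> Unit T A = Id K A \<and> a \<cdot>\<^bsub>K\<^esub> Mult T A = a \<cdot>\<^bsub>K\<^esub> FArr T a}"

definition lax_morphisms ::
  "('o, 'm, 'c) two_cat \<Rightarrow> ('o, 'm, 'c) monad_data \<Rightarrow> ('o, 'm, 'c) lax_mor set" where
  "lax_morphisms K T = {\<lparr>lax_dom = (A, a), lax_cod = (B, b), lax_arr = f, lax_cell = \<phi>\<rparr> |A a B b f \<phi>.
     (A, a) \<in> algebras K T \<and> (B, b) \<in> algebras K T \<and>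
     f \<in> Hom K A B \<and> \<phi> \<in> Hom2 K (b \<cdot>\<^bsub>K\<^esub> FArr T f) (f \<cdot>\<^bsub>K\<^esub> a) \<and>
     \<phi> \<lhd>\<^bsub>K\<^esub> Unit T A = Id2 K f \<and>
     \<phi> \<lhd>\<^bsub>K\<^esub> Mult T A = (\<phi> \<lhd>\<^bsub>K\<^esub> FArr T a) \<odot>\<^bsub>K\<^esub> (b \<rhd>\<^bsub>K\<^esub> FCell T \<phi>)}"

definition alg_cells ::
  "('o, 'm, 'c) two_cat \<Rightarrow> ('o, 'm, 'c) monad_data \<Rightarrow> ('o, 'm, 'c) alg_cell set" where
  "alg_cells K T = {\<lparr>alg_src = p, alg_trg = q, alg_under = \<alpha>\<rparr> |p q \<alpha>.
     p \<in> lax_morphisms K T \<and> q \<in> lax_morphisms K T \<and>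
     lax_dom p = lax_dom q \<and> lax_cod p = lax_cod q \<and>
     \<alpha> \<in> Hom2 K (lax_arr p) (lax_arr q) \<and>
     (\<alpha> \<lhd>\<^bsub>K\<^esub> snd (lax_dom p)) \<odot>\<^bsub>K\<^esub> lax_cell p
       = lax_cell q \<odot>\<^bsub>K\<^esub> (snd (lax_cod p) \<rhd>\<^bsub>K\<^esub> FCell T \<alpha>)}"

definition lax_id :: "('o, 'm, 'c) two_cat \<Rightarrow> 'o \<times> 'm \<Rightarrow> ('o, 'm, 'c) lax_mor" where
  "lax_id K X = \<lparr>lax_dom = X, lax_cod = X, lax_arr = Id K (fst X), lax_cell = Id2 K (snd X)\<rparr>"

definition lax_comp :: "('o, 'm, 'c) two_cat \<Rightarrow> ('o, 'm, 'c) monad_data \<Rightarrow>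
    ('o, 'm, 'c) lax_mor \<Rightarrow> ('o, 'm, 'c) lax_mor \<Rightarrow> ('o, 'm, 'c) lax_mor" where
  "lax_comp K T q p = \<lparr>lax_dom = lax_dom p, lax_cod = lax_cod q,
     lax_arr = lax_arr q \<cdot>\<^bsub>K\<^esub> lax_arr p,
     lax_cell = (lax_arr q \<rhd>\<^bsub>K\<^esub> lax_cell p) \<odot>\<^bsub>K\<^esub> (lax_cell q \<lhd>\<^bsub>K\<^esub> FArr T (lax_arr p))\<rparr>"

definition Alg_lax :: "('o, 'm, 'c) two_cat \<Rightarrow> ('o, 'm, 'c) monad_data \<Rightarrow>
    ('o \<times> 'm, ('o, 'm, 'c) lax_mor, ('o, 'm, 'c) alg_cell) two_cat" where
  "Alg_lax K T = \<lparr>Ob = algebras K T, Arr = lax_morphisms K T,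
     Dom = lax_dom, Cod = lax_cod, Id = lax_id K, Comp = lax_comp K T,
     Cell = alg_cells K T, Src = alg_src, Trg = alg_trg,
     Id2 = (\<lambda>p. \<lparr>alg_src = p, alg_trg = p, alg_under = Id2 K (lax_arr p)\<rparr>),
     VComp = (\<lambda>\<beta> \<alpha>. \<lparr>alg_src = alg_src \<alpha>, alg_trg = alg_trg \<beta>,
        alg_under = alg_under \<beta> \<odot>\<^bsub>K\<^esub> alg_under \<alpha>\<rparr>),
     HComp = (\<lambda>\<beta> \<alpha>. \<lparr>alg_src = lax_comp K T (alg_src \<beta>) (alg_src \<alpha>),
        alg_trg = lax_comp K T (alg_trg \<beta>) (alg_trg \<alpha>),
        alg_under = alg_under \<beta> \<star>\<^bsub>K\<^esub> alg_under \<alpha>\<rparr>)\<rparr>"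

definition Forget :: "('o \<times> 'm, ('o, 'm, 'c) lax_mor, ('o, 'm, 'c) alg_cell, 'o, 'm, 'c) two_fun" where
  "Forget = \<lparr>FOb = fst, FArr = lax_arr, FCell = alg_under\<rparr>"

definition strict_mor :: "('o, 'm, 'c) two_cat \<Rightarrow> ('o, 'm, 'c) lax_mor \<Rightarrow> bool" where
  "strict_mor K p \<longleftrightarrow> identity_cell K (lax_cell p)"

definition pseudo_mor :: "('o, 'm, 'c) two_cat \<Rightarrow> ('o, 'm, 'c) lax_mor \<Rightarrow> bool" where
  "pseudo_mor K p \<longleftrightarrow> invertible_cell K (lax_cell p)"

definition jointly_detects :: "('o, 'm, 'c) two_cat \<Rightarrow> ('o, 'm, 'c) monad_data \<Rightarrow>
    (('o, 'm, 'c) lax_mor \<Rightarrow> bool) \<Rightarrow> 'o \<times> 'm \<Rightarrow> 'i set \<Rightarrow> ('i \<Rightarrow> ('o, 'm, 'c) lax_mor) \<Rightarrow> bool" where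
  "jointly_detects K T Q L I p \<longleftrightarrow>
     (\<forall>z \<in> Arr (Alg_lax K T). Cod (Alg_lax K T) z = L \<longrightarrow>
        (\<forall>i \<in> I. Q (p i \<cdot>\<^bsub>Alg_lax K T\<^esub> z)) \<longrightarrow> Q z)"

section \<open>Indexing pairs\<close>

definition indexing_pair :: "('x, 'f, 'g) two_cat \<Rightarrow> 'f set \<Rightarrow> bool" where
  "indexing_pair A S \<longleftrightarrow> two_category A \<and> S \<subseteq> Arr A \<and> (\<forall>X \<in> Ob A. Id A X \<in> S) \<and>
     (\<forall>f \<in> S. \<forall>g \<in> S. Cod A f = Dom A g \<longrightarrow> g \<cdot>\<^bsub>A\<^esub> f \<in> S)"

definition wide_sub :: "('x, 'f, 'g) two_cat \<Rightarrow> 'f set \<Rightarrow> ('x, 'f) cat" where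
  "wide_sub A S = \<lparr>Ob = Ob A, Arr = S, Dom = Dom A, Cod = Cod A, Id = Id A, Comp = Comp A\<rparr>"

definition PIE :: "('x, 'f, 'g) two_cat \<Rightarrow> 'f set \<Rightarrow> bool" where
  "PIE A S \<longleftrightarrow> indexing_pair A S \<and>
     (\<forall>P \<in> components (wide_sub A S). \<exists>X. initial_ob (full_sub (wide_sub A S) P) X)"

text \<open>A choice of one initial object in each connected component.\<close>

definition initial_family :: "('x, 'f, 'g) two_cat \<Rightarrow> 'f set \<Rightarrow> 'x set \<Rightarrow> bool" where
  "initial_family A S I \<longleftrightarrow> I \<subseteq> Ob A \<and>
     (\<forall>P \<in> components (wide_sub A S). \<exists>X. I \<inter> P = {X} \<and> initial_ob (full_sub (wide_sub A S) P) X)"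

text \<open>The element of \<open>I\<close> in the component of \<open>X\<close>, and the arrow of \<open>S\<close> from it to \<open>X\<close>; both
  are unique when \<open>initial_family A S I\<close> holds.\<close>

definition init_ob :: "('x, 'f, 'g) two_cat \<Rightarrow> 'f set \<Rightarrow> 'x set \<Rightarrow> 'x \<Rightarrow> 'x" where
  "init_ob A S I X = (THE X\<^sub>0. X\<^sub>0 \<in> I \<and> (X\<^sub>0, X) \<in> connected_rel (wide_sub A S))"

definition init_arr :: "('x, 'f, 'g) two_cat \<Rightarrow> 'f set \<Rightarrow> 'x set \<Rightarrow> 'x \<Rightarrow> 'f" where
  "init_arr A S I X = (THE f. f \<in> S \<and> f \<in> Hom A (init_ob A S I X) X)"

section \<open>\<open>\<sigma>\<close>-s-oplimits\<close>

text \<open>The components of cones and of cone morphisms are required to be \<open>extensional\<close>, so that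
  equality of the HOL functions is equality of the families indexed by the objects and
  arrows of \<open>A\<close>.\<close>

record ('x, 'f, 'm, 'c) opcone =
  leg :: "'x \<Rightarrow> 'm"
  con :: "'f \<Rightarrow> 'c"

record ('x, 'f, 'm, 'c) opcone_mor =
  cm_dom :: "('x, 'f, 'm, 'c) opcone"
  cm_cod :: "('x, 'f, 'm, 'c) opcone"
  cm_cell :: "'x \<Rightarrow> 'c"

definition oplax_cone :: "('x, 'f, 'g) two_cat \<Rightarrow> ('o, 'm, 'c) two_cat \<Rightarrow>
    ('x, 'f, 'g, 'o, 'm, 'c) two_fun \<Rightarrow> 'o \<Rightarrow> ('x, 'f, 'm, 'c) opcone \<Rightarrow> bool" where
  "oplax_cone A B F E \<theta> \<longleftrightarrow>
     leg \<theta> \<in> extensional (Ob A) \<and> con \<theta> \<in> extensional (Arr A) \<and>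
     (\<forall>X \<in> Ob A. leg \<theta> X \<in> Hom B E (FOb F X)) \<and>
     (\<forall>f \<in> Arr A. con \<theta> f \<in> Hom2 B (leg \<theta> (Cod A f)) (FArr F f \<cdot>\<^bsub>B\<^esub> leg \<theta> (Dom A f))) \<and>
     (\<forall>X \<in> Ob A. con \<theta> (Id A X) = Id2 B (leg \<theta> X)) \<and>
     (\<forall>f \<in> Arr A. \<forall>g \<in> Arr A. Cod A f = Dom A g \<longrightarrow>
        con \<theta> (g \<cdot>\<^bsub>A\<^esub> f) = (FArr F g \<rhd>\<^bsub>B\<^esub> con \<theta> f) \<odot>\<^bsub>B\<^esub> con \<theta> g) \<and>
     (\<forall>\<gamma> \<in> Cell A.
        con \<theta> (Trg A \<gamma>) = (FCell F \<gamma> \<lhd>\<^bsub>B\<^esub> leg \<theta> (Dom A (Src A \<gamma>))) \<odot>\<^bsub>B\<^esub> con \<theta> (Src A \<gamma>))"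

definition sigma_opcone :: "('x, 'f, 'g) two_cat \<Rightarrow> 'f set \<Rightarrow> ('o, 'm, 'c) two_cat \<Rightarrow>
    ('x, 'f, 'g, 'o, 'm, 'c) two_fun \<Rightarrow> 'o \<Rightarrow> ('x, 'f, 'm, 'c) opcone \<Rightarrow> bool" where
  "sigma_opcone A S B F E \<theta> \<longleftrightarrow> oplax_cone A B F E \<theta> \<and> (\<forall>f \<in> S. identity_cell B (con \<theta> f))"

definition opcone_morphism :: "('x, 'f, 'g) two_cat \<Rightarrow> ('o, 'm, 'c) two_cat \<Rightarrow>
    ('x, 'f, 'g, 'o, 'm, 'c) two_fun \<Rightarrow> ('x, 'f, 'm, 'c) opcone \<Rightarrow> ('x, 'f, 'm, 'c) opcone \<Rightarrow>
    ('x \<Rightarrow> 'c) \<Rightarrow> bool" where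
  "opcone_morphism A B F \<theta> \<theta>' \<alpha> \<longleftrightarrow>
     \<alpha> \<in> extensional (Ob A) \<and>
     (\<forall>X \<in> Ob A. \<alpha> X \<in> Hom2 B (leg \<theta> X) (leg \<theta>' X)) \<and>
     (\<forall>f \<in> Arr A. (FArr F f \<rhd>\<^bsub>B\<^esub> \<alpha> (Dom A f)) \<odot>\<^bsub>B\<^esub> con \<theta> f = con \<theta>' f \<odot>\<^bsub>B\<^esub> \<alpha> (Cod A f))"

definition sigma_opcone_cat :: "('x, 'f, 'g) two_cat \<Rightarrow> 'f set \<Rightarrow> ('o, 'm, 'c) two_cat \<Rightarrow>
    ('x, 'f, 'g, 'o, 'm, 'c) two_fun \<Rightarrow> 'o \<Rightarrow>
    (('x, 'f, 'm, 'c) opcone, ('x, 'f, 'm, 'c) opcone_mor) cat" where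
  "sigma_opcone_cat A S B F E =
     \<lparr>Ob = {\<theta>. sigma_opcone A S B F E \<theta>},
      Arr = {\<lparr>cm_dom = \<theta>, cm_cod = \<theta>', cm_cell = \<alpha>\<rparr> |\<theta> \<theta>' \<alpha>. sigma_opcone A S B F E \<theta> \<and>
               sigma_opcone A S B F E \<theta>' \<and> opcone_morphism A B F \<theta> \<theta>' \<alpha>},
      Dom = cm_dom, Cod = cm_cod,
      Id = (\<lambda>\<theta>. \<lparr>cm_dom = \<theta>, cm_cod = \<theta>, cm_cell = (\<lambda>X\<in>Ob A. Id2 B (leg \<theta> X))\<rparr>),
      Comp = (\<lambda>q p. \<lparr>cm_dom = cm_dom p, cm_cod = cm_cod q,
               cm_cell = (\<lambda>X\<in>Ob A. cm_cell q X \<odot>\<^bsub>B\<^esub> cm_cell p X)\<rparr>)\<rparr>"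

definition precomp :: "('x, 'f, 'g) two_cat \<Rightarrow> ('o, 'm, 'c) two_cat \<Rightarrow>
    ('x, 'f, 'm, 'c) opcone \<Rightarrow> 'm \<Rightarrow> ('x, 'f, 'm, 'c) opcone" where
  "precomp A B \<pi> h = \<lparr>leg = (\<lambda>X\<in>Ob A. leg \<pi> X \<cdot>\<^bsub>B\<^esub> h), con = (\<lambda>f\<in>Arr A. con \<pi> f \<lhd>\<^bsub>B\<^esub> h)\<rparr>"

definition precomp2 :: "('x, 'f, 'g) two_cat \<Rightarrow> ('o, 'm, 'c) two_cat \<Rightarrow>
    ('x, 'f, 'm, 'c) opcone \<Rightarrow> 'c \<Rightarrow> ('x, 'f, 'm, 'c) opcone_mor" where
  "precomp2 A B \<pi> \<alpha> = \<lparr>cm_dom = precomp A B \<pi> (Src B \<alpha>), cm_cod = precomp A B \<pi> (Trg B \<alpha>),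
     cm_cell = (\<lambda>X\<in>Ob A. leg \<pi> X \<rhd>\<^bsub>B\<^esub> \<alpha>)\<rparr>"

definition is_sigma_oplimit :: "('x, 'f, 'g) two_cat \<Rightarrow> 'f set \<Rightarrow> ('o, 'm, 'c) two_cat \<Rightarrow>
    ('x, 'f, 'g, 'o, 'm, 'c) two_fun \<Rightarrow> 'o \<Rightarrow> ('x, 'f, 'm, 'c) opcone \<Rightarrow> bool" where
  "is_sigma_oplimit A S B F L \<pi> \<longleftrightarrow>
     L \<in> Ob B \<and> sigma_opcone A S B F L \<pi> \<and>
     (\<forall>E \<in> Ob B. cat_iso (hom_cat B E L) (sigma_opcone_cat A S B F E)
        (precomp A B \<pi>) (precomp2 A B \<pi>))"

definition map_opcone :: "('x, 'f, 'g) two_cat \<Rightarrow> ('o, 'm, 'c, 'p, 'n, 'd) two_fun \<Rightarrow>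
    ('x, 'f, 'm, 'c) opcone \<Rightarrow> ('x, 'f, 'n, 'd) opcone" where
  "map_opcone A U \<theta> = \<lparr>leg = (\<lambda>X\<in>Ob A. FArr U (leg \<theta> X)), con = (\<lambda>f\<in>Arr A. FCell U (con \<theta> f))\<rparr>"

definition creates_sigma_oplimit :: "('x, 'f, 'g) two_cat \<Rightarrow> 'f set \<Rightarrow> ('o, 'm, 'c) two_cat \<Rightarrow>
    ('p, 'n, 'd) two_cat \<Rightarrow> ('o, 'm, 'c, 'p, 'n, 'd) two_fun \<Rightarrow>
    ('x, 'f, 'g, 'o, 'm, 'c) two_fun \<Rightarrow> bool" where
  "creates_sigma_oplimit A S B K U F \<longleftrightarrow>
     ((\<exists>L \<pi>. is_sigma_oplimit A S K (two_fun_comp U F) L \<pi>) \<longrightarrow>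
        (\<exists>L \<pi>. is_sigma_oplimit A S B F L \<pi>) \<and>
        (\<forall>L \<pi>. is_sigma_oplimit A S B F L \<pi> \<longrightarrow>
           is_sigma_oplimit A S K (two_fun_comp U F) (FOb U L) (map_opcone A U \<pi>)))"

end

(* Let X0 be the initial object of the component of X and f_X : X0 -> X.  A structure map l : TL -> L
   making the projections pi_X0 strict must satisfy pi_X0 l = a_X0 T(pi_X0), and then pi_X = F f_X pi_X0
   has to carry the 2-cell lam_X = phi_(f_X) T(pi_X0) : a_X T(pi_X) => pi_X l, where phi_f is the 2-cell
   of the lax morphism F f.  The arrows a_X T(pi_X) form an op-lax cone with 2-cells
   (phi_f T(pi_X)) o (a_Y T(pi_f)).  As each lam_X is invertible, this cone can be transported along lam,
   and the result is a sigma-s-opcone: for f in Sigma the equation f f_X = f_Y gives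
   lam_Y = (F f lam_X) o (phi_f T(pi_X)).  So l (named str below) exists.  Every further equation
   between 2-cells into L is checked after composing with pi_X, cancelling the invertible lam_X. *)
theory Submission
  imports Defs
begin

section \<open>Whiskering and invertible 2-cells\<close>

text \<open>The arrows a_X T(pi_X) alone induce no arrow into L: at f in Sigma their 2-cell is phi_f
  T(pi_X), which need not be an identity, so they form an op-lax cone but in general no
  sigma-s-opcone. Conjugating by lam repairs exactly this. Once l exists, lam_X : a_X T(pi_X) =>
  pi_X l is also the lax structure of pi_X. The algebra laws for l are equations between arrows into
  L, so they are tested on the 2-cells pi_f as well as on the legs; agreement of the legs is read
  off from the boundaries of the unit and multiplication laws of lam. A lax structure chi on an
  arrow h into L is forced: if mu_X is the 2-cell of the composite with pi_X, then pi_X chi = mu_X o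
  (lam_X T(h))^-1. Detection rests on pi_X = F f_X pi_X0 and on lam being an identity at X0:
  together they make pi_X chi equal to F f_X whiskered with the 2-cell of the composite with pi_X0.
  Preservation concerns an arbitrary limit cone of lax morphisms; it is isomorphic to the lifted
  one, and the isomorphism has an isomorphism of K underneath.\<close>

text \<open>The simplifier brings a pasting of 2-cells into the normal form of a right-nested vertical
  composite of whiskered cells \<open>g \<rhd> (\<alpha> \<lhd> f)\<close>; the exchange law \<open>whisker_exchange\<close>
  has no preferred direction and is applied by hand.\<close>

lemma mem_Hom [simp]: "f \<in> Hom C A B \<longleftrightarrow> f \<in> Arr C \<and> Dom C f = A \<and> Cod C f = B"
  by (simp add: Hom_def)

lemma mem_Hom2 [simp]: "\<alpha> \<in> Hom2 K f g \<longleftrightarrow> \<alpha> \<in> Cell K \<and> Src K \<alpha> = f \<and> Trg K \<alpha> = g"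
  by (simp add: Hom2_def)

context category
begin

lemmas [simp] = dom_ob cod_ob

lemma id_typing [simp]:
  assumes "A \<in> Ob C"
  shows "Id C A \<in> Arr C" "Dom C (Id C A) = A" "Cod C (Id C A) = A"
  using id_hom [OF assms] by simp_all

lemma comp_typing [simp]:
  assumes "f \<in> Arr C" "g \<in> Arr C" "Cod C f = Dom C g"
  shows "g \<cdot> f \<in> Arr C" "Dom C (g \<cdot> f) = Dom C f" "Cod C (g \<cdot> f) = Cod C g"
  using comp_hom [OF assms] by simp_all

lemma comp_Id_right [simp]: "f \<in> Arr C \<Longrightarrow> Dom C f = X \<Longrightarrow> f \<cdot> Id C X = f"
  using id_right by blast

lemma comp_Id_left [simp]: "f \<in> Arr C \<Longrightarrow> Cod C f = X \<Longrightarrow> Id C X \<cdot> f = f"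
  using id_left by blast

lemmas [simp] = comp_assoc

end

context two_category
begin

lemma src_trg_typing [simp]:
  assumes "\<alpha> \<in> Cell K"
  shows "Src K \<alpha> \<in> Arr K" "Trg K \<alpha> \<in> Arr K"
    "Dom K (Trg K \<alpha>) = Dom K (Src K \<alpha>)" "Cod K (Trg K \<alpha>) = Cod K (Src K \<alpha>)"
  using category.dom_ob [OF vert_category, of \<alpha>] category.cod_ob [OF vert_category, of \<alpha>]
    cell_dom cell_cod assms
  by (simp_all add: vert_cat_def)

lemma Id2_typing [simp]:
  assumes "f \<in> Arr K"
  shows "Id2 K f \<in> Cell K" "Src K (Id2 K f) = f" "Trg K (Id2 K f) = f"
  using category.id_typing [OF vert_category, of f] assms by (simp_all add: vert_cat_def)

lemma vcomp_typing [simp]: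
  assumes "\<alpha> \<in> Cell K" "\<beta> \<in> Cell K" "Trg K \<alpha> = Src K \<beta>"
  shows "\<beta> \<odot> \<alpha> \<in> Cell K" "Src K (\<beta> \<odot> \<alpha>) = Src K \<alpha>" "Trg K (\<beta> \<odot> \<alpha>) = Trg K \<beta>"
  using category.comp_typing [OF vert_category, of \<alpha> \<beta>] assms by (simp_all add: vert_cat_def)

lemma vcomp_Id2_right [simp]: "\<alpha> \<in> Cell K \<Longrightarrow> Src K \<alpha> = f \<Longrightarrow> \<alpha> \<odot> Id2 K f = \<alpha>"
  using category.comp_Id_right [OF vert_category, of \<alpha>] by (simp add: vert_cat_def)

lemma vcomp_Id2_left [simp]: "\<alpha> \<in> Cell K \<Longrightarrow> Trg K \<alpha> = f \<Longrightarrow> Id2 K f \<odot> \<alpha> = \<alpha>"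
  using category.comp_Id_left [OF vert_category, of \<alpha>] by (simp add: vert_cat_def)

lemma vcomp_assoc [simp]:
  "\<lbrakk>\<alpha> \<in> Cell K; \<beta> \<in> Cell K; \<gamma> \<in> Cell K; Trg K \<alpha> = Src K \<beta>; Trg K \<beta> = Src K \<gamma>\<rbrakk>
    \<Longrightarrow> (\<gamma> \<odot> \<beta>) \<odot> \<alpha> = \<gamma> \<odot> (\<beta> \<odot> \<alpha>)"
  using category.comp_assoc [OF vert_category, of \<alpha> \<beta> \<gamma>] by (simp add: vert_cat_def)

lemma hcomp_typing [simp]:
  assumes "\<alpha> \<in> Cell K" "\<beta> \<in> Cell K" "Cod K (Src K \<alpha>) = Dom K (Src K \<beta>)"
  shows "\<beta> \<star> \<alpha> \<in> Cell K" "Src K (\<beta> \<star> \<alpha>) = Src K \<beta> \<cdot> Src K \<alpha>"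
    "Trg K (\<beta> \<star> \<alpha>) = Trg K \<beta> \<cdot> Trg K \<alpha>"
  using hcomp_hom [OF assms] by simp_all

lemmas [simp] = hcomp_id2

lemma whisker_Id_right [simp]: "\<alpha> \<in> Cell K \<Longrightarrow> Dom K (Src K \<alpha>) = X \<Longrightarrow> \<alpha> \<lhd> Id K X = \<alpha>"
  using hcomp_id_right by blast

lemma whisker_Id_left [simp]: "\<alpha> \<in> Cell K \<Longrightarrow> Cod K (Src K \<alpha>) = X \<Longrightarrow> Id K X \<rhd> \<alpha> = \<alpha>"
  using hcomp_id_left by blast

lemmas [simp] = hcomp_assoc

lemma whisker_left_left [simp]:
  assumes "\<alpha> \<in> Cell K" "f \<in> Arr K" "g \<in> Arr K" "Cod K (Src K \<alpha>) = Dom K f" "Cod K f = Dom K g"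
  shows "g \<rhd> (f \<rhd> \<alpha>) = (g \<cdot> f) \<rhd> \<alpha>"
  using assms hcomp_assoc [of \<alpha> "Id2 K f" "Id2 K g"] by simp

text \<open>Opposite to the simp normal form, which merges the two whiskerings; used to expose an
  inner whiskering to which a law applies.\<close>

lemma whisker_right_right:
  "\<lbrakk>\<alpha> \<in> Cell K; f \<in> Arr K; g \<in> Arr K; Cod K f = Dom K (Src K \<alpha>); Cod K g = Dom K f\<rbrakk>
    \<Longrightarrow> \<alpha> \<lhd> (f \<cdot> g) = (\<alpha> \<lhd> f) \<lhd> g"
  by simp

lemma whisker_left_vcomp [simp]:
  assumes "\<alpha> \<in> Cell K" "\<beta> \<in> Cell K" "g \<in> Arr K" "Trg K \<alpha> = Src K \<beta>" "Cod K (Src K \<alpha>) = Dom K g"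
  shows "g \<rhd> (\<beta> \<odot> \<alpha>) = (g \<rhd> \<beta>) \<odot> (g \<rhd> \<alpha>)"
  using interchange [of \<alpha> \<beta> "Id2 K g" "Id2 K g"] assms by simp

lemma whisker_right_vcomp [simp]:
  assumes "\<alpha> \<in> Cell K" "\<beta> \<in> Cell K" "f \<in> Arr K" "Trg K \<alpha> = Src K \<beta>" "Cod K f = Dom K (Src K \<alpha>)"
  shows "(\<beta> \<odot> \<alpha>) \<lhd> f = (\<beta> \<lhd> f) \<odot> (\<alpha> \<lhd> f)"
  using interchange [of "Id2 K f" "Id2 K f" \<alpha> \<beta>] assms by simp

text \<open>Interchange with identity cells inserted, in the two possible orders; comparing the
  results gives the exchange law.\<close>

lemma hcomp_whisker:
  assumes "\<alpha> \<in> Cell K" "\<beta> \<in> Cell K" "Cod K (Src K \<alpha>) = Dom K (Src K \<beta>)"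
  shows "\<beta> \<star> \<alpha> = (\<beta> \<lhd> Trg K \<alpha>) \<odot> (Src K \<beta> \<rhd> \<alpha>)"
    and "\<beta> \<star> \<alpha> = (Trg K \<beta> \<rhd> \<alpha>) \<odot> (\<beta> \<lhd> Src K \<alpha>)"
  using interchange [of \<alpha> "Id2 K (Trg K \<alpha>)" "Id2 K (Src K \<beta>)" \<beta>]
    interchange [of "Id2 K (Src K \<alpha>)" \<alpha> \<beta> "Id2 K (Trg K \<beta>)"] assms by simp_all

lemma whisker_exchange:
  assumes "\<alpha> \<in> Hom2 K f f'" "\<beta> \<in> Hom2 K g g'" "Cod K f = Dom K g"
  shows "(\<beta> \<lhd> f') \<odot> (g \<rhd> \<alpha>) = (g' \<rhd> \<alpha>) \<odot> (\<beta> \<lhd> f)"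
  using hcomp_whisker [of \<alpha> \<beta>] assms by auto

text \<open>Vertical composites are nested to the right, so an equation between two-fold composites
  no longer matches once a further cell follows on the right. This form carries that tail
  \<open>\<epsilon>\<close> along.\<close>

lemma vcomp_assoc_subst:
  assumes "\<alpha> \<odot> \<beta> = \<gamma> \<odot> \<delta>" "\<alpha> \<in> Cell K" "\<beta> \<in> Cell K" "\<gamma> \<in> Cell K" "\<delta> \<in> Cell K" "\<epsilon> \<in> Cell K"
    "Trg K \<beta> = Src K \<alpha>" "Trg K \<delta> = Src K \<gamma>" "Trg K \<epsilon> = Src K \<beta>"  "Trg K \<epsilon> = Src K \<delta>"
  shows "\<alpha> \<odot> (\<beta> \<odot> \<epsilon>) = \<gamma> \<odot> (\<delta> \<odot> \<epsilon>)"
  using assms vcomp_assoc [of \<epsilon> \<beta> \<alpha>] vcomp_assoc [of \<epsilon> \<delta> \<gamma>] by simp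

text \<open>Meaningful on invertible cells only. With \<open>SOME\<close>, existence of an inverse
  suffices and its uniqueness need not be established first.\<close>

definition inv_cell :: "'c \<Rightarrow> 'c" where
  "inv_cell \<alpha> = (SOME \<beta>. \<beta> \<in> Hom2 K (Trg K \<alpha>) (Src K \<alpha>) \<and>
     \<beta> \<odot> \<alpha> = Id2 K (Src K \<alpha>) \<and> \<alpha> \<odot> \<beta> = Id2 K (Trg K \<alpha>))"

lemma inv_cell [simp]:
  assumes "invertible_cell K \<alpha>"
  shows "inv_cell \<alpha> \<in> Cell K" "Src K (inv_cell \<alpha>) = Trg K \<alpha>" "Trg K (inv_cell \<alpha>) = Src K \<alpha>"
    "inv_cell \<alpha> \<odot> \<alpha> = Id2 K (Src K \<alpha>)" "\<alpha> \<odot> inv_cell \<alpha> = Id2 K (Trg K \<alpha>)"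
proof -
  have "\<exists>\<beta>. \<beta> \<in> Hom2 K (Trg K \<alpha>) (Src K \<alpha>) \<and>
     \<beta> \<odot> \<alpha> = Id2 K (Src K \<alpha>) \<and> \<alpha> \<odot> \<beta> = Id2 K (Trg K \<alpha>)"
    using assms by (auto simp: invertible_cell_def)
  from someI_ex [OF this] show
    "inv_cell \<alpha> \<in> Cell K" "Src K (inv_cell \<alpha>) = Trg K \<alpha>" "Trg K (inv_cell \<alpha>) = Src K \<alpha>"
    "inv_cell \<alpha> \<odot> \<alpha> = Id2 K (Src K \<alpha>)" "\<alpha> \<odot> inv_cell \<alpha> = Id2 K (Trg K \<alpha>)"
    unfolding inv_cell_def by auto
qed

lemma invertible_cell_Cell: "invertible_cell K \<alpha> \<Longrightarrow> \<alpha> \<in> Cell K"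
  by (simp add: invertible_cell_def)

lemma invertible_cellI:
  assumes "\<alpha> \<in> Cell K" "\<beta> \<in> Cell K" "Src K \<beta> = Trg K \<alpha>" "Trg K \<beta> = Src K \<alpha>"
    "\<beta> \<odot> \<alpha> = Id2 K (Src K \<alpha>)" "\<alpha> \<odot> \<beta> = Id2 K (Trg K \<alpha>)"
  shows "invertible_cell K \<alpha>"
  using assms by (auto simp: invertible_cell_def intro!: bexI [of _ \<beta>])

lemma invertible_whisker_right [simp]:
  assumes "invertible_cell K \<alpha>" "f \<in> Arr K" "Cod K f = Dom K (Src K \<alpha>)"
  shows "invertible_cell K (\<alpha> \<lhd> f)"
  using assms invertible_cell_Cell [OF assms(1)]
    whisker_right_vcomp [of \<alpha> "inv_cell \<alpha>" f] whisker_right_vcomp [of "inv_cell \<alpha>" \<alpha> f]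
  by (intro invertible_cellI [of _ "inv_cell \<alpha> \<lhd> f"]) simp_all

lemma invertible_whisker_left [simp]:
  assumes "invertible_cell K \<alpha>" "g \<in> Arr K" "Cod K (Src K \<alpha>) = Dom K g"
  shows "invertible_cell K (g \<rhd> \<alpha>)"
  using assms invertible_cell_Cell [OF assms(1)]
    whisker_left_vcomp [of \<alpha> "inv_cell \<alpha>" g] whisker_left_vcomp [of "inv_cell \<alpha>" \<alpha> g]
  by (intro invertible_cellI [of _ "g \<rhd> inv_cell \<alpha>"]) simp_all

lemma invertible_cancel_right:
  assumes "\<beta> \<odot> \<alpha> = \<gamma> \<odot> \<alpha>" "invertible_cell K \<alpha>" "\<beta> \<in> Cell K" "\<gamma> \<in> Cell K"
    "Src K \<beta> = Trg K \<alpha>" "Src K \<gamma> = Trg K \<alpha>"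
  shows "\<beta> = \<gamma>"
proof -
  have "\<beta> = (\<beta> \<odot> \<alpha>) \<odot> inv_cell \<alpha>" "\<gamma> = (\<gamma> \<odot> \<alpha>) \<odot> inv_cell \<alpha>"
    using assms(2-) invertible_cell_Cell [OF assms(2)] by simp_all
  with assms(1) show ?thesis by simp
qed

text \<open>The cancellation of an inverse pair in the shape in which it occurs inside right-nested
  pastings: under a whiskering and in front of a tail \<open>\<beta>\<close>.\<close>

lemma whisker_inv_cell_cancel:
  assumes \<alpha>: "invertible_cell K \<alpha>" and g: "g \<in> Arr K" "Cod K (Src K \<alpha>) = Dom K g"
    and \<beta>: "\<beta> \<in> Cell K" "Trg K \<beta> = g \<cdot> Src K \<alpha>"
  shows "(g \<rhd> inv_cell \<alpha>) \<odot> ((g \<rhd> \<alpha>) \<odot> \<beta>) = \<beta>"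
proof -
  have [simp]: "\<alpha> \<in> Cell K" using \<alpha> by (rule invertible_cell_Cell)
  \<comment> \<open>The right side has to be distributed over the whiskering before the pair
    cancels, hence the removal of \<open>inv_cell(4)\<close> from the simp set here.\<close>
  have "(g \<rhd> inv_cell \<alpha>) \<odot> ((g \<rhd> \<alpha>) \<odot> \<beta>) = (g \<rhd> (inv_cell \<alpha> \<odot> \<alpha>)) \<odot> \<beta>"
    using \<alpha> g \<beta> by (simp del: inv_cell(4))
  then show ?thesis using \<alpha> g \<beta> by simp
qed

end

section \<open>The 2-category of algebras and lax morphisms\<close>

locale monad_context = two_category K for K :: "('o, 'm, 'c) two_cat" (structure) +
  fixes T :: "('o, 'm, 'c) monad_data"
  assumes monad: "two_monad K T"
begin

section \<open>The 2-monad: functoriality and naturality as rewrite rules\<close>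

abbreviation "T0 \<equiv> FOb T"
abbreviation "T1 \<equiv> FArr T"
abbreviation "T2 \<equiv> FCell T"

lemma T_functor: "functor_between K K T0 T1"
  and T_vfunctor: "functor_between (vert_cat K) (vert_cat K) T1 T2"
  and T_unit: "two_natural K K two_fun_id T (Unit T)"
  and T_mult: "two_natural K K (two_fun_comp T T) T (Mult T)"
  using monad unfolding two_monad_def two_functor_def by blast+

lemma T0_Ob [simp]: "X \<in> Ob K \<Longrightarrow> T0 X \<in> Ob K"
  and T1_Id [simp]: "X \<in> Ob K \<Longrightarrow> T1 (Id K X) = Id K (T0 X)"
  and T1_typing [simp]: "f \<in> Arr K \<Longrightarrow> T1 f \<in> Arr K" "f \<in> Arr K \<Longrightarrow> Dom K (T1 f) = T0 (Dom K f)"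
    "f \<in> Arr K \<Longrightarrow> Cod K (T1 f) = T0 (Cod K f)"
  and T1_comp [simp]: "\<lbrakk>f \<in> Arr K; g \<in> Arr K; Cod K f = Dom K g\<rbrakk> \<Longrightarrow> T1 (g \<cdot> f) = T1 g \<cdot> T1 f"
  using T_functor by (simp_all add: functor_between_def)

lemma T2_typing [simp]: "\<alpha> \<in> Cell K \<Longrightarrow> T2 \<alpha> \<in> Cell K" "\<alpha> \<in> Cell K \<Longrightarrow> Src K (T2 \<alpha>) = T1 (Src K \<alpha>)"
    "\<alpha> \<in> Cell K \<Longrightarrow> Trg K (T2 \<alpha>) = T1 (Trg K \<alpha>)"
  and T2_Id2 [simp]: "f \<in> Arr K \<Longrightarrow> T2 (Id2 K f) = Id2 K (T1 f)"
  and T2_vcomp [simp]: "\<lbrakk>\<alpha> \<in> Cell K; \<beta> \<in> Cell K; Trg K \<alpha> = Src K \<beta>\<rbrakk> \<Longrightarrow> T2 (\<beta> \<odot> \<alpha>) = T2 \<beta> \<odot> T2 \<alpha>"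
  using T_vfunctor by (simp_all add: functor_between_def vert_cat_def)

lemma T2_hcomp [simp]: "\<lbrakk>\<alpha> \<in> Cell K; \<beta> \<in> Cell K; Cod K (Src K \<alpha>) = Dom K (Src K \<beta>)\<rbrakk>
    \<Longrightarrow> T2 (\<beta> \<star> \<alpha>) = T2 \<beta> \<star> T2 \<alpha>"
  using monad unfolding two_monad_def two_functor_def by blast

lemma unit_typing [simp]: "X \<in> Ob K \<Longrightarrow> Unit T X \<in> Arr K" "X \<in> Ob K \<Longrightarrow> Dom K (Unit T X) = X"
    "X \<in> Ob K \<Longrightarrow> Cod K (Unit T X) = T0 X"
  and unit_natural: "f \<in> Arr K \<Longrightarrow> T1 f \<cdot> Unit T (Dom K f) = Unit T (Cod K f) \<cdot> f"
  and unit_natural2: "\<alpha> \<in> Cell K \<Longrightarrow>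
    T2 \<alpha> \<lhd> Unit T (Dom K (Src K \<alpha>)) = Unit T (Cod K (Src K \<alpha>)) \<rhd> \<alpha>"
  using T_unit by (simp_all add: two_natural_def two_fun_id_def)

lemma mult_typing [simp]: "X \<in> Ob K \<Longrightarrow> Mult T X \<in> Arr K" "X \<in> Ob K \<Longrightarrow> Dom K (Mult T X) = T0 (T0 X)"
    "X \<in> Ob K \<Longrightarrow> Cod K (Mult T X) = T0 X"
  and mult_natural: "f \<in> Arr K \<Longrightarrow> T1 f \<cdot> Mult T (Dom K f) = Mult T (Cod K f) \<cdot> T1 (T1 f)"
  and mult_natural2: "\<alpha> \<in> Cell K \<Longrightarrow>
    T2 \<alpha> \<lhd> Mult T (Dom K (Src K \<alpha>)) = Mult T (Cod K (Src K \<alpha>)) \<rhd> T2 (T2 \<alpha>)"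
  using T_mult by (simp_all add: two_natural_def two_fun_comp_def)

section \<open>Algebras, lax morphisms and their 2-cells, and the closure of these under
  composition\<close>

lemma algebra_iff: "X \<in> algebras K T \<longleftrightarrow> fst X \<in> Ob K \<and> snd X \<in> Hom K (T0 (fst X)) (fst X) \<and>
    snd X \<cdot> Unit T (fst X) = Id K (fst X) \<and> snd X \<cdot> Mult T (fst X) = snd X \<cdot> T1 (snd X)"
  by (cases X) (simp add: algebras_def)

lemma lax_morphism_iff: "p \<in> lax_morphisms K T \<longleftrightarrow> lax_dom p \<in> algebras K T \<and> lax_cod p \<in> algebras K T \<and>
    lax_arr p \<in> Hom K (fst (lax_dom p)) (fst (lax_cod p)) \<and>
    lax_cell p \<in> Hom2 K (snd (lax_cod p) \<cdot> T1 (lax_arr p)) (lax_arr p \<cdot> snd (lax_dom p)) \<and>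
    lax_cell p \<lhd> Unit T (fst (lax_dom p)) = Id2 K (lax_arr p) \<and>
    lax_cell p \<lhd> Mult T (fst (lax_dom p)) =
      (lax_cell p \<lhd> T1 (snd (lax_dom p))) \<odot> (snd (lax_cod p) \<rhd> T2 (lax_cell p))"
  by (cases p) (auto simp: lax_morphisms_def)

lemma alg_cell_iff: "\<alpha> \<in> alg_cells K T \<longleftrightarrow>
     alg_src \<alpha> \<in> lax_morphisms K T \<and> alg_trg \<alpha> \<in> lax_morphisms K T \<and>
     lax_dom (alg_src \<alpha>) = lax_dom (alg_trg \<alpha>) \<and> lax_cod (alg_src \<alpha>) = lax_cod (alg_trg \<alpha>) \<and>
     alg_under \<alpha> \<in> Hom2 K (lax_arr (alg_src \<alpha>)) (lax_arr (alg_trg \<alpha>)) \<and>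
     (alg_under \<alpha> \<lhd> snd (lax_dom (alg_src \<alpha>))) \<odot> lax_cell (alg_src \<alpha>)
       = lax_cell (alg_trg \<alpha>) \<odot> (snd (lax_cod (alg_src \<alpha>)) \<rhd> T2 (alg_under \<alpha>))"
  by (cases \<alpha>) (auto simp: alg_cells_def)

lemma algebra_typing [simp]:
  assumes "X \<in> algebras K T"
  shows "fst X \<in> Ob K" "snd X \<in> Arr K" "Dom K (snd X) = T0 (fst X)" "Cod K (snd X) = fst X"
  using assms unfolding algebra_iff mem_Hom by blast+

lemma algebra_laws:
  assumes "X \<in> algebras K T"
  shows "snd X \<cdot> Unit T (fst X) = Id K (fst X)" "snd X \<cdot> Mult T (fst X) = snd X \<cdot> T1 (snd X)"
  using assms unfolding algebra_iff by blast+

lemma lax_typing [simp]: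
  assumes "p \<in> lax_morphisms K T"
  shows "lax_dom p \<in> algebras K T" "lax_cod p \<in> algebras K T"
    "lax_arr p \<in> Arr K" "Dom K (lax_arr p) = fst (lax_dom p)" "Cod K (lax_arr p) = fst (lax_cod p)"
    "lax_cell p \<in> Cell K" "Src K (lax_cell p) = snd (lax_cod p) \<cdot> T1 (lax_arr p)"
    "Trg K (lax_cell p) = lax_arr p \<cdot> snd (lax_dom p)"
  using assms unfolding lax_morphism_iff mem_Hom mem_Hom2 by blast+

lemma lax_laws:
  assumes "p \<in> lax_morphisms K T"
  shows "lax_cell p \<lhd> Unit T (fst (lax_dom p)) = Id2 K (lax_arr p)"
    "lax_cell p \<lhd> Mult T (fst (lax_dom p)) =
      (lax_cell p \<lhd> T1 (snd (lax_dom p))) \<odot> (snd (lax_cod p) \<rhd> T2 (lax_cell p))"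
  using assms unfolding lax_morphism_iff by blast+

lemma alg_cell_typing [simp]:
  assumes "\<alpha> \<in> alg_cells K T"
  shows "alg_src \<alpha> \<in> lax_morphisms K T" "alg_trg \<alpha> \<in> lax_morphisms K T"
     "lax_dom (alg_trg \<alpha>) = lax_dom (alg_src \<alpha>)" "lax_cod (alg_trg \<alpha>) = lax_cod (alg_src \<alpha>)"
     "alg_under \<alpha> \<in> Cell K" "Src K (alg_under \<alpha>) = lax_arr (alg_src \<alpha>)"
     "Trg K (alg_under \<alpha>) = lax_arr (alg_trg \<alpha>)"
  using assms unfolding alg_cell_iff mem_Hom2 by metis+

lemma alg_cell_law: "\<alpha> \<in> alg_cells K T \<Longrightarrow>
   (alg_under \<alpha> \<lhd> snd (lax_dom (alg_src \<alpha>))) \<odot> lax_cell (alg_src \<alpha>)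
       = lax_cell (alg_trg \<alpha>) \<odot> (snd (lax_cod (alg_src \<alpha>)) \<rhd> T2 (alg_under \<alpha>))"
  unfolding alg_cell_iff by blast

lemma Alg_sel [simp]:
  "Ob (Alg_lax K T) = algebras K T" "Arr (Alg_lax K T) = lax_morphisms K T"
  "Dom (Alg_lax K T) = lax_dom" "Cod (Alg_lax K T) = lax_cod" "Id (Alg_lax K T) = lax_id K"
  "Comp (Alg_lax K T) = lax_comp K T" "Cell (Alg_lax K T) = alg_cells K T"
  "Src (Alg_lax K T) = alg_src" "Trg (Alg_lax K T) = alg_trg"
  "Id2 (Alg_lax K T) p = \<lparr>alg_src = p, alg_trg = p, alg_under = Id2 K (lax_arr p)\<rparr>"
  "VComp (Alg_lax K T) \<beta> \<alpha> = \<lparr>alg_src = alg_src \<alpha>, alg_trg = alg_trg \<beta>,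
        alg_under = alg_under \<beta> \<odot>\<^bsub>K\<^esub> alg_under \<alpha>\<rparr>"
  "HComp (Alg_lax K T) \<beta> \<alpha> = \<lparr>alg_src = lax_comp K T (alg_src \<beta>) (alg_src \<alpha>),
        alg_trg = lax_comp K T (alg_trg \<beta>) (alg_trg \<alpha>),
        alg_under = alg_under \<beta> \<star>\<^bsub>K\<^esub> alg_under \<alpha>\<rparr>"
  by (simp_all add: Alg_lax_def)

lemma lax_comp_sel [simp]:
  "lax_dom (lax_comp K T q p) = lax_dom p" "lax_cod (lax_comp K T q p) = lax_cod q"
  "lax_arr (lax_comp K T q p) = lax_arr q \<cdot> lax_arr p"
  "lax_cell (lax_comp K T q p) = (lax_arr q \<rhd> lax_cell p) \<odot> (lax_cell q \<lhd> T1 (lax_arr p))"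
  by (simp_all add: lax_comp_def)

lemma lax_id_sel [simp]:
  "lax_dom (lax_id K X) = X" "lax_cod (lax_id K X) = X"
  "lax_arr (lax_id K X) = Id K (fst X)" "lax_cell (lax_id K X) = Id2 K (snd X)"
  by (simp_all add: lax_id_def)

lemma lax_id_lax [simp]: "X \<in> algebras K T \<Longrightarrow> lax_id K X \<in> lax_morphisms K T"
  by (simp add: lax_morphism_iff algebra_laws)

text \<open>Naturality of unit and multiplication at \<open>f\<close> moves the laws of
  \<open>q\<close> across \<open>T1 f\<close>. In the multiplication law the pasted laws of
  \<open>p\<close> and \<open>q\<close> then differ only by the order of \<open>T2 \<phi>\<close>
  and \<open>\<gamma>\<close>, which \<open>ex\<close> exchanges.\<close>

lemma lax_comp_lax [simp]:
  assumes p: "p \<in> lax_morphisms K T" and q: "q \<in> lax_morphisms K T" and pq: "lax_cod p = lax_dom q"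
  shows "lax_comp K T q p \<in> lax_morphisms K T"
proof -
  define A a B b C c f g \<phi> \<gamma> where "A = fst (lax_dom p)" and "a = snd (lax_dom p)"
    and "B = fst (lax_cod p)" and "b = snd (lax_cod p)" and "C = fst (lax_cod q)" and "c = snd (lax_cod q)"
    and "f = lax_arr p" and "g = lax_arr q" and "\<phi> = lax_cell p" and "\<gamma> = lax_cell q"
  note d = this
  have eqs: "lax_dom p = (A, a)" "lax_cod p = (B, b)" "lax_dom q = (B, b)" "lax_cod q = (C, c)"
    "lax_arr p = f" "lax_arr q = g" "lax_cell p = \<phi>" "lax_cell q = \<gamma>"
    by (simp_all add: d pq)
  have alg: "(A, a) \<in> algebras K T" "(B, b) \<in> algebras K T" "(C, c) \<in> algebras K T"
    using lax_typing(1,2) [OF p] lax_typing(2) [OF q] by (simp_all only: eqs)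
  note pl = lax_laws [OF p, unfolded eqs fst_conv snd_conv] and ql = lax_laws [OF q, unfolded eqs fst_conv snd_conv]
  note al [simp] = alg [THEN algebra_typing(1)] alg [THEN algebra_typing(2)] alg [THEN algebra_typing(3)] alg [THEN algebra_typing(4)]
  note al' [simp] = al [unfolded fst_conv snd_conv]
  note ty [simp] = lax_typing(3-) [OF p, unfolded eqs fst_conv snd_conv] lax_typing(3-) [OF q, unfolded eqs fst_conv snd_conv]
  have un: "T1 f \<cdot> Unit T A = Unit T B \<cdot> f" "T1 f \<cdot> Mult T A = Mult T B \<cdot> T1 (T1 f)"
    using unit_natural [of f] mult_natural [of f] by simp_all
  have 1: "\<gamma> \<lhd> (Unit T B \<cdot> f) = Id2 K g \<lhd> f"
    using ql(1) hcomp_assoc [of "Id2 K f" "Id2 K (Unit T B)" \<gamma>] by simp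
  have 2: "\<gamma> \<lhd> (Mult T B \<cdot> T1 (T1 f)) = ((\<gamma> \<lhd> T1 b) \<odot> (c \<rhd> T2 \<gamma>)) \<lhd> T1 (T1 f)"
    using ql(2) hcomp_assoc [of "Id2 K (T1 (T1 f))" "Id2 K (Mult T B)" \<gamma>] by simp
  have ex: "((g \<cdot> b) \<rhd> T2 \<phi>) \<odot> (\<gamma> \<lhd> (T1 b \<cdot> T1 (T1 f))) = (\<gamma> \<lhd> (T1 f \<cdot> T1 a)) \<odot> ((c \<cdot> T1 g) \<rhd> T2 \<phi>)"
    using whisker_exchange [of "T2 \<phi>" "T1 b \<cdot> T1 (T1 f)" "T1 f \<cdot> T1 a" \<gamma> "c \<cdot> T1 g" "g \<cdot> b"] by simp
  show ?thesis
    using vcomp_assoc_subst [OF ex, of "c \<rhd> (T2 \<gamma> \<lhd> T1 (T1 f))"]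
    by (simp add: lax_morphism_iff eqs alg un 1 2 pl)
qed

lemma lax_mor_eqI:
  fixes p q :: "('o, 'm, 'c) lax_mor"
  assumes "lax_dom p = lax_dom q" "lax_cod p = lax_cod q" "lax_arr p = lax_arr q" "lax_cell p = lax_cell q"
  shows "p = q"
  using assms by (intro lax_mor.equality) auto

lemma alg_cell_eqI:
  fixes \<alpha> \<beta> :: "('o, 'm, 'c) alg_cell"
  assumes "alg_src \<alpha> = alg_src \<beta>" "alg_trg \<alpha> = alg_trg \<beta>" "alg_under \<alpha> = alg_under \<beta>"
  shows "\<alpha> = \<beta>"
  using assms by (intro alg_cell.equality) auto

lemma lax_comp_id_right [simp]: "p \<in> lax_morphisms K T \<Longrightarrow> lax_dom p = X \<Longrightarrow> lax_comp K T p (lax_id K X) = p"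
  by (intro lax_mor_eqI) auto

lemma lax_comp_id_left [simp]: "p \<in> lax_morphisms K T \<Longrightarrow> lax_cod p = X \<Longrightarrow> lax_comp K T (lax_id K X) p = p"
  by (intro lax_mor_eqI) auto

lemma lax_comp_assoc [simp]:
  "\<lbrakk>p \<in> lax_morphisms K T; q \<in> lax_morphisms K T; r \<in> lax_morphisms K T; lax_cod p = lax_dom q;
    lax_cod q = lax_dom r\<rbrakk> \<Longrightarrow> lax_comp K T (lax_comp K T r q) p = lax_comp K T r (lax_comp K T q p)"
  by (intro lax_mor_eqI) simp_all

lemma vcomp_alg_cell:
  assumes a: "\<alpha> \<in> alg_cells K T" and b: "\<beta> \<in> alg_cells K T" and ab: "alg_trg \<alpha> = alg_src \<beta>"
  shows "\<lparr>alg_src = alg_src \<alpha>, alg_trg = alg_trg \<beta>, alg_under = alg_under \<beta> \<odot> alg_under \<alpha>\<rparr> \<in> alg_cells K T"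
proof -
  define p q r where "p = alg_src \<alpha>" and "q = alg_trg \<alpha>" and "r = alg_trg \<beta>"
  have eqs: "alg_src \<alpha> = p" "alg_trg \<alpha> = q" "alg_src \<beta> = q" "alg_trg \<beta> = r"
    by (simp_all add: p_def q_def r_def ab)
  note [simp] = alg_cell_typing [OF a, unfolded eqs] alg_cell_typing [OF b, unfolded eqs] eqs
  define x y where "x = snd (lax_dom p)" and "y = snd (lax_cod p)"
  have xy: "snd (lax_dom p) = x" "snd (lax_cod p) = y" by (simp_all add: x_def y_def)
  note [simp] = algebra_typing(2-) [OF lax_typing(1) [of p], unfolded xy] algebra_typing(2-) [OF lax_typing(2) [of p], unfolded xy]
  have 1: "(alg_under \<alpha> \<lhd> x) \<odot> lax_cell p = lax_cell q \<odot> (y \<rhd> T2 (alg_under \<alpha>))"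
    using alg_cell_law [OF a] by (simp add: xy)
  have 2: "(alg_under \<beta> \<lhd> x) \<odot> lax_cell q = lax_cell r \<odot> (y \<rhd> T2 (alg_under \<beta>))"
    using alg_cell_law [OF b] by (simp add: xy)
  show ?thesis
    using vcomp_assoc_subst [OF 2, of "y \<rhd> T2 (alg_under \<alpha>)"]
    by (simp add: alg_cell_iff xy 1)
qed

text \<open>Each of the cells \<open>u\<close> and \<open>v\<close> passes one lax structure by its
  own law; two exchanges, of \<open>v\<close> with \<open>F'\<close> and of \<open>G\<close> with
  \<open>T2 u\<close>, bring them into the position where these laws apply.\<close>

lemma hcomp_alg_cell:
  assumes a: "\<alpha> \<in> alg_cells K T" and b: "\<beta> \<in> alg_cells K T"
    and ab: "lax_cod (alg_src \<alpha>) = lax_dom (alg_src \<beta>)"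
  shows "\<lparr>alg_src = lax_comp K T (alg_src \<beta>) (alg_src \<alpha>), alg_trg = lax_comp K T (alg_trg \<beta>) (alg_trg \<alpha>),
    alg_under = alg_under \<beta> \<star> alg_under \<alpha>\<rparr> \<in> alg_cells K T"
proof -
  define f f' g g' F F' G G' u v where d: "f = lax_arr (alg_src \<alpha>)" "f' = lax_arr (alg_trg \<alpha>)"
    "g = lax_arr (alg_src \<beta>)" "g' = lax_arr (alg_trg \<beta>)"
    "F = lax_cell (alg_src \<alpha>)" "F' = lax_cell (alg_trg \<alpha>)"
    "G = lax_cell (alg_src \<beta>)" "G' = lax_cell (alg_trg \<beta>)" "u = alg_under \<alpha>" "v = alg_under \<beta>"
  define A a' B b' C c where e: "A = fst (lax_dom (alg_src \<alpha>))" "a' = snd (lax_dom (alg_src \<alpha>))"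
     "B = fst (lax_cod (alg_src \<alpha>))" "b' = snd (lax_cod (alg_src \<alpha>))"
     "C = fst (lax_cod (alg_src \<beta>))" "c = snd (lax_cod (alg_src \<beta>))"
  have al: "lax_dom (alg_src \<alpha>) \<in> algebras K T" "lax_cod (alg_src \<alpha>) \<in> algebras K T" 
    "lax_cod (alg_src \<beta>) \<in> algebras K T" using a b by simp_all
  note al [simp] = algebra_typing [OF al(1), folded e] algebra_typing [OF al(2), folded e]
    algebra_typing [OF al(3), folded e]
  have ty [simp]: "f \<in> Arr K" "Dom K f = A" "Cod K f = B" "f' \<in> Arr K" "Dom K f' = A" "Cod K f' = B"
    "g \<in> Arr K" "Dom K g = B" "Cod K g = C" "g' \<in> Arr K" "Dom K g' = B" "Cod K g' = C"
    "F \<in> Cell K" "Src K F = b' \<cdot> T1 f" "Trg K F = f \<cdot> a'"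
    "F' \<in> Cell K" "Src K F' = b' \<cdot> T1 f'" "Trg K F' = f' \<cdot> a'"
    "G \<in> Cell K" "Src K G = c \<cdot> T1 g" "Trg K G = g \<cdot> b'"
    "G' \<in> Cell K" "Src K G' = c \<cdot> T1 g'" "Trg K G' = g' \<cdot> b'"
    "u \<in> Cell K" "Src K u = f" "Trg K u = f'" "v \<in> Cell K" "Src K v = g" "Trg K v = g'"
    using a b by (simp_all add: d e ab)
  have 1: "(u \<lhd> a') \<odot> F = F' \<odot> (b' \<rhd> T2 u)" and 2: "(v \<lhd> b') \<odot> G = G' \<odot> (c \<rhd> T2 v)"
    using alg_cell_law [OF a] alg_cell_law [OF b] ab by (simp_all add: d e)
  have "((v \<star> u) \<lhd> a') \<odot> ((g \<rhd> F) \<odot> (G \<lhd> T1 f)) = ((v \<lhd> (f' \<cdot> a')) \<odot> (g \<rhd> ((u \<lhd> a') \<odot> F))) \<odot> (G \<lhd> T1 f)"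
    by (simp add: hcomp_whisker(1) [of u v])
  also have "\<dots> = ((v \<lhd> (f' \<cdot> a')) \<odot> (g \<rhd> F')) \<odot> (((g \<cdot> b') \<rhd> T2 u) \<odot> (G \<lhd> T1 f))"
    by (simp add: 1)
  also have "(v \<lhd> (f' \<cdot> a')) \<odot> (g \<rhd> F') = (g' \<rhd> F') \<odot> (v \<lhd> (b' \<cdot> T1 f'))"
    by (rule whisker_exchange) simp_all
  also have "((g \<cdot> b') \<rhd> T2 u) \<odot> (G \<lhd> T1 f) = (G \<lhd> T1 f') \<odot> ((c \<cdot> T1 g) \<rhd> T2 u)"
    by (rule whisker_exchange [symmetric]) simp_all
  also have "(g' \<rhd> F') \<odot> (v \<lhd> (b' \<cdot> T1 f')) \<odot> ((G \<lhd> T1 f') \<odot> ((c \<cdot> T1 g) \<rhd> T2 u)) =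
    (g' \<rhd> F') \<odot> (((v \<lhd> b') \<odot> G) \<lhd> T1 f' \<odot> ((c \<cdot> T1 g) \<rhd> T2 u))"
    by simp
  also have "\<dots> = ((g' \<rhd> F') \<odot> (G' \<lhd> T1 f')) \<odot> (c \<rhd> T2 (v \<star> u))"
    unfolding 2 by (simp add: hcomp_whisker(1) [of "T2 u" "T2 v"])
  finally have eq: "((v \<star> u) \<lhd> a') \<odot> ((g \<rhd> F) \<odot> (G \<lhd> T1 f)) =
    ((g' \<rhd> F') \<odot> (G' \<lhd> T1 f')) \<odot> (c \<rhd> T2 (v \<star> u))" .
  show ?thesis
    unfolding alg_cell_iff alg_cell.simps lax_comp_sel mem_Hom2
    apply (intro conjI eq [unfolded d e])
    using a b ab by simp_all
qed

text \<open>A 2-cell is determined by its two boundary arrows and its underlying 2-cell, so the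
  equations between 2-cells are inherited from \<open>K\<close>. The content lies in closure under
  the compositions.\<close>

lemma Alg_two_category: "two_category (Alg_lax K T)"
proof (rule two_category.intro)
  show "category (Alg_lax K T)"
    by (rule category.intro) simp_all
  have "category (vert_cat (Alg_lax K T))"
  proof (rule category.intro; simp only: vert_cat_def cat.simps Alg_sel mem_Hom)
    fix p assume "p \<in> lax_morphisms K T" then show "\<lparr>alg_src = p, alg_trg = p, alg_under = Id2 K (lax_arr p)\<rparr>
         \<in> alg_cells K T \<and> alg_src \<lparr>alg_src = p, alg_trg = p, alg_under = Id2 K (lax_arr p)\<rparr> = p \<and>
         alg_trg \<lparr>alg_src = p, alg_trg = p, alg_under = Id2 K (lax_arr p)\<rparr> = p"
      by (simp add: alg_cell_iff)
  qed (simp_all add: vcomp_alg_cell)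
  then show "two_category_axioms (Alg_lax K T)"
    by (rule two_category_axioms.intro) (simp_all add: hcomp_alg_cell interchange)
qed

end

section \<open>Universal opcones\<close>

text \<open>The target \<open>B\<close> is kept arbitrary because the theory of cones is
  instantiated twice: at \<open>Alg_lax K T\<close> (as \<open>DA\<close>) and at \<open>K\<close>
  (as \<open>D\<close>).\<close>

locale indexed_diagram =
  A: two_category A + two_category B
  for A :: "('x, 'f, 'g) two_cat" and B :: "('o, 'm, 'c) two_cat" (structure) +
  fixes S :: "'f set" and F :: "('x, 'f, 'g, 'o, 'm, 'c) two_fun"
  assumes S_Arr: "S \<subseteq> Arr A"
    and F_two_functor: "two_functor A B F"
begin

lemma F_functor: "functor_between A B (FOb F) (FArr F)"
  and F_vfunctor: "functor_between (vert_cat A) (vert_cat B) (FArr F) (FCell F)"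
  using F_two_functor unfolding two_functor_def by blast+

lemma F_Ob [simp]: "X \<in> Ob A \<Longrightarrow> FOb F X \<in> Ob B"
  and F_Id [simp]: "X \<in> Ob A \<Longrightarrow> FArr F (Id A X) = Id B (FOb F X)"
  and F_Arr_typing [simp]: "f \<in> Arr A \<Longrightarrow> FArr F f \<in> Arr B"
    "f \<in> Arr A \<Longrightarrow> Dom B (FArr F f) = FOb F (Dom A f)"
    "f \<in> Arr A \<Longrightarrow> Cod B (FArr F f) = FOb F (Cod A f)"
  and F_comp [simp]: "\<lbrakk>f \<in> Arr A; g \<in> Arr A; Cod A f = Dom A g\<rbrakk>
    \<Longrightarrow> FArr F (g \<cdot>\<^bsub>A\<^esub> f) = FArr F g \<cdot> FArr F f"
  using F_functor by (simp_all add: functor_between_def)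

lemma F_Cell_typing [simp]: "\<alpha> \<in> Cell A \<Longrightarrow> FCell F \<alpha> \<in> Cell B"
    "\<alpha> \<in> Cell A \<Longrightarrow> Src B (FCell F \<alpha>) = FArr F (Src A \<alpha>)"
    "\<alpha> \<in> Cell A \<Longrightarrow> Trg B (FCell F \<alpha>) = FArr F (Trg A \<alpha>)"
  using F_vfunctor by (simp_all add: functor_between_def vert_cat_def)

section \<open>Op-lax cones and their composition with arrows and 2-cells\<close>

lemma opcone_typing [simp]:
  assumes "oplax_cone A B F E \<theta>"
  shows "X \<in> Ob A \<Longrightarrow> leg \<theta> X \<in> Arr B"
    "X \<in> Ob A \<Longrightarrow> Dom B (leg \<theta> X) = E" "X \<in> Ob A \<Longrightarrow> Cod B (leg \<theta> X) = FOb F X"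
    "f \<in> Arr A \<Longrightarrow> con \<theta> f \<in> Cell B" "f \<in> Arr A \<Longrightarrow> Src B (con \<theta> f) = leg \<theta> (Cod A f)"
    "f \<in> Arr A \<Longrightarrow> Trg B (con \<theta> f) = FArr F f \<cdot> leg \<theta> (Dom A f)"
  using assms unfolding oplax_cone_def mem_Hom mem_Hom2 by blast+

lemma opcone_ext:
  assumes "oplax_cone A B F E \<theta>"
  shows "leg \<theta> \<in> extensional (Ob A)" "con \<theta> \<in> extensional (Arr A)"
  using assms unfolding oplax_cone_def by blast+

lemma opcone_laws:
  assumes "oplax_cone A B F E \<theta>"
  shows "X \<in> Ob A \<Longrightarrow> con \<theta> (Id A X) = Id2 B (leg \<theta> X)"
    "\<lbrakk>f \<in> Arr A; g \<in> Arr A; Cod A f = Dom A g\<rbrakk> \<Longrightarrow>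
        con \<theta> (g \<cdot>\<^bsub>A\<^esub> f) = (FArr F g \<rhd> con \<theta> f) \<odot> con \<theta> g"
    "\<gamma> \<in> Cell A \<Longrightarrow>
        con \<theta> (Trg A \<gamma>) = (FCell F \<gamma> \<lhd> leg \<theta> (Dom A (Src A \<gamma>))) \<odot> con \<theta> (Src A \<gamma>)"
  using assms unfolding oplax_cone_def by blast+

lemma opcone_eqI:
  assumes "oplax_cone A B F E \<theta>" "oplax_cone A B F E' \<theta>'"
    "\<And>X. X \<in> Ob A \<Longrightarrow> leg \<theta> X = leg \<theta>' X" "\<And>f. f \<in> Arr A \<Longrightarrow> con \<theta> f = con \<theta>' f"
  shows "\<theta> = \<theta>'"
  using assms opcone_ext [OF assms(1)] opcone_ext [OF assms(2)]
  by (intro opcone.equality) (auto intro: extensionalityI)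

lemma sigma_opcone_oplax: "sigma_opcone A S B F E \<theta> \<Longrightarrow> oplax_cone A B F E \<theta>"
  by (simp add: sigma_opcone_def)

text \<open>The definition only provides an identity on some arrow. The boundary of the cone cell
  determines that arrow in two ways, and this yields the equation between the legs.\<close>

lemma sigma_opcone_identity:
  assumes "sigma_opcone A S B F E \<theta>" "f \<in> S"
  shows "con \<theta> f = Id2 B (leg \<theta> (Cod A f))" "leg \<theta> (Cod A f) = FArr F f \<cdot> leg \<theta> (Dom A f)"
proof -
  obtain h where h: "h \<in> Arr B" "con \<theta> f = Id2 B h"
    using assms by (auto simp: sigma_opcone_def identity_cell_def)
  have "f \<in> Arr A" using assms S_Arr by blast
  then have "Src B (con \<theta> f) = leg \<theta> (Cod A f)" "Trg B (con \<theta> f) = FArr F f \<cdot> leg \<theta> (Dom A f)"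
    using sigma_opcone_oplax [OF assms(1)] by simp_all
  then show "con \<theta> f = Id2 B (leg \<theta> (Cod A f))" "leg \<theta> (Cod A f) = FArr F f \<cdot> leg \<theta> (Dom A f)"
    using h by simp_all
qed

lemma precomp_sel [simp]:
  "X \<in> Ob A \<Longrightarrow> leg (precomp A B \<theta> h) X = leg \<theta> X \<cdot> h"
  "f \<in> Arr A \<Longrightarrow> con (precomp A B \<theta> h) f = con \<theta> f \<lhd> h"
  by (simp_all add: precomp_def)

lemma precomp_oplax:
  assumes \<theta>: "oplax_cone A B F L \<theta>" and h: "h \<in> Arr B" "Cod B h = L"
  shows "oplax_cone A B F (Dom B h) (precomp A B \<theta> h)"
  unfolding oplax_cone_def
proof (intro conjI ballI impI)
  note [simp] = opcone_typing [OF \<theta>] h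
  show "leg (precomp A B \<theta> h) \<in> extensional (Ob A)" "con (precomp A B \<theta> h) \<in> extensional (Arr A)"
    by (simp_all add: precomp_def)
  show "leg (precomp A B \<theta> h) X \<in> Hom B (Dom B h) (FOb F X)" if "X \<in> Ob A" for X
    using that by simp
  show "con (precomp A B \<theta> h) f \<in>
      Hom2 B (leg (precomp A B \<theta> h) (Cod A f)) (FArr F f \<cdot> leg (precomp A B \<theta> h) (Dom A f))"
    if "f \<in> Arr A" for f using that by simp
  show "con (precomp A B \<theta> h) (Id A X) = Id2 B (leg (precomp A B \<theta> h) X)" if "X \<in> Ob A" for X
    using that by (simp add: opcone_laws(1) [OF \<theta>])
  show "con (precomp A B \<theta> h) (g \<cdot>\<^bsub>A\<^esub> f) =
      (FArr F g \<rhd> con (precomp A B \<theta> h) f) \<odot> con (precomp A B \<theta> h) g"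
    if "f \<in> Arr A" "g \<in> Arr A" "Cod A f = Dom A g" for f g
    using that by (simp add: opcone_laws(2) [OF \<theta>])
  show "con (precomp A B \<theta> h) (Trg A \<gamma>) =
      (FCell F \<gamma> \<lhd> leg (precomp A B \<theta> h) (Dom A (Src A \<gamma>))) \<odot> con (precomp A B \<theta> h) (Src A \<gamma>)"
    if "\<gamma> \<in> Cell A" for \<gamma>
    using that by (simp add: opcone_laws(3) [OF \<theta>])
qed

lemma precomp_sigma:
  assumes \<theta>: "sigma_opcone A S B F L \<theta>" and h: "h \<in> Arr B" "Cod B h = L"
  shows "sigma_opcone A S B F (Dom B h) (precomp A B \<theta> h)"
  unfolding sigma_opcone_def
proof (intro conjI ballI)
  show "oplax_cone A B F (Dom B h) (precomp A B \<theta> h)"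
    by (rule precomp_oplax [OF sigma_opcone_oplax [OF \<theta>] h])
  fix f assume f: "f \<in> S"
  then have [simp]: "f \<in> Arr A" using S_Arr by blast
  note [simp] = opcone_typing [OF sigma_opcone_oplax [OF \<theta>]] h
  show "identity_cell B (con (precomp A B \<theta> h) f)"
    by (auto simp: identity_cell_def sigma_opcone_identity(1) [OF \<theta> f]
      intro!: bexI [of _ "leg \<theta> (Cod A f) \<cdot> h"])
qed

lemma precomp_comp:
  assumes \<theta>: "oplax_cone A B F L \<theta>" and h: "h \<in> Arr B" "Cod B h = L" and k: "k \<in> Arr B" "Cod B k = Dom B h"
  shows "precomp A B (precomp A B \<theta> h) k = precomp A B \<theta> (h \<cdot> k)"
  using opcone_typing [OF \<theta>] h k by (auto simp: precomp_def fun_eq_iff restrict_def)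

lemma precomp_Id:
  assumes \<theta>: "oplax_cone A B F L \<theta>" and L: "L \<in> Ob B"
  shows "precomp A B \<theta> (Id B L) = \<theta>"
  using precomp_oplax [OF \<theta>, of "Id B L"] opcone_typing [OF \<theta>] L
  by (intro opcone_eqI [OF _ \<theta>]) auto

text \<open>Naturality in \<open>f\<close> is the exchange law for \<open>con \<theta> f\<close> and
  \<open>\<beta>\<close>.\<close>

lemma precomp2_morphism:
  assumes \<theta>: "oplax_cone A B F L \<theta>" and \<beta>: "\<beta> \<in> Cell B" "Cod B (Src B \<beta>) = L"
  shows "opcone_morphism A B F (precomp A B \<theta> (Src B \<beta>)) (precomp A B \<theta> (Trg B \<beta>))
    (\<lambda>X\<in>Ob A. leg \<theta> X \<rhd> \<beta>)"
  unfolding opcone_morphism_def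
proof (intro conjI ballI)
  note [simp] = opcone_typing [OF \<theta>] \<beta>
  show "(\<lambda>X\<in>Ob A. leg \<theta> X \<rhd> \<beta>) \<in> extensional (Ob A)" by simp
  show "(\<lambda>X\<in>Ob A. leg \<theta> X \<rhd> \<beta>) X \<in>
      Hom2 B (leg (precomp A B \<theta> (Src B \<beta>)) X) (leg (precomp A B \<theta> (Trg B \<beta>)) X)" if "X \<in> Ob A" for X
    using that by simp
  fix f assume [simp]: "f \<in> Arr A"
  show "(FArr F f \<rhd> (\<lambda>X\<in>Ob A. leg \<theta> X \<rhd> \<beta>) (Dom A f)) \<odot> con (precomp A B \<theta> (Src B \<beta>)) f =
      con (precomp A B \<theta> (Trg B \<beta>)) f \<odot> (\<lambda>X\<in>Ob A. leg \<theta> X \<rhd> \<beta>) (Cod A f)"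
    using whisker_exchange [of \<beta> "Src B \<beta>" "Trg B \<beta>" "con \<theta> f" "leg \<theta> (Cod A f)"
      "FArr F f \<cdot> leg \<theta> (Dom A f)"] by simp
qed

text \<open>The two bijections in an isomorphism of categories, restated as unique existence, for
  2-cells between a fixed pair of arrows. Functoriality is supplied for every sigma-s-opcone by
  \<open>precomp_functor\<close>.\<close>

definition opcone_representing :: "'o \<Rightarrow> ('x, 'f, 'm, 'c) opcone \<Rightarrow> bool" where
  "opcone_representing L \<pi> \<longleftrightarrow> (\<forall>E \<in> Ob B.
     (\<forall>\<theta>. sigma_opcone A S B F E \<theta> \<longrightarrow> (\<exists>!h. h \<in> Hom B E L \<and> precomp A B \<pi> h = \<theta>)) \<and>
     (\<forall>h \<in> Hom B E L. \<forall>k \<in> Hom B E L. \<forall>\<alpha>.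
        opcone_morphism A B F (precomp A B \<pi> h) (precomp A B \<pi> k) \<alpha> \<longrightarrow>
        (\<exists>!\<beta>. \<beta> \<in> Hom2 B h k \<and> (\<forall>X \<in> Ob A. leg \<pi> X \<rhd> \<beta> = \<alpha> X))))"

lemma hom_cat_sel [simp]:
  "Ob (hom_cat B E L) = Hom B E L \<inter> Arr B"
  "Arr (hom_cat B E L) = {\<alpha> \<in> Cell B. Src B \<alpha> \<in> Hom B E L \<and> Trg B \<alpha> \<in> Hom B E L}"
  "Dom (hom_cat B E L) = Src B" "Cod (hom_cat B E L) = Trg B" "Id (hom_cat B E L) = Id2 B"
  "Comp (hom_cat B E L) = VComp B"
  by (simp_all add: hom_cat_def full_sub_def vert_cat_def)

lemma sigma_opcone_cat_sel [simp]:
  "Ob (sigma_opcone_cat A S B F E) = {\<theta>. sigma_opcone A S B F E \<theta>}"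
  "Dom (sigma_opcone_cat A S B F E) = cm_dom" "Cod (sigma_opcone_cat A S B F E) = cm_cod"
  "Id (sigma_opcone_cat A S B F E) \<theta> =
     \<lparr>cm_dom = \<theta>, cm_cod = \<theta>, cm_cell = (\<lambda>X\<in>Ob A. Id2 B (leg \<theta> X))\<rparr>"
  "Comp (sigma_opcone_cat A S B F E) q p =
     \<lparr>cm_dom = cm_dom p, cm_cod = cm_cod q, cm_cell = (\<lambda>X\<in>Ob A. cm_cell q X \<odot> cm_cell p X)\<rparr>"
  by (simp_all add: sigma_opcone_cat_def)

lemma sigma_opcone_cat_Arr [simp]:
  "p \<in> Arr (sigma_opcone_cat A S B F E) \<longleftrightarrow> sigma_opcone A S B F E (cm_dom p) \<and>
     sigma_opcone A S B F E (cm_cod p) \<and> opcone_morphism A B F (cm_dom p) (cm_cod p) (cm_cell p)"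
  by (cases p) (auto simp: sigma_opcone_cat_def)

lemma precomp2_sel [simp]:
  "cm_dom (precomp2 A B \<pi> \<alpha>) = precomp A B \<pi> (Src B \<alpha>)"
  "cm_cod (precomp2 A B \<pi> \<alpha>) = precomp A B \<pi> (Trg B \<alpha>)"
  "cm_cell (precomp2 A B \<pi> \<alpha>) = (\<lambda>X\<in>Ob A. leg \<pi> X \<rhd> \<alpha>)"
  by (simp_all add: precomp2_def)

lemma precomp_functor:
  assumes \<pi>: "sigma_opcone A S B F L \<pi>"
  shows "functor_between (hom_cat B E L) (sigma_opcone_cat A S B F E) (precomp A B \<pi>) (precomp2 A B \<pi>)"
  unfolding functor_between_def
proof (intro conjI ballI impI)
  note [simp] = opcone_typing [OF sigma_opcone_oplax [OF \<pi>]]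
  fix h assume "h \<in> Ob (hom_cat B E L)"
  then have h [simp]: "h \<in> Arr B" "Dom B h = E" "Cod B h = L" by simp_all
  show "precomp A B \<pi> h \<in> Ob (sigma_opcone_cat A S B F E)"
    using precomp_sigma [OF \<pi>, of h] by simp
  show "precomp2 A B \<pi> (Id (hom_cat B E L) h) = Id (sigma_opcone_cat A S B F E) (precomp A B \<pi> h)"
    by (simp add: precomp2_def restrict_def fun_eq_iff)
next
  fix \<alpha> assume "\<alpha> \<in> Arr (hom_cat B E L)"
  then have [simp]: "\<alpha> \<in> Cell B" "Dom B (Src B \<alpha>) = E" "Cod B (Src B \<alpha>) = L" by simp_all
  show "precomp2 A B \<pi> \<alpha> \<in> Hom (sigma_opcone_cat A S B F E)
      (precomp A B \<pi> (Dom (hom_cat B E L) \<alpha>)) (precomp A B \<pi> (Cod (hom_cat B E L) \<alpha>))"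
    using precomp_sigma [OF \<pi>, of "Src B \<alpha>"] precomp_sigma [OF \<pi>, of "Trg B \<alpha>"]
      precomp2_morphism [OF sigma_opcone_oplax [OF \<pi>], of \<alpha>] by simp
next
  note [simp] = opcone_typing [OF sigma_opcone_oplax [OF \<pi>]]
  fix \<alpha> \<beta> assume "\<alpha> \<in> Arr (hom_cat B E L)" "\<beta> \<in> Arr (hom_cat B E L)"
    "Cod (hom_cat B E L) \<alpha> = Dom (hom_cat B E L) \<beta>"
  then have [simp]: "\<alpha> \<in> Cell B" "Dom B (Src B \<alpha>) = E" "Cod B (Src B \<alpha>) = L" "\<beta> \<in> Cell B"
    "Trg B \<alpha> = Src B \<beta>" by simp_all
  show "precomp2 A B \<pi> (\<beta> \<cdot>\<^bsub>hom_cat B E L\<^esub> \<alpha>) =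
      precomp2 A B \<pi> \<beta> \<cdot>\<^bsub>sigma_opcone_cat A S B F E\<^esub> precomp2 A B \<pi> \<alpha>"
    by (simp add: precomp2_def restrict_def fun_eq_iff)
qed

text \<open>The bijection on arrows of the cone category ranges over all pairs of ends at once,
  unique existence over one pair \<open>h\<close>, \<open>k\<close>. Injectivity of
  \<open>precomp\<close> on arrows passes between the two: it recovers the ends of a 2-cell from the
  ends of its image.\<close>

lemma is_sigma_oplimit_iff:
  "is_sigma_oplimit A S B F L \<pi> \<longleftrightarrow>
     L \<in> Ob B \<and> sigma_opcone A S B F L \<pi> \<and> opcone_representing L \<pi>"
proof
  assume lim: "is_sigma_oplimit A S B F L \<pi>"
  then have L: "L \<in> Ob B" and \<pi>: "sigma_opcone A S B F L \<pi>"
    by (simp_all add: is_sigma_oplimit_def)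
  have "opcone_representing L \<pi>"
    unfolding opcone_representing_def
  proof (intro ballI conjI allI impI)
    fix E assume E: "E \<in> Ob B"
    then have b1: "bij_betw (precomp A B \<pi>) (Ob (hom_cat B E L)) (Ob (sigma_opcone_cat A S B F E))"
      and b2: "bij_betw (precomp2 A B \<pi>) (Arr (hom_cat B E L)) (Arr (sigma_opcone_cat A S B F E))"
      using lim by (auto simp: is_sigma_oplimit_def cat_iso_def)
    have inj: "h = k" if "precomp A B \<pi> h = precomp A B \<pi> k" "h \<in> Hom B E L" "k \<in> Hom B E L" for h k
      using bij_betw_imp_inj_on [OF b1] that by (auto dest!: inj_onD)
    show "\<exists>!h. h \<in> Hom B E L \<and> precomp A B \<pi> h = \<theta>" if "sigma_opcone A S B F E \<theta>" for \<theta>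
    proof -
      have "\<theta> \<in> precomp A B \<pi> ` Ob (hom_cat B E L)"
        using that bij_betw_imp_surj_on [OF b1] by simp
      then show ?thesis by (auto intro: inj)
    qed
    fix h k \<alpha> assume h: "h \<in> Hom B E L" and k: "k \<in> Hom B E L"
      and \<alpha>: "opcone_morphism A B F (precomp A B \<pi> h) (precomp A B \<pi> k) \<alpha>"
    define p where "p = \<lparr>cm_dom = precomp A B \<pi> h, cm_cod = precomp A B \<pi> k, cm_cell = \<alpha>\<rparr>"
    have "p \<in> Arr (sigma_opcone_cat A S B F E)"
      using precomp_sigma [OF \<pi>, of h] precomp_sigma [OF \<pi>, of k] h k \<alpha> by (simp add: p_def)
    then have "p \<in> precomp2 A B \<pi> ` Arr (hom_cat B E L)"
      using bij_betw_imp_surj_on [OF b2] by simp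
    then obtain \<beta> where \<beta>: "\<beta> \<in> Arr (hom_cat B E L)" "precomp2 A B \<pi> \<beta> = p" by auto
    have "precomp A B \<pi> (Src B \<beta>) = precomp A B \<pi> h" "precomp A B \<pi> (Trg B \<beta>) = precomp A B \<pi> k"
      using arg_cong [OF \<beta>(2), of cm_dom] arg_cong [OF \<beta>(2), of cm_cod] by (simp_all add: p_def)
    then have s: "Src B \<beta> = h" "Trg B \<beta> = k"
      using \<beta>(1) h k by (auto intro: inj)
    show "\<exists>!\<beta>. \<beta> \<in> Hom2 B h k \<and> (\<forall>X\<in>Ob A. leg \<pi> X \<rhd> \<beta> = \<alpha> X)"
    proof (intro ex1I conjI)
      show "\<beta> \<in> Hom2 B h k" using \<beta>(1) s by simp
      show "\<forall>X\<in>Ob A. leg \<pi> X \<rhd> \<beta> = \<alpha> X"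
      proof
        fix X assume "X \<in> Ob A"
        then show "leg \<pi> X \<rhd> \<beta> = \<alpha> X"
          using fun_cong [OF arg_cong [OF \<beta>(2), of cm_cell], of X] by (simp add: p_def)
      qed
      fix \<beta>' assume \<beta>': "\<beta>' \<in> Hom2 B h k \<and> (\<forall>X\<in>Ob A. leg \<pi> X \<rhd> \<beta>' = \<alpha> X)"
      \<comment> \<open>Extensionality of \<open>\<alpha>\<close> turns agreement on
        \<open>Ob A\<close> into equality of the families.\<close>
      have "precomp2 A B \<pi> \<beta>' = precomp2 A B \<pi> \<beta>"
        using \<beta>' \<alpha> unfolding \<beta>(2)
        by (auto simp: p_def precomp2_def opcone_morphism_def restrict_def extensional_def)
      moreover have "\<beta>' \<in> Arr (hom_cat B E L)" using \<beta>' h k by auto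
      ultimately show "\<beta>' = \<beta>"
        using bij_betw_imp_inj_on [OF b2] \<beta>(1) by (auto dest: inj_onD)
    qed
  qed
  with L \<pi> show "L \<in> Ob B \<and> sigma_opcone A S B F L \<pi> \<and> opcone_representing L \<pi>" by blast
next
  assume "L \<in> Ob B \<and> sigma_opcone A S B F L \<pi> \<and> opcone_representing L \<pi>"
  then have L: "L \<in> Ob B" and \<pi>: "sigma_opcone A S B F L \<pi>" and rep: "opcone_representing L \<pi>"
    by blast+
  show "is_sigma_oplimit A S B F L \<pi>"
    unfolding is_sigma_oplimit_def cat_iso_def
  proof (intro conjI ballI)
    fix E assume E: "E \<in> Ob B"
    have r1: "\<exists>!h. h \<in> Hom B E L \<and> precomp A B \<pi> h = \<theta>" if "sigma_opcone A S B F E \<theta>" for \<theta>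
      using rep E that by (auto simp: opcone_representing_def)
    have r2: "\<exists>!\<beta>. \<beta> \<in> Hom2 B h k \<and> (\<forall>X\<in>Ob A. leg \<pi> X \<rhd> \<beta> = \<alpha> X)"
      if "h \<in> Hom B E L" "k \<in> Hom B E L" "opcone_morphism A B F (precomp A B \<pi> h) (precomp A B \<pi> k) \<alpha>" for h k \<alpha>
      using rep E that unfolding opcone_representing_def by blast
    have inj: "h = k" if "precomp A B \<pi> h = precomp A B \<pi> k" "h \<in> Hom B E L" "k \<in> Hom B E L" for h k
      using r1 [of "precomp A B \<pi> h"] precomp_sigma [OF \<pi>, of h] that by auto
    show "functor_between (hom_cat B E L) (sigma_opcone_cat A S B F E) (precomp A B \<pi>) (precomp2 A B \<pi>)"
      by (rule precomp_functor [OF \<pi>])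
    show "bij_betw (precomp A B \<pi>) (Ob (hom_cat B E L)) (Ob (sigma_opcone_cat A S B F E))"
      unfolding bij_betw_def
    proof (intro conjI inj_onI equalityI subsetI)
      show "h = k" if "h \<in> Ob (hom_cat B E L)" "k \<in> Ob (hom_cat B E L)"
        "precomp A B \<pi> h = precomp A B \<pi> k" for h k using inj that by simp
      show "\<theta> \<in> Ob (sigma_opcone_cat A S B F E)" if "\<theta> \<in> precomp A B \<pi> ` Ob (hom_cat B E L)" for \<theta>
        using precomp_sigma [OF \<pi>] that by auto
      show "\<theta> \<in> precomp A B \<pi> ` Ob (hom_cat B E L)" if "\<theta> \<in> Ob (sigma_opcone_cat A S B F E)" for \<theta>
        using r1 [of \<theta>] that by auto
    qed
    show "bij_betw (precomp2 A B \<pi>) (Arr (hom_cat B E L)) (Arr (sigma_opcone_cat A S B F E))"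
      unfolding bij_betw_def
    proof (intro conjI inj_onI equalityI subsetI)
      fix \<alpha> \<beta> assume \<alpha>: "\<alpha> \<in> Arr (hom_cat B E L)" and \<beta>: "\<beta> \<in> Arr (hom_cat B E L)"
        and eq: "precomp2 A B \<pi> \<alpha> = precomp2 A B \<pi> \<beta>"
      have s: "Src B \<alpha> = Src B \<beta>" "Trg B \<alpha> = Trg B \<beta>"
        using arg_cong [OF eq, of cm_dom] arg_cong [OF eq, of cm_cod] \<alpha> \<beta> by (simp_all add: inj)
      have c: "leg \<pi> X \<rhd> \<alpha> = leg \<pi> X \<rhd> \<beta>" if "X \<in> Ob A" for X
        using fun_cong [OF arg_cong [OF eq, of cm_cell], of X] that by simp
      have m: "opcone_morphism A B F (precomp A B \<pi> (Src B \<beta>)) (precomp A B \<pi> (Trg B \<beta>))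
          (\<lambda>X\<in>Ob A. leg \<pi> X \<rhd> \<beta>)"
        by (rule precomp2_morphism [OF sigma_opcone_oplax [OF \<pi>]]) (use \<beta> in auto)
      have "\<exists>!\<delta>. \<delta> \<in> Hom2 B (Src B \<beta>) (Trg B \<beta>) \<and>
          (\<forall>X\<in>Ob A. leg \<pi> X \<rhd> \<delta> = (\<lambda>X\<in>Ob A. leg \<pi> X \<rhd> \<beta>) X)"
        by (rule r2 [OF _ _ m]) (use \<beta> in simp_all)
      moreover have "\<alpha> \<in> Hom2 B (Src B \<beta>) (Trg B \<beta>)" "\<beta> \<in> Hom2 B (Src B \<beta>) (Trg B \<beta>)"
        using \<alpha> \<beta> s by simp_all
      ultimately show "\<alpha> = \<beta>"
        using c by (metis (no_types, lifting) restrict_apply')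
    next
      fix p assume "p \<in> precomp2 A B \<pi> ` Arr (hom_cat B E L)"
      then show "p \<in> Arr (sigma_opcone_cat A S B F E)"
        using precomp_functor [OF \<pi>, of E] by (auto simp: functor_between_def)
    next
      fix p assume p: "p \<in> Arr (sigma_opcone_cat A S B F E)"
      obtain h k where h: "h \<in> Hom B E L" "precomp A B \<pi> h = cm_dom p"
        and k: "k \<in> Hom B E L" "precomp A B \<pi> k = cm_cod p"
        using r1 p by (metis sigma_opcone_cat_Arr)
      then obtain \<beta> where \<beta>: "\<beta> \<in> Hom2 B h k" "\<forall>X\<in>Ob A. leg \<pi> X \<rhd> \<beta> = cm_cell p X"
        using r2 [of h k "cm_cell p"] p by auto
      have "cm_cell p \<in> extensional (Ob A)" using p by (auto simp: opcone_morphism_def)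
      then have "p = precomp2 A B \<pi> \<beta>"
        using h(2) k(2) \<beta> by (intro opcone_mor.equality) (auto intro!: extensionalityI [of _ "Ob A"])
      moreover have "\<beta> \<in> Arr (hom_cat B E L)" using \<beta> h k by auto
      ultimately show "p \<in> precomp2 A B \<pi> ` Arr (hom_cat B E L)" by blast
    qed
  qed (use L \<pi> in auto)
qed

section \<open>Elimination and introduction rules for the universal property, and their
  consequences\<close>

lemma oplimit_facts:
  assumes "is_sigma_oplimit A S B F L \<pi>"
  shows "L \<in> Ob B" "sigma_opcone A S B F L \<pi>" "oplax_cone A B F L \<pi>"
  using assms sigma_opcone_oplax unfolding is_sigma_oplimit_def by blast+

lemma oplimit_arr_ex:
  assumes "is_sigma_oplimit A S B F L \<pi>" "E \<in> Ob B" "sigma_opcone A S B F E \<theta>"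
  obtains h where "h \<in> Arr B" "Dom B h = E" "Cod B h = L" "precomp A B \<pi> h = \<theta>"
  using assms unfolding is_sigma_oplimit_iff opcone_representing_def mem_Hom by blast

lemma oplimit_arr_eq:
  assumes lim: "is_sigma_oplimit A S B F L \<pi>"
    and h: "h \<in> Arr B" "Cod B h = L" and k: "k \<in> Arr B" "Cod B k = L" and hk: "Dom B h = Dom B k"
    and eq: "precomp A B \<pi> h = precomp A B \<pi> k"
  shows "h = k"
proof -
  have "Dom B k \<in> Ob B" using k by simp
  then have "\<exists>!h'. h' \<in> Hom B (Dom B k) L \<and> precomp A B \<pi> h' = precomp A B \<pi> k"
    using lim precomp_sigma [OF oplimit_facts(2) [OF lim] k]
    unfolding is_sigma_oplimit_iff opcone_representing_def by blast
  then show ?thesis using h k hk eq by auto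
qed

text \<open>The family \<open>\<alpha>\<close> may be any function; it is restricted to
  \<open>Ob A\<close> inside the proof, so that plain lambda terms can be supplied.\<close>

lemma oplimit_cell_ex:
  assumes lim: "is_sigma_oplimit A S B F L \<pi>"
    and h: "h \<in> Arr B" "Cod B h = L" and k: "k \<in> Arr B" "Cod B k = L" and hk: "Dom B h = Dom B k"
    and \<alpha>: "\<And>X. X \<in> Ob A \<Longrightarrow> \<alpha> X \<in> Hom2 B (leg \<pi> X \<cdot> h) (leg \<pi> X \<cdot> k)"
    and nat: "\<And>f. f \<in> Arr A \<Longrightarrow>
      (FArr F f \<rhd> \<alpha> (Dom A f)) \<odot> (con \<pi> f \<lhd> h) = (con \<pi> f \<lhd> k) \<odot> \<alpha> (Cod A f)"
  obtains \<beta> where "\<beta> \<in> Cell B" "Src B \<beta> = h" "Trg B \<beta> = k" "\<And>X. X \<in> Ob A \<Longrightarrow> leg \<pi> X \<rhd> \<beta> = \<alpha> X"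
proof -
  have "opcone_morphism A B F (precomp A B \<pi> h) (precomp A B \<pi> k) (restrict \<alpha> (Ob A))"
    using \<alpha> nat by (simp add: opcone_morphism_def)
  moreover have "h \<in> Hom B (Dom B k) L" "k \<in> Hom B (Dom B k) L" "Dom B k \<in> Ob B" using h k hk by simp_all
  ultimately have "\<exists>\<beta>. \<beta> \<in> Hom2 B h k \<and> (\<forall>X \<in> Ob A. leg \<pi> X \<rhd> \<beta> = restrict \<alpha> (Ob A) X)"
    using lim unfolding is_sigma_oplimit_iff opcone_representing_def by blast
  then show ?thesis using that by auto
qed

lemma oplimit_cell_eq:
  assumes lim: "is_sigma_oplimit A S B F L \<pi>"
    and \<beta>: "\<beta> \<in> Cell B" "Cod B (Src B \<beta>) = L" and \<gamma>: "\<gamma> \<in> Cell B"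
    and s: "Src B \<beta> = Src B \<gamma>" "Trg B \<beta> = Trg B \<gamma>"
    and eq: "\<And>X. X \<in> Ob A \<Longrightarrow> leg \<pi> X \<rhd> \<beta> = leg \<pi> X \<rhd> \<gamma>"
  shows "\<beta> = \<gamma>"
proof -
  have m: "opcone_morphism A B F (precomp A B \<pi> (Src B \<gamma>)) (precomp A B \<pi> (Trg B \<gamma>)) (\<lambda>X\<in>Ob A. leg \<pi> X \<rhd> \<gamma>)"
    using precomp2_morphism [OF oplimit_facts(3) [OF lim] \<gamma>] \<beta> s by simp
  have h: "Src B \<gamma> \<in> Hom B (Dom B (Src B \<gamma>)) L" "Trg B \<gamma> \<in> Hom B (Dom B (Src B \<gamma>)) L"
    "Dom B (Src B \<gamma>) \<in> Ob B" using \<beta> \<gamma> s by simp_all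
  have "\<exists>!\<delta>. \<delta> \<in> Hom2 B (Src B \<gamma>) (Trg B \<gamma>) \<and> (\<forall>X \<in> Ob A. leg \<pi> X \<rhd> \<delta> = (\<lambda>X\<in>Ob A. leg \<pi> X \<rhd> \<gamma>) X)"
    using lim m h unfolding is_sigma_oplimit_iff opcone_representing_def by blast
  moreover have "\<beta> \<in> Hom2 B (Src B \<gamma>) (Trg B \<gamma>)" "\<gamma> \<in> Hom2 B (Src B \<gamma>) (Trg B \<gamma>)" using \<beta> \<gamma> s by simp_all
  ultimately show ?thesis using eq by (metis (no_types, lifting) restrict_apply')
qed

text \<open>Unique existence is split into existence and uniqueness, and cone morphisms are
  presented as bare families satisfying naturality.\<close>

lemma oplimitI:
  assumes L: "L \<in> Ob B" and \<pi>: "sigma_opcone A S B F L \<pi>"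
    and arr_ex: "\<And>E \<theta>. E \<in> Ob B \<Longrightarrow> sigma_opcone A S B F E \<theta> \<Longrightarrow>
      \<exists>h. h \<in> Arr B \<and> Dom B h = E \<and> Cod B h = L \<and> precomp A B \<pi> h = \<theta>"
    and arr_eq: "\<And>h k. \<lbrakk>h \<in> Arr B; Cod B h = L; k \<in> Arr B; Cod B k = L; Dom B h = Dom B k;
      precomp A B \<pi> h = precomp A B \<pi> k\<rbrakk> \<Longrightarrow> h = k"
    and cell_ex: "\<And>h k \<alpha>. \<lbrakk>h \<in> Arr B; Cod B h = L; k \<in> Arr B; Cod B k = L; Dom B h = Dom B k;
      \<And>X. X \<in> Ob A \<Longrightarrow> \<alpha> X \<in> Hom2 B (leg \<pi> X \<cdot> h) (leg \<pi> X \<cdot> k);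
      \<And>f. f \<in> Arr A \<Longrightarrow>
        (FArr F f \<rhd> \<alpha> (Dom A f)) \<odot> (con \<pi> f \<lhd> h) = (con \<pi> f \<lhd> k) \<odot> \<alpha> (Cod A f)\<rbrakk> \<Longrightarrow>
      \<exists>\<beta>. \<beta> \<in> Cell B \<and> Src B \<beta> = h \<and> Trg B \<beta> = k \<and> (\<forall>X \<in> Ob A. leg \<pi> X \<rhd> \<beta> = \<alpha> X)"
    and cell_eq: "\<And>\<beta> \<gamma>. \<lbrakk>\<beta> \<in> Cell B; Cod B (Src B \<beta>) = L; \<gamma> \<in> Cell B; Src B \<beta> = Src B \<gamma>;
      Trg B \<beta> = Trg B \<gamma>; \<And>X. X \<in> Ob A \<Longrightarrow> leg \<pi> X \<rhd> \<beta> = leg \<pi> X \<rhd> \<gamma>\<rbrakk> \<Longrightarrow> \<beta> = \<gamma>"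
  shows "is_sigma_oplimit A S B F L \<pi>"
  unfolding is_sigma_oplimit_iff opcone_representing_def
proof (intro conjI L \<pi> ballI allI impI)
  fix E \<theta> assume E: "E \<in> Ob B" and \<theta>: "sigma_opcone A S B F E \<theta>"
  show "\<exists>!h. h \<in> Hom B E L \<and> precomp A B \<pi> h = \<theta>"
  proof (rule ex_ex1I)
    show "\<exists>h. h \<in> Hom B E L \<and> precomp A B \<pi> h = \<theta>"
      unfolding mem_Hom using arr_ex [OF E \<theta>] by blast
    show "h = k" if "h \<in> Hom B E L \<and> precomp A B \<pi> h = \<theta>" "k \<in> Hom B E L \<and> precomp A B \<pi> k = \<theta>" for h k
      using arr_eq [of h k] that by simp
  qed
next
  fix E h k \<alpha> assume E: "E \<in> Ob B" and h: "h \<in> Hom B E L" and k: "k \<in> Hom B E L"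
    and \<alpha>: "opcone_morphism A B F (precomp A B \<pi> h) (precomp A B \<pi> k) \<alpha>"
  show "\<exists>!\<beta>. \<beta> \<in> Hom2 B h k \<and> (\<forall>X\<in>Ob A. leg \<pi> X \<rhd> \<beta> = \<alpha> X)"
  proof (rule ex_ex1I)
    have *: "\<alpha> X \<in> Hom2 B (leg \<pi> X \<cdot> h) (leg \<pi> X \<cdot> k)" if "X \<in> Ob A" for X
      using \<alpha> that by (simp add: opcone_morphism_def)
    have **: "(FArr F f \<rhd> \<alpha> (Dom A f)) \<odot> (con \<pi> f \<lhd> h) = (con \<pi> f \<lhd> k) \<odot> \<alpha> (Cod A f)"
      if "f \<in> Arr A" for f
      using \<alpha> that by (simp add: opcone_morphism_def)
    show "\<exists>\<beta>. \<beta> \<in> Hom2 B h k \<and> (\<forall>X\<in>Ob A. leg \<pi> X \<rhd> \<beta> = \<alpha> X)"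
      unfolding mem_Hom2 using cell_ex [of h k \<alpha>, OF _ _ _ _ _ * **] h k by auto
    show "\<beta> = \<gamma>" if "\<beta> \<in> Hom2 B h k \<and> (\<forall>X\<in>Ob A. leg \<pi> X \<rhd> \<beta> = \<alpha> X)"
      "\<gamma> \<in> Hom2 B h k \<and> (\<forall>X\<in>Ob A. leg \<pi> X \<rhd> \<gamma> = \<alpha> X)" for \<beta> \<gamma>
      using cell_eq [of \<beta> \<gamma>] that h by simp
  qed
qed

text \<open>The inverses of the whiskered cells again form a cone morphism: their naturality follows
  from that of \<open>\<beta>\<close> by cancelling
  \<open>leg \<pi> (Cod A f) \<rhd> \<beta>\<close>. The 2-cell they induce is inverse to
  \<open>\<beta>\<close>, since both composites are identities on every projection.\<close>

lemma oplimit_cell_invertible: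
  assumes lim: "is_sigma_oplimit A S B F L \<pi>"
    and \<beta>: "\<beta> \<in> Cell B" "Cod B (Src B \<beta>) = L"
    and inv: "\<And>X. X \<in> Ob A \<Longrightarrow> invertible_cell B (leg \<pi> X \<rhd> \<beta>)"
  shows "invertible_cell B \<beta>"
proof -
  note [simp] = opcone_typing [OF oplimit_facts(3) [OF lim]] \<beta> inv
  let ?i = "\<lambda>X. inv_cell (leg \<pi> X \<rhd> \<beta>)"
  have nat: "(FArr F f \<rhd> ?i (Dom A f)) \<odot> (con \<pi> f \<lhd> Trg B \<beta>) = (con \<pi> f \<lhd> Src B \<beta>) \<odot> ?i (Cod A f)"
    if f [simp]: "f \<in> Arr A" for f
  proof (rule invertible_cancel_right)
    have "((con \<pi> f \<lhd> Trg B \<beta>) \<odot> (leg \<pi> (Cod A f) \<rhd> \<beta>)) =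
      ((FArr F f \<cdot> leg \<pi> (Dom A f)) \<rhd> \<beta>) \<odot> (con \<pi> f \<lhd> Src B \<beta>)"
      by (rule whisker_exchange) simp_all
    then have "((FArr F f \<rhd> ?i (Dom A f)) \<odot> (con \<pi> f \<lhd> Trg B \<beta>)) \<odot> (leg \<pi> (Cod A f) \<rhd> \<beta>) =
      (FArr F f \<rhd> ?i (Dom A f)) \<odot> ((FArr F f \<rhd> (leg \<pi> (Dom A f) \<rhd> \<beta>)) \<odot> (con \<pi> f \<lhd> Src B \<beta>))"
      by simp
    also have "\<dots> = con \<pi> f \<lhd> Src B \<beta>"
      by (rule whisker_inv_cell_cancel) simp_all
    finally show "((FArr F f \<rhd> ?i (Dom A f)) \<odot> (con \<pi> f \<lhd> Trg B \<beta>)) \<odot> (leg \<pi> (Cod A f) \<rhd> \<beta>) =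
      ((con \<pi> f \<lhd> Src B \<beta>) \<odot> ?i (Cod A f)) \<odot> (leg \<pi> (Cod A f) \<rhd> \<beta>)" by simp
  qed simp_all
  obtain \<gamma> where \<gamma>: "\<gamma> \<in> Cell B" "Src B \<gamma> = Trg B \<beta>" "Trg B \<gamma> = Src B \<beta>"
    "\<And>X. X \<in> Ob A \<Longrightarrow> leg \<pi> X \<rhd> \<gamma> = ?i X"
    by (rule oplimit_cell_ex [OF lim, of "Trg B \<beta>" "Src B \<beta>" ?i]) (use nat in simp_all)
  note [simp] = \<gamma>
  show ?thesis
  proof (rule invertible_cellI [of _ \<gamma>])
    show "\<gamma> \<odot> \<beta> = Id2 B (Src B \<beta>)" "\<beta> \<odot> \<gamma> = Id2 B (Trg B \<beta>)"
      by (rule oplimit_cell_eq [OF lim]; simp)+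
  qed simp_all
qed

text \<open>Before \<open>\<beta>\<close> can be compared with an identity, its source and target
  must agree. These are arrows into \<open>L\<close>, so besides the legs also the cone cells have
  to match (\<open>c\<close>), which is the exchange law with both whiskerings of
  \<open>\<beta>\<close> reduced to identities.\<close>

lemma oplimit_cell_identity:
  assumes lim: "is_sigma_oplimit A S B F L \<pi>"
    and \<beta>: "\<beta> \<in> Cell B" "Cod B (Src B \<beta>) = L"
    and ident: "\<And>X. X \<in> Ob A \<Longrightarrow> identity_cell B (leg \<pi> X \<rhd> \<beta>)"
  shows "identity_cell B \<beta>"
proof -
  note [simp] = opcone_typing [OF oplimit_facts(3) [OF lim]] \<beta>
  have e: "leg \<pi> X \<rhd> \<beta> = Id2 B (leg \<pi> X \<cdot> Src B \<beta>)" "leg \<pi> X \<cdot> Src B \<beta> = leg \<pi> X \<cdot> Trg B \<beta>" if X: "X \<in> Ob A" for X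
  proof -
    obtain h where h: "h \<in> Arr B" "leg \<pi> X \<rhd> \<beta> = Id2 B h"
      using ident [OF X] by (auto simp: identity_cell_def)
    have s: "leg \<pi> X \<cdot> Src B \<beta> = h" and t: "leg \<pi> X \<cdot> Trg B \<beta> = h"
      using X hcomp_typing [of \<beta> "Id2 B (leg \<pi> X)", unfolded h(2)] h(1) by simp_all
    show "leg \<pi> X \<rhd> \<beta> = Id2 B (leg \<pi> X \<cdot> Src B \<beta>)" "leg \<pi> X \<cdot> Src B \<beta> = leg \<pi> X \<cdot> Trg B \<beta>"
      by (simp_all add: h(2) s t)
  qed
  have c: "con \<pi> f \<lhd> Src B \<beta> = con \<pi> f \<lhd> Trg B \<beta>" if f [simp]: "f \<in> Arr A" for f
  proof -
    have "(con \<pi> f \<lhd> Trg B \<beta>) \<odot> (leg \<pi> (Cod A f) \<rhd> \<beta>) =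
      ((FArr F f \<cdot> leg \<pi> (Dom A f)) \<rhd> \<beta>) \<odot> (con \<pi> f \<lhd> Src B \<beta>)"
      by (rule whisker_exchange) simp_all
    also have "\<dots> = (FArr F f \<rhd> (leg \<pi> (Dom A f) \<rhd> \<beta>)) \<odot> (con \<pi> f \<lhd> Src B \<beta>)" by simp
    \<comment> \<open>Merging the nested whiskerings would hide
      \<open>leg \<pi> (Dom A f) \<rhd> \<beta>\<close> from \<open>e\<close>.\<close>
    finally show ?thesis by (simp add: e del: whisker_left_left)
  qed
  have s: "Src B \<beta> = Trg B \<beta>"
  proof (rule oplimit_arr_eq [OF lim])
    show "precomp A B \<pi> (Src B \<beta>) = precomp A B \<pi> (Trg B \<beta>)"
      unfolding precomp_def by (auto simp: fun_eq_iff restrict_def c e(2))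
  qed simp_all
  have "\<beta> = Id2 B (Src B \<beta>)"
    by (rule oplimit_cell_eq [OF lim]) (simp_all add: e(1) s [symmetric])
  then show ?thesis using src_trg_typing(1) [OF \<beta>(1)] by (auto simp: identity_cell_def)
qed

text \<open>Both composites of the comparison arrows fix a limit cone, so uniqueness makes them
  identities.\<close>

lemma oplimit_iso:
  assumes lim: "is_sigma_oplimit A S B F L \<pi>" and lim': "is_sigma_oplimit A S B F M \<rho>"
  obtains u v where "u \<in> Hom B M L" "v \<in> Hom B L M" "u \<cdot> v = Id B L" "v \<cdot> u = Id B M"
    "precomp A B \<pi> u = \<rho>"
proof -
  obtain u where u: "u \<in> Arr B" "Dom B u = M" "Cod B u = L" "precomp A B \<pi> u = \<rho>"
    using oplimit_arr_ex [OF lim] oplimit_facts [OF lim'] by metis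
  obtain v where v: "v \<in> Arr B" "Dom B v = L" "Cod B v = M" "precomp A B \<rho> v = \<pi>"
    using oplimit_arr_ex [OF lim'] oplimit_facts [OF lim] by metis
  note L = oplimit_facts(1,3) [OF lim] and M = oplimit_facts(1,3) [OF lim']
  have "u \<cdot> v = Id B L"
    by (rule oplimit_arr_eq [OF lim])
      (use L u v in \<open>simp_all add: precomp_Id flip: precomp_comp [OF L(2)]\<close>)
  moreover have "v \<cdot> u = Id B M"
    by (rule oplimit_arr_eq [OF lim'])
      (use M u v in \<open>simp_all add: precomp_Id flip: precomp_comp [OF M(2)]\<close>)
  ultimately show ?thesis using that u v by simp
qed

text \<open>Every factorization is found through \<open>\<pi>\<close> and then composed with
  \<open>v\<close>; uniqueness follows because composition with \<open>u\<close> is injective.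
  Applied in \<open>K\<close> to the arrow underlying an isomorphism of algebras.\<close>

lemma oplimit_transport:
  assumes lim: "is_sigma_oplimit A S B F L \<pi>"
    and u: "u \<in> Hom B M L" and v: "v \<in> Hom B L M" and uv: "u \<cdot> v = Id B L" and vu: "v \<cdot> u = Id B M"
  shows "is_sigma_oplimit A S B F M (precomp A B \<pi> u)"
proof (rule oplimitI)
  note L = oplimit_facts [OF lim]
  note [simp] = opcone_typing [OF L(3)] L(1)
  have ty [simp]: "u \<in> Arr B" "Dom B u = M" "Cod B u = L" "v \<in> Arr B" "Dom B v = L" "Cod B v = M"
    using u v by simp_all
  have uv' [simp]: "u \<cdot> (v \<cdot> h) = h" if "h \<in> Arr B" "Cod B h = L" for h
    using comp_assoc [of h v u] uv that by simp
  have vu' [simp]: "v \<cdot> (u \<cdot> h) = h" if "h \<in> Arr B" "Cod B h = M" for h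
    using comp_assoc [of h u v] vu that by simp
  have vu2: "v \<rhd> (u \<rhd> \<beta>) = \<beta>" if "\<beta> \<in> Cell B" "Cod B (Src B \<beta>) = M" for \<beta>
    using that by (simp add: vu)
  show M: "M \<in> Ob B" using dom_ob [of u] by (simp del: dom_ob)
  show "sigma_opcone A S B F M (precomp A B \<pi> u)"
    using precomp_sigma [OF L(2), of u] by simp
  show "\<exists>h. h \<in> Arr B \<and> Dom B h = E \<and> Cod B h = M \<and> precomp A B (precomp A B \<pi> u) h = \<theta>"
    if E: "E \<in> Ob B" and \<theta>: "sigma_opcone A S B F E \<theta>" for E \<theta>
  proof -
    obtain h where "h \<in> Arr B" "Dom B h = E" "Cod B h = L" "precomp A B \<pi> h = \<theta>"
      by (rule oplimit_arr_ex [OF lim E \<theta>])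
    then show ?thesis
      by (intro exI [of _ "v \<cdot> h"]) (simp add: precomp_comp [OF L(3)])
  qed
  show "h = k" if "h \<in> Arr B" "Cod B h = M" "k \<in> Arr B" "Cod B k = M" "Dom B h = Dom B k"
    "precomp A B (precomp A B \<pi> u) h = precomp A B (precomp A B \<pi> u) k" for h k
  proof -
    have "u \<cdot> h = u \<cdot> k"
      by (rule oplimit_arr_eq [OF lim]) (use that in \<open>simp_all add: precomp_comp [OF L(3)]\<close>)
    then have "v \<cdot> (u \<cdot> h) = v \<cdot> (u \<cdot> k)" by simp
    then show ?thesis using that by (simp del: comp_assoc)
  qed
  show "\<exists>\<beta>. \<beta> \<in> Cell B \<and> Src B \<beta> = h \<and> Trg B \<beta> = k \<and>
      (\<forall>X\<in>Ob A. leg (precomp A B \<pi> u) X \<rhd> \<beta> = \<alpha> X)"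
    if hk [simp]: "h \<in> Arr B" "Cod B h = M" "k \<in> Arr B" "Cod B k = M" "Dom B h = Dom B k"
      and \<alpha>: "\<And>X. X \<in> Ob A \<Longrightarrow> \<alpha> X \<in> Hom2 B (leg (precomp A B \<pi> u) X \<cdot> h) (leg (precomp A B \<pi> u) X \<cdot> k)"
      and nat: "\<And>f. f \<in> Arr A \<Longrightarrow> (FArr F f \<rhd> \<alpha> (Dom A f)) \<odot> (con (precomp A B \<pi> u) f \<lhd> h) =
        (con (precomp A B \<pi> u) f \<lhd> k) \<odot> \<alpha> (Cod A f)" for h k \<alpha>
  proof -
    obtain \<beta> where \<beta>: "\<beta> \<in> Cell B" "Src B \<beta> = u \<cdot> h" "Trg B \<beta> = u \<cdot> k"
      "\<And>X. X \<in> Ob A \<Longrightarrow> leg \<pi> X \<rhd> \<beta> = \<alpha> X"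
      by (rule oplimit_cell_ex [OF lim, of "u \<cdot> h" "u \<cdot> k" \<alpha>]) (use \<alpha> nat in simp_all)
    have "(leg \<pi> X \<cdot> u) \<rhd> (v \<rhd> \<beta>) = leg \<pi> X \<rhd> \<beta>" if "X \<in> Ob A" for X
      using that \<beta> uv by simp
    then show ?thesis
      using \<beta> by (intro exI [of _ "v \<rhd> \<beta>"]) simp
  qed
  show "\<beta> = \<gamma>" if "\<beta> \<in> Cell B" "Cod B (Src B \<beta>) = M" "\<gamma> \<in> Cell B" "Src B \<beta> = Src B \<gamma>"
    "Trg B \<beta> = Trg B \<gamma>" "\<And>X. X \<in> Ob A \<Longrightarrow> leg (precomp A B \<pi> u) X \<rhd> \<beta> = leg (precomp A B \<pi> u) X \<rhd> \<gamma>" for \<beta> \<gamma>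
  proof -
    have "u \<rhd> \<beta> = u \<rhd> \<gamma>"
      by (rule oplimit_cell_eq [OF lim]) (use that in simp_all)
    then show ?thesis using vu2 [of \<beta>] vu2 [of \<gamma>] that by simp
  qed
qed

text \<open>Conjugation of the cone cells by \<open>\<tau>\<close>. In the law for composites the
  inner pair of \<open>\<tau>\<close> and its inverse cancels; the law for 2-cells of
  \<open>A\<close> is an exchange. Nothing is claimed about arrows of \<open>S\<close>: whether
  their cells become identities depends on the choice of \<open>\<tau>\<close>.\<close>

lemma oplax_cone_transport:
  assumes \<psi>: "oplax_cone A B F E \<psi>"
    and \<tau>: "\<And>X. X \<in> Ob A \<Longrightarrow> invertible_cell B (\<tau> X)"
    and s: "\<And>X. X \<in> Ob A \<Longrightarrow> Src B (\<tau> X) = leg \<psi> X"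
  shows "oplax_cone A B F E \<lparr>leg = (\<lambda>X\<in>Ob A. Trg B (\<tau> X)),
    con = (\<lambda>f\<in>Arr A. (FArr F f \<rhd> \<tau> (Dom A f)) \<odot> (con \<psi> f \<odot> inv_cell (\<tau> (Cod A f))))\<rparr>"
    (is "oplax_cone A B F E ?\<theta>")
  unfolding oplax_cone_def
proof (intro conjI ballI impI)
  note [simp] = opcone_typing [OF \<psi>] \<tau> s
  have c [simp]: "\<tau> X \<in> Cell B" if "X \<in> Ob A" for X
    using that \<tau> invertible_cell_Cell by blast
  have dc [simp]: "Dom B (Trg B (\<tau> X)) = E" "Cod B (Trg B (\<tau> X)) = FOb F X" if "X \<in> Ob A" for X
    using that by simp_all
  show "leg ?\<theta> \<in> extensional (Ob A)" "con ?\<theta> \<in> extensional (Arr A)" by simp_all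
  show "leg ?\<theta> X \<in> Hom B E (FOb F X)" if "X \<in> Ob A" for X
    using that by simp
  show "con ?\<theta> f \<in> Hom2 B (leg ?\<theta> (Cod A f)) (FArr F f \<cdot> leg ?\<theta> (Dom A f))" if "f \<in> Arr A" for f
    using that by simp
  show "con ?\<theta> (Id A X) = Id2 B (leg ?\<theta> X)" if "X \<in> Ob A" for X
    using that by (simp add: opcone_laws(1) [OF \<psi>])
  show "con ?\<theta> (g \<cdot>\<^bsub>A\<^esub> f) = (FArr F g \<rhd> con ?\<theta> f) \<odot> con ?\<theta> g"
    if [simp]: "f \<in> Arr A" "g \<in> Arr A" "Cod A f = Dom A g" for f g
    by (simp add: opcone_laws(2) [OF \<psi>] whisker_inv_cell_cancel)
  show "con ?\<theta> (Trg A \<gamma>) = (FCell F \<gamma> \<lhd> leg ?\<theta> (Dom A (Src A \<gamma>))) \<odot> con ?\<theta> (Src A \<gamma>)"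
    if [simp]: "\<gamma> \<in> Cell A" for \<gamma>
  proof -
    define X Y where XY: "X = Dom A (Src A \<gamma>)" "Y = Cod A (Src A \<gamma>)"
    have ex: "(FCell F \<gamma> \<lhd> Trg B (\<tau> X)) \<odot> (FArr F (Src A \<gamma>) \<rhd> \<tau> X) =
      (FArr F (Trg A \<gamma>) \<rhd> \<tau> X) \<odot> (FCell F \<gamma> \<lhd> leg \<psi> X)"
      by (rule whisker_exchange) (simp_all add: XY)
    show ?thesis
      using vcomp_assoc_subst [OF ex, of "con \<psi> (Src A \<gamma>) \<odot> inv_cell (\<tau> Y)"]
      by (simp add: XY opcone_laws(3) [OF \<psi>])
  qed
qed

end

section \<open>Initial objects of components\<close>

lemma equiv_connected_rel:
  assumes "\<And>f. f \<in> Arr C \<Longrightarrow> Dom C f \<in> Ob C \<and> Cod C f \<in> Ob C"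
  shows "equiv (Ob C) (connected_rel C)"
proof (rule equivI)
  let ?R = "{(Dom C f, Cod C f) |f. f \<in> Arr C}"
  have c: "connected_rel C = (?R \<union> ?R\<inverse>)\<^sup>* \<inter> (Ob C \<times> Ob C)"
    by (simp add: connected_rel_def Let_def)
  show "refl_on (Ob C) (connected_rel C)"
    unfolding c by (auto simp: refl_on_def)
  show "connected_rel C \<subseteq> Ob C \<times> Ob C" unfolding c by blast
  have "sym ((?R \<union> ?R\<inverse>)\<^sup>*)" by (intro sym_rtrancl sym_Un_converse)
  then show "sym (connected_rel C)" unfolding c by (auto simp: sym_def)
  show "trans (connected_rel C)"
    unfolding c by (intro transI) (auto intro: rtrancl_trans)
qed

lemma connected_rel_arr:
  assumes "f \<in> Arr C" "Dom C f \<in> Ob C" "Cod C f \<in> Ob C"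
  shows "(Dom C f, Cod C f) \<in> connected_rel C"
  using assms by (auto simp: connected_rel_def Let_def intro!: r_into_rtrancl)

locale initial_indexing =
  A: two_category A
  for A :: "('x, 'f, 'g) two_cat" +
  fixes S :: "'f set" and I :: "'x set"
  assumes pair: "indexing_pair A S"
    and family: "initial_family A S I"
begin

abbreviation "io \<equiv> init_ob A S I"
abbreviation "ia \<equiv> init_arr A S I"

lemma S_Arr [simp]: "f \<in> S \<Longrightarrow> f \<in> Arr A"
  and Id_S: "X \<in> Ob A \<Longrightarrow> Id A X \<in> S"
  and comp_S: "f \<in> S \<Longrightarrow> g \<in> S \<Longrightarrow> Cod A f = Dom A g \<Longrightarrow> g \<cdot>\<^bsub>A\<^esub> f \<in> S"
  using pair by (auto simp: indexing_pair_def)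

lemma I_Ob [simp]: "X \<in> I \<Longrightarrow> X \<in> Ob A"
  using family by (auto simp: initial_family_def)

abbreviation "conn \<equiv> connected_rel (wide_sub A S)"

lemma equiv_conn: "equiv (Ob A) conn"
  using equiv_connected_rel [of "wide_sub A S"] by (simp add: wide_sub_def)

lemma conn_S: "f \<in> S \<Longrightarrow> (Dom A f, Cod A f) \<in> conn"
  using connected_rel_arr [of f "wide_sub A S"] by (simp add: wide_sub_def)

text \<open>The full subcategory on a component has all arrows of \<open>S\<close> between its
  objects, so initiality there is unique existence of an arrow in \<open>S\<close>. Both
  \<open>THE\<close> terms, in \<open>init_ob\<close> and in \<open>init_arr\<close>, are thereby
  well defined.\<close>

lemma component_initial:
  assumes X: "X \<in> Ob A"
  shows "\<exists>Z. (\<forall>W. W \<in> I \<and> (W, X) \<in> conn \<longleftrightarrow> W = Z) \<and>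
    (\<forall>Y. (Z, Y) \<in> conn \<longrightarrow> (\<exists>!f. f \<in> S \<and> f \<in> Hom A Z Y))"
proof -
  define P where "P = conn `` {X}"
  have "P \<in> components (wide_sub A S)"
    using X by (auto simp: P_def components_def wide_sub_def intro: quotientI)
  then obtain Z where Z: "I \<inter> P = {Z}" "initial_ob (full_sub (wide_sub A S) P) Z"
    using family by (auto simp: initial_family_def)
  have "W \<in> P \<longleftrightarrow> (W, X) \<in> conn" for W
    using equiv_conn by (auto simp: P_def elim: equivE dest: symD)
  then have 1: "\<forall>W. W \<in> I \<and> (W, X) \<in> conn \<longleftrightarrow> W = Z" using Z(1) by blast
  have "\<exists>!f. f \<in> S \<and> f \<in> Hom A Z Y" if "(Z, Y) \<in> conn" for Y
  proof -
    have "(X, Z) \<in> conn" using Z(1) by (auto simp: P_def)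
    then have YP: "Y \<in> P" "Y \<in> Ob A"
      using that equiv_conn by (auto simp: P_def elim!: equivE dest: transD)
    have ZP: "Z \<in> P" using Z(1) by blast
    have "f \<in> Hom (full_sub (wide_sub A S) P) Z Y \<longleftrightarrow> f \<in> S \<and> f \<in> Hom A Z Y" for f
      using YP ZP by (auto simp: full_sub_def wide_sub_def)
    moreover have "\<exists>!f. f \<in> Hom (full_sub (wide_sub A S) P) Z Y"
      using Z(2) YP unfolding initial_ob_def by (simp add: full_sub_def wide_sub_def del: mem_Hom)
    ultimately show ?thesis by simp
  qed
  with 1 show ?thesis by blast
qed

lemma init_ob_props:
  assumes X: "X \<in> Ob A"
  shows "io X \<in> I" "(io X, X) \<in> conn" "W \<in> I \<Longrightarrow> (W, X) \<in> conn \<Longrightarrow> W = io X"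
    "(io X, Y) \<in> conn \<Longrightarrow> \<exists>!f. f \<in> S \<and> f \<in> Hom A (io X) Y"
proof -
  obtain Z where Z: "\<And>W. W \<in> I \<and> (W, X) \<in> conn \<longleftrightarrow> W = Z"
    "\<And>Y. (Z, Y) \<in> conn \<Longrightarrow> \<exists>!f. f \<in> S \<and> f \<in> Hom A Z Y"
    using component_initial [OF X] by blast
  have "io X = Z" by (simp add: init_ob_def Z(1))
  then show "io X \<in> I" "(io X, X) \<in> conn" "W \<in> I \<Longrightarrow> (W, X) \<in> conn \<Longrightarrow> W = io X"
    "(io X, Y) \<in> conn \<Longrightarrow> \<exists>!f. f \<in> S \<and> f \<in> Hom A (io X) Y"
    using Z by blast+
qed

lemma init_arr_props:
  assumes X: "X \<in> Ob A"
  shows "ia X \<in> S" "Dom A (ia X) = io X" "Cod A (ia X) = X"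
    and init_arr_eq: "f \<in> S \<Longrightarrow> Dom A f = io X \<Longrightarrow> Cod A f = X \<Longrightarrow> f = ia X"
proof -
  have u: "\<exists>!f. f \<in> S \<and> f \<in> Hom A (io X) X"
    using init_ob_props(2,4) [OF X] by blast
  have w: "ia X \<in> S" "ia X \<in> Hom A (io X) X"
    unfolding init_arr_def using theI' [OF u] by blast+
  then show "ia X \<in> S" "Dom A (ia X) = io X" "Cod A (ia X) = X"
    by simp_all
  show "f = ia X" if "f \<in> S" "Dom A f = io X" "Cod A f = X"
  proof -
    have "f \<in> Hom A (io X) X" using that by simp
    with u w \<open>f \<in> S\<close> show ?thesis by blast
  qed
qed

lemma init_ob_S:
  assumes "f \<in> S"
  shows "io (Cod A f) = io (Dom A f)"
proof -
  have "(io (Dom A f), Cod A f) \<in> conn"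
    using init_ob_props(2) [of "Dom A f"] conn_S [OF assms] equiv_conn assms
    by (auto elim!: equivE dest: transD)
  then show ?thesis
    using init_ob_props(1) [of "Dom A f"] init_ob_props(3) [of "Cod A f" "io (Dom A f)"] assms by simp
qed

text \<open>The right-hand side lies in \<open>S\<close> and starts at the same initial object, as
  \<open>f\<close> stays inside its component; uniqueness of arrows out of an initial object does
  the rest. This is the source of \<open>lam_S\<close>.\<close>

lemma init_arr_S:
  assumes "f \<in> S"
  shows "ia (Cod A f) = f \<cdot>\<^bsub>A\<^esub> ia (Dom A f)"
  using init_arr_props(1-3) [of "Dom A f"] assms init_ob_S [OF assms]
  by (intro init_arr_eq [symmetric]) (auto intro: comp_S)

text \<open>Makes \<open>lam X\<close> an identity for \<open>X\<close> in \<open>I\<close>, and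
  hence these projections strict.\<close>

lemma init_I:
  assumes "X \<in> I"
  shows "io X = X" "ia X = Id A X"
proof -
  have X: "X \<in> Ob A" using assms by simp
  have "(X, X) \<in> conn" using equiv_conn X by (auto elim!: equivE dest: refl_onD)
  then show o: "io X = X" using init_ob_props(3) [OF X assms] by simp
  show "ia X = Id A X"
    by (rule init_arr_eq [symmetric]) (use X o in \<open>simp_all add: Id_S\<close>)
qed

end

section \<open>Lifting the limit\<close>

lemma two_fun_comp_sel [simp]:
  "FOb (two_fun_comp G F) X = FOb G (FOb F X)" "FArr (two_fun_comp G F) f = FArr G (FArr F f)"
  "FCell (two_fun_comp G F) \<alpha> = FCell G (FCell F \<alpha>)"
  by (simp_all add: two_fun_comp_def)

lemma Forget_sel [simp]: "FOb Forget = fst" "FArr Forget = lax_arr" "FCell Forget = alg_under"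
  by (simp_all add: Forget_def)

locale lax_diagram = monad_context K T + A: two_category A
  for K :: "('o, 'm, 'c) two_cat" (structure) and T :: "('o, 'm, 'c) monad_data"
    and A :: "('x, 'f, 'g) two_cat" +
  fixes S :: "'f set"
    and F :: "('x, 'f, 'g, 'o \<times> 'm, ('o, 'm, 'c) lax_mor, ('o, 'm, 'c) alg_cell) two_fun"
  assumes S_sub: "S \<subseteq> Arr A"
    and F2: "two_functor A (Alg_lax K T) F"
begin

sublocale DA: indexed_diagram A "Alg_lax K T" S F
  by (intro indexed_diagram.intro indexed_diagram_axioms.intro Alg_two_category A.two_category_axioms S_sub F2)

abbreviation "G X \<equiv> fst (FOb F X)"
abbreviation "alg X \<equiv> snd (FOb F X)"
abbreviation "Fa f \<equiv> lax_arr (FArr F f)"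
abbreviation "\<phi> f \<equiv> lax_cell (FArr F f)"
abbreviation "Fc \<gamma> \<equiv> alg_under (FCell F \<gamma>)"

lemma F_alg [simp]: "X \<in> Ob A \<Longrightarrow> FOb F X \<in> algebras K T"
  using DA.F_Ob by simp

lemma F_lax [simp]:
  "f \<in> Arr A \<Longrightarrow> FArr F f \<in> lax_morphisms K T" "f \<in> Arr A \<Longrightarrow> lax_dom (FArr F f) = FOb F (Dom A f)"
  "f \<in> Arr A \<Longrightarrow> lax_cod (FArr F f) = FOb F (Cod A f)"
  using DA.F_Arr_typing by simp_all

lemma F_alg_cell [simp]: "\<gamma> \<in> Cell A \<Longrightarrow> FCell F \<gamma> \<in> alg_cells K T"
  "\<gamma> \<in> Cell A \<Longrightarrow> alg_src (FCell F \<gamma>) = FArr F (Src A \<gamma>)"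
  "\<gamma> \<in> Cell A \<Longrightarrow> alg_trg (FCell F \<gamma>) = FArr F (Trg A \<gamma>)"
  using DA.F_Cell_typing by simp_all

lemma F_lax_laws:
  assumes "f \<in> Arr A"
  shows "\<phi> f \<lhd> Unit T (G (Dom A f)) = Id2 K (Fa f)"
    "\<phi> f \<lhd> Mult T (G (Dom A f)) =
      (\<phi> f \<lhd> T1 (alg (Dom A f))) \<odot> (alg (Cod A f) \<rhd> T2 (\<phi> f))"
  using lax_laws [of "FArr F f"] assms by simp_all

lemma F_cell_law:
  assumes "\<gamma> \<in> Cell A"
  shows "(Fc \<gamma> \<lhd> alg (Dom A (Src A \<gamma>))) \<odot> \<phi> (Src A \<gamma>) =
    \<phi> (Trg A \<gamma>) \<odot> (alg (Cod A (Src A \<gamma>)) \<rhd> T2 (Fc \<gamma>))"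
  using alg_cell_law [of "FCell F \<gamma>"] assms by simp

sublocale D: indexed_diagram A K S "two_fun_comp Forget F"
proof (intro indexed_diagram.intro indexed_diagram_axioms.intro two_category_axioms A.two_category_axioms S_sub)
  have "FCell F (Id2 A f) = Id2 (Alg_lax K T) (FArr F f)" if "f \<in> Arr A" for f
    using DA.F_vfunctor that by (simp add: functor_between_def vert_cat_def)
  moreover have "FCell F (\<beta> \<odot>\<^bsub>A\<^esub> \<alpha>) = FCell F \<beta> \<odot>\<^bsub>Alg_lax K T\<^esub> FCell F \<alpha>"
    if "\<alpha> \<in> Cell A" "\<beta> \<in> Cell A" "Trg A \<alpha> = Src A \<beta>" for \<alpha> \<beta>
    using DA.F_vfunctor that by (simp add: functor_between_def vert_cat_def)
  moreover have "FCell F (\<beta> \<star>\<^bsub>A\<^esub> \<alpha>) = FCell F \<beta> \<star>\<^bsub>Alg_lax K T\<^esub> FCell F \<alpha>"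
    if "\<alpha> \<in> Cell A" "\<beta> \<in> Cell A" "Cod A (Src A \<alpha>) = Dom A (Src A \<beta>)" for \<alpha> \<beta>
    using F2 that unfolding two_functor_def by blast
  ultimately show "two_functor A K (two_fun_comp Forget F)"
    by (simp add: two_functor_def functor_between_def vert_cat_def)
qed

abbreviation "F' \<equiv> two_fun_comp Forget F"

lemma structure_exchange:
  assumes p: "oplax_cone A K F' E \<theta>" and f: "f \<in> Arr A" "g \<in> Arr A" "Cod A f = Dom A g"
  shows "((Fa g \<cdot> alg (Cod A f)) \<rhd> T2 (con \<theta> f)) \<odot> (\<phi> g \<lhd> T1 (leg \<theta> (Cod A f))) =
    (\<phi> g \<lhd> T1 (Fa f \<cdot> leg \<theta> (Dom A f))) \<odot> ((alg (Cod A g) \<cdot> T1 (Fa g)) \<rhd> T2 (con \<theta> f))"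
  by (rule whisker_exchange [symmetric]) (use f D.opcone_typing [OF p] in simp_all)

text \<open>The image of the cone under \<open>T\<close> followed by the structure arrows, with
  \<open>\<phi> f\<close> filling the squares. For \<open>f\<close> in \<open>S\<close> and a
  sigma-s-opcone \<open>\<theta>\<close> the 2-cell reduces to a whiskering of
  \<open>\<phi> f\<close>, so the sigma condition is lost.\<close>

definition structure_opcone :: "('x, 'f, 'm, 'c) opcone \<Rightarrow> ('x, 'f, 'm, 'c) opcone" where
  "structure_opcone \<theta> = \<lparr>leg = (\<lambda>X\<in>Ob A. alg X \<cdot> T1 (leg \<theta> X)),
     con = (\<lambda>f\<in>Arr A. (\<phi> f \<lhd> T1 (leg \<theta> (Dom A f))) \<odot> (alg (Cod A f) \<rhd> T2 (con \<theta> f)))\<rparr>"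

text \<open>For composites, the 2-cell of a composite lax morphism splits, and
  \<open>structure_exchange\<close> moves \<open>T2 (con \<theta> f)\<close> past
  \<open>\<phi> g\<close>. For 2-cells of \<open>A\<close> the reason is that
  \<open>F \<gamma>\<close> is compatible with the lax structures
  (\<open>F_cell_law\<close>).\<close>

lemma structure_opcone_oplax:
  assumes \<theta>: "oplax_cone A K F' E \<theta>" and E: "E \<in> Ob K"
  shows "oplax_cone A K F' (T0 E) (structure_opcone \<theta>)"
  unfolding oplax_cone_def
proof (intro conjI ballI impI)
  note [simp] = D.opcone_typing [OF \<theta>]
  show "leg (structure_opcone \<theta>) \<in> extensional (Ob A)" "con (structure_opcone \<theta>) \<in> extensional (Arr A)"
    by (simp_all add: structure_opcone_def)
  show "leg (structure_opcone \<theta>) X \<in> Hom K (T0 E) (FOb F' X)" if "X \<in> Ob A" for X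
    using that by (simp add: structure_opcone_def)
  show "con (structure_opcone \<theta>) f \<in>
      Hom2 K (leg (structure_opcone \<theta>) (Cod A f)) (FArr F' f \<cdot> leg (structure_opcone \<theta>) (Dom A f))"
    if "f \<in> Arr A" for f
    using that by (simp add: structure_opcone_def)
  show "con (structure_opcone \<theta>) (Id A X) = Id2 K (leg (structure_opcone \<theta>) X)" if "X \<in> Ob A" for X
    using that by (simp add: structure_opcone_def D.opcone_laws(1) [OF \<theta>])
  show "con (structure_opcone \<theta>) (g \<cdot>\<^bsub>A\<^esub> f) =
      (FArr F' g \<rhd> con (structure_opcone \<theta>) f) \<odot> con (structure_opcone \<theta>) g"
    if [simp]: "f \<in> Arr A" "g \<in> Arr A" "Cod A f = Dom A g" for f g
    using vcomp_assoc_subst [OF structure_exchange [OF \<theta>, of f g], of "alg (Cod A g) \<rhd> T2 (con \<theta> g)"]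
    by (simp add: structure_opcone_def D.opcone_laws(2) [OF \<theta>])
  show "con (structure_opcone \<theta>) (Trg A \<gamma>) =
      (FCell F' \<gamma> \<lhd> leg (structure_opcone \<theta>) (Dom A (Src A \<gamma>))) \<odot> con (structure_opcone \<theta>) (Src A \<gamma>)"
    if [simp]: "\<gamma> \<in> Cell A" for \<gamma>
  proof -
    define X Y where XY: "X = Dom A (Src A \<gamma>)" "Y = Cod A (Src A \<gamma>)"
    have *: "((Fc \<gamma> \<lhd> alg X) \<lhd> T1 (leg \<theta> X)) \<odot> (\<phi> (Src A \<gamma>) \<lhd> T1 (leg \<theta> X)) =
      (\<phi> (Trg A \<gamma>) \<lhd> T1 (leg \<theta> X)) \<odot> ((alg Y \<rhd> T2 (Fc \<gamma>)) \<lhd> T1 (leg \<theta> X))"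
      using arg_cong [OF F_cell_law [OF that], of "\<lambda>\<alpha>. \<alpha> \<lhd> T1 (leg \<theta> X)"] by (simp add: XY)
    show ?thesis
      using vcomp_assoc_subst [OF *, of "alg Y \<rhd> T2 (con \<theta> (Src A \<gamma>))"]
      by (simp add: structure_opcone_def XY D.opcone_laws(3) [OF \<theta>])
  qed
qed

lemma Alg_opcone_typing [simp]:
  assumes "oplax_cone A (Alg_lax K T) F E \<theta>"
  shows "X \<in> Ob A \<Longrightarrow> leg \<theta> X \<in> lax_morphisms K T"
    "X \<in> Ob A \<Longrightarrow> lax_dom (leg \<theta> X) = E" "X \<in> Ob A \<Longrightarrow> lax_cod (leg \<theta> X) = FOb F X"
    "f \<in> Arr A \<Longrightarrow> con \<theta> f \<in> alg_cells K T" "f \<in> Arr A \<Longrightarrow> alg_src (con \<theta> f) = leg \<theta> (Cod A f)"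
    "f \<in> Arr A \<Longrightarrow> alg_trg (con \<theta> f) = lax_comp K T (FArr F f) (leg \<theta> (Dom A f))"
  using DA.opcone_typing [OF assms] by simp_all

lemma map_opcone_sel [simp]:
  "X \<in> Ob A \<Longrightarrow> leg (map_opcone A Forget \<theta>) X = lax_arr (leg \<theta> X)"
  "f \<in> Arr A \<Longrightarrow> con (map_opcone A Forget \<theta>) f = alg_under (con \<theta> f)"
  by (simp_all add: map_opcone_def)

lemma map_opcone_sigma:
  assumes \<theta>: "sigma_opcone A S (Alg_lax K T) F E \<theta>"
  shows "sigma_opcone A S K F' (fst E) (map_opcone A Forget \<theta>)"
  unfolding sigma_opcone_def oplax_cone_def
proof (intro conjI ballI impI)
  note o = DA.sigma_opcone_oplax [OF \<theta>]
  note [simp] = Alg_opcone_typing [OF o]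
  let ?\<theta> = "map_opcone A Forget \<theta>"
  show "leg ?\<theta> \<in> extensional (Ob A)" "con ?\<theta> \<in> extensional (Arr A)"
    by (simp_all add: map_opcone_def)
  show "leg ?\<theta> X \<in> Hom K (fst E) (FOb F' X)" if "X \<in> Ob A" for X
    using that by simp
  show "con ?\<theta> f \<in> Hom2 K (leg ?\<theta> (Cod A f)) (FArr F' f \<cdot> leg ?\<theta> (Dom A f))" if "f \<in> Arr A" for f
    using that by simp
  show "con ?\<theta> (Id A X) = Id2 K (leg ?\<theta> X)" if "X \<in> Ob A" for X
    using that DA.opcone_laws(1) [OF o, of X] by simp
  show "con ?\<theta> (g \<cdot>\<^bsub>A\<^esub> f) = (FArr F' g \<rhd> con ?\<theta> f) \<odot> con ?\<theta> g"
    if "f \<in> Arr A" "g \<in> Arr A" "Cod A f = Dom A g" for f g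
    using that DA.opcone_laws(2) [OF o, of f g] by simp
  show "con ?\<theta> (Trg A \<gamma>) = (FCell F' \<gamma> \<lhd> leg ?\<theta> (Dom A (Src A \<gamma>))) \<odot> con ?\<theta> (Src A \<gamma>)"
    if "\<gamma> \<in> Cell A" for \<gamma>
    using that DA.opcone_laws(3) [OF o, of \<gamma>] by simp
  show "identity_cell K (con ?\<theta> f)" if "f \<in> S" for f
  proof -
    have "f \<in> Arr A" using that S_sub by blast
    then show ?thesis
      using DA.sigma_opcone_identity(1) [OF \<theta> that]
      by (auto simp: identity_cell_def intro!: bexI [of _ "lax_arr (leg \<theta> (Cod A f))"])
  qed
qed

lemma map_opcone_precomp:
  "map_opcone A Forget (precomp A (Alg_lax K T) \<theta> h) = precomp A K (map_opcone A Forget \<theta>) (lax_arr h)"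
  by (simp add: map_opcone_def precomp_def restrict_def fun_eq_iff)

end

locale lifting = lax_diagram K T A S F + initial_indexing A S I
  for K :: "('o, 'm, 'c) two_cat" (structure) and T :: "('o, 'm, 'c) monad_data"
    and A :: "('x, 'f, 'g) two_cat" and S :: "'f set"
    and F :: "('x, 'f, 'g, 'o \<times> 'm, ('o, 'm, 'c) lax_mor, ('o, 'm, 'c) alg_cell) two_fun"
    and I :: "'x set" +
  fixes L :: 'o and \<pi> :: "('x, 'f, 'm, 'c) opcone"
  assumes init_invertible: "X \<in> Ob A \<Longrightarrow> invertible_cell K (lax_cell (FArr F (init_arr A S I X)))"
    and lim: "is_sigma_oplimit A S K (two_fun_comp Forget F) L \<pi>"
begin

abbreviation "p \<equiv> leg \<pi>"
abbreviation "q \<equiv> con \<pi>"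

lemmas L_Ob [simp] = D.oplimit_facts(1) [OF lim]
lemmas \<pi>_sigma = D.oplimit_facts(2) [OF lim]
lemmas \<pi>_oplax = D.oplimit_facts(3) [OF lim]
lemmas \<pi>_typing [simp] = D.opcone_typing [OF \<pi>_oplax, unfolded two_fun_comp_sel Forget_sel]

lemma io_Ob [simp]: "X \<in> Ob A \<Longrightarrow> io X \<in> Ob A"
  by (rule I_Ob) (rule init_ob_props)

lemma ia_typing [simp]:
  assumes "X \<in> Ob A"
  shows "ia X \<in> S" "ia X \<in> Arr A" "Dom A (ia X) = io X" "Cod A (ia X) = X"
  using init_arr_props(1-3) [OF assms] by simp_all

lemma leg_S: "f \<in> S \<Longrightarrow> p (Cod A f) = Fa f \<cdot> p (Dom A f)"
  using D.sigma_opcone_identity(2) [OF \<pi>_sigma] by simp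

lemma leg_ia: "X \<in> Ob A \<Longrightarrow> Fa (ia X) \<cdot> p (io X) = p X"
  using leg_S [of "ia X"] by simp

section \<open>The invertible comparison cells and the structure arrow on the limit\<close>

definition lam :: "'x \<Rightarrow> 'c" where
  "lam X = \<phi> (ia X) \<lhd> T1 (p (io X))"

lemma lam_invertible [simp]: "X \<in> Ob A \<Longrightarrow> invertible_cell K (lam X)"
  unfolding lam_def by (rule invertible_whisker_right) (simp_all add: init_invertible)

lemma lam_Cell [simp]: "X \<in> Ob A \<Longrightarrow> lam X \<in> Cell K"
  by (rule invertible_cell_Cell) simp

lemma lam_Src [simp]: "X \<in> Ob A \<Longrightarrow> Src K (lam X) = alg X \<cdot> T1 (p X)"
  by (simp add: lam_def flip: leg_ia [of X])

lemma lam_S: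
  assumes f: "f \<in> S"
  shows "lam (Cod A f) = (Fa f \<rhd> lam (Dom A f)) \<odot> (\<phi> f \<lhd> T1 (p (Dom A f)))"
proof -
  have [simp]: "f \<in> Arr A" using f by simp
  show ?thesis
    by (simp add: lam_def init_arr_S [OF f] init_ob_S [OF f] flip: leg_ia [of "Dom A f"])
qed

lemma lam_I:
  assumes "X \<in> I"
  shows "lam X = Id2 K (alg X \<cdot> T1 (p X))"
  using assms by (simp add: lam_def init_I)

definition str_opcone :: "('x, 'f, 'm, 'c) opcone" where
  "str_opcone = \<lparr>leg = (\<lambda>X\<in>Ob A. Trg K (lam X)),
    con = (\<lambda>f\<in>Arr A. (Fa f \<rhd> lam (Dom A f)) \<odot> (con (structure_opcone \<pi>) f \<odot> inv_cell (lam (Cod A f))))\<rparr>"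

lemma str_opcone_sigma: "sigma_opcone A S K F' (T0 L) str_opcone"
  unfolding sigma_opcone_def
proof (intro conjI ballI)
  have "oplax_cone A K F' (T0 L) \<lparr>leg = (\<lambda>X\<in>Ob A. Trg K (lam X)),
    con = (\<lambda>f\<in>Arr A. (FArr F' f \<rhd> lam (Dom A f)) \<odot> (con (structure_opcone \<pi>) f \<odot> inv_cell (lam (Cod A f))))\<rparr>"
    by (rule D.oplax_cone_transport [OF structure_opcone_oplax [OF \<pi>_oplax L_Ob]])
      (simp_all add: structure_opcone_def)
  then show "oplax_cone A K F' (T0 L) str_opcone"
    by (simp add: str_opcone_def)
  fix f assume f: "f \<in> S"
  then have fA [simp]: "f \<in> Arr A" by simp
  have q: "q f = Id2 K (Fa f \<cdot> p (Dom A f))"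
    using D.sigma_opcone_identity [OF \<pi>_sigma f] by simp
  have "con str_opcone f = ((Fa f \<rhd> lam (Dom A f)) \<odot> (\<phi> f \<lhd> T1 (p (Dom A f)))) \<odot> inv_cell (lam (Cod A f))"
    by (simp add: str_opcone_def structure_opcone_def q leg_S [OF f])
  \<comment> \<open>By \<open>lam_S\<close> the bracket is \<open>lam (Cod A f)\<close> itself,
    which meets its own inverse.\<close>
  also have "\<dots> = Id2 K (Trg K (lam (Cod A f)))"
    by (simp flip: lam_S [OF f])
  finally have "con str_opcone f = Id2 K (Trg K (lam (Cod A f)))" .
  then show "identity_cell K (con str_opcone f)"
    by (auto simp: identity_cell_def)
qed

definition str :: 'm where
  "str = (SOME l. l \<in> Arr K \<and> Dom K l = T0 L \<and> Cod K l = L \<and> precomp A K \<pi> l = str_opcone)"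

lemma str_typing [simp]: "str \<in> Arr K" "Dom K str = T0 L" "Cod K str = L"
  and str_precomp: "precomp A K \<pi> str = str_opcone"
proof -
  have "\<exists>l. l \<in> Arr K \<and> Dom K l = T0 L \<and> Cod K l = L \<and> precomp A K \<pi> l = str_opcone"
    using D.oplimit_arr_ex [OF lim _ str_opcone_sigma] by (metis L_Ob T0_Ob)
  from someI_ex [OF this]
  show "str \<in> Arr K" "Dom K str = T0 L" "Cod K str = L" "precomp A K \<pi> str = str_opcone"
    unfolding str_def by blast+
qed

text \<open>By construction the target of \<open>lam X\<close> is
  \<open>Fa (ia X) \<cdot> alg (io X) \<cdot> T1 (p (io X))\<close>; the choice of
  \<open>str\<close> lets it be read as the target required of a lax structure on
  \<open>p X\<close>.\<close>

lemma lam_Trg [simp]: "X \<in> Ob A \<Longrightarrow> Trg K (lam X) = p X \<cdot> str"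
  using D.precomp_sel(1) [of X \<pi> str] str_precomp by (simp add: str_opcone_def)

text \<open>The defining property of \<open>str\<close> with the inverse moved to the other side. It
  is literally the condition that \<open>q f\<close> be a 2-cell of algebras from the lifted
  projection at \<open>Cod A f\<close> to the composite of \<open>FArr F f\<close> with the one at
  \<open>Dom A f\<close>.\<close>

lemma str_cell:
  assumes f: "f \<in> Arr A"
  shows "(q f \<lhd> str) \<odot> lam (Cod A f) =
    (Fa f \<rhd> lam (Dom A f)) \<odot> ((\<phi> f \<lhd> T1 (p (Dom A f))) \<odot> (alg (Cod A f) \<rhd> T2 (q f)))"
proof -
  have "q f \<lhd> str = con str_opcone f"
    using D.precomp_sel(2) [of f \<pi> str] f by (simp add: str_precomp)
  then show ?thesis
    using f by (simp add: str_opcone_def structure_opcone_def)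
qed

section \<open>Unit and multiplication laws, for the comparison cells and then for the structure
  arrow\<close>

lemma lam_unit:
  assumes X: "X \<in> Ob A"
  shows "lam X \<lhd> Unit T L = Id2 K (p X)"
proof -
  \<comment> \<open>Naturality of the unit at \<open>p (io X)\<close> exposes the unit law of the
    lax morphism \<open>FArr F (ia X)\<close>.\<close>
  have "lam X \<lhd> Unit T L = \<phi> (ia X) \<lhd> (Unit T (G (io X)) \<cdot> p (io X))"
    using X unit_natural [of "p (io X)"] by (simp add: lam_def)
  also have "\<dots> = (\<phi> (ia X) \<lhd> Unit T (G (io X))) \<lhd> p (io X)"
    using X by simp
  also have "\<dots> = Id2 K (p X)"
    using F_lax_laws(1) [of "ia X"] X by (simp add: leg_ia)
  finally show ?thesis .
qed

lemma leg_str_io: "X \<in> Ob A \<Longrightarrow> p (io X) \<cdot> str = alg (io X) \<cdot> T1 (p (io X))"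
  using lam_I [OF init_ob_props(1), of X] lam_Trg [of "io X"] by simp

lemma \<phi>_mult:
  assumes f: "f \<in> Arr A" and g: "g \<in> Arr K" "Cod K g = G (Dom A f)"
  shows "\<phi> f \<lhd> (T1 g \<cdot> Mult T (Dom K g)) =
    (\<phi> f \<lhd> (T1 (alg (Dom A f)) \<cdot> T1 (T1 g))) \<odot> (alg (Cod A f) \<rhd> (T2 (\<phi> f) \<lhd> T1 (T1 g)))"
proof -
  have "\<phi> f \<lhd> (T1 g \<cdot> Mult T (Dom K g)) = \<phi> f \<lhd> (Mult T (G (Dom A f)) \<cdot> T1 (T1 g))"
    using f g mult_natural [of g] by simp
  also have "\<dots> = (\<phi> f \<lhd> Mult T (G (Dom A f))) \<lhd> T1 (T1 g)"
    using f g by simp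
  also have "\<dots> = ((\<phi> f \<lhd> T1 (alg (Dom A f))) \<odot> (alg (Cod A f) \<rhd> T2 (\<phi> f))) \<lhd> T1 (T1 g)"
    by (simp add: F_lax_laws(2) [OF f])
  finally show ?thesis using f g by simp
qed

text \<open>The multiplication law of \<open>FArr F (ia X)\<close>, moved along
  \<open>p (io X)\<close> by naturality. The image under \<open>T\<close> of
  \<open>leg_str_io\<close> then replaces the structure arrow of \<open>FOb F (io X)\<close> by
  \<open>str\<close>.\<close>

lemma lam_mult:
  assumes X: "X \<in> Ob A"
  shows "lam X \<lhd> Mult T L = (lam X \<lhd> T1 str) \<odot> (alg X \<rhd> T2 (lam X))"
proof -
  have *: "T1 (p (io X)) \<cdot> T1 str = T1 (alg (io X)) \<cdot> T1 (T1 (p (io X)))"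
    using arg_cong [OF leg_str_io [OF X], of T1] X by simp
  show ?thesis
    using X \<phi>_mult [of "ia X" "p (io X)"] by (simp add: lam_def *)
qed

text \<open>Two arrows into \<open>L\<close> are equal when they agree on the legs and on the cone
  cells; \<open>leg\<close> and \<open>con\<close> check these in turn.\<close>

lemma str_unit: "str \<cdot> Unit T L = Id K L"
proof (rule D.oplimit_arr_eq [OF lim])
  \<comment> \<open>Equal 2-cells have equal targets, and the targets in \<open>lam_unit\<close> are
    these two arrows.\<close>
  have leg: "p X \<cdot> (str \<cdot> Unit T L) = p X" if "X \<in> Ob A" for X
    using arg_cong [OF lam_unit [OF that], of "Trg K"] that by simp
  have con: "q f \<lhd> (str \<cdot> Unit T L) = q f" if f [simp]: "f \<in> Arr A" for f
  proof -
    have 1: "\<phi> f \<lhd> (T1 (p (Dom A f)) \<cdot> Unit T L) = Id2 K (Fa f \<cdot> p (Dom A f))"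
    proof -
      have "\<phi> f \<lhd> (T1 (p (Dom A f)) \<cdot> Unit T L) = (\<phi> f \<lhd> Unit T (G (Dom A f))) \<lhd> p (Dom A f)"
        using unit_natural [of "p (Dom A f)"] by simp
      then show ?thesis by (simp add: F_lax_laws(1))
    qed
    have 2: "alg (Cod A f) \<rhd> (T2 (q f) \<lhd> Unit T L) = q f"
    proof -
      have "alg (Cod A f) \<rhd> (T2 (q f) \<lhd> Unit T L) = (alg (Cod A f) \<cdot> Unit T (G (Cod A f))) \<rhd> q f"
        using unit_natural2 [of "q f"] by simp
      then show ?thesis using algebra_laws(1) [of "FOb F (Cod A f)"] by simp
    qed
    \<comment> \<open>Whiskered with the unit, \<open>str_cell\<close> keeps only the
      \<open>q f\<close> terms: both \<open>lam\<close> factors become identities by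
      \<open>lam_unit\<close>, and the \<open>\<phi> f\<close> factor by \<open>1\<close>.\<close>
    show ?thesis
      using arg_cong [OF str_cell [OF f], of "\<lambda>\<alpha>. \<alpha> \<lhd> Unit T L"]
      by (simp add: lam_unit 1 2 leg)
  qed
  show "precomp A K \<pi> (str \<cdot> Unit T L) = precomp A K \<pi> (Id K L)"
    unfolding precomp_def by (auto simp: fun_eq_iff restrict_def leg con)
qed simp_all

lemma str_mult: "str \<cdot> Mult T L = str \<cdot> T1 str"
proof (rule D.oplimit_arr_eq [OF lim])
  \<comment> \<open>Again the equation of arrows is the equality of targets in a law for
    \<open>lam\<close>.\<close>
  have leg: "p X \<cdot> (str \<cdot> Mult T L) = p X \<cdot> (str \<cdot> T1 str)" if "X \<in> Ob A" for X
    using arg_cong [OF lam_mult [OF that], of "Trg K"] that by simp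
  have con: "q f \<lhd> (str \<cdot> Mult T L) = q f \<lhd> (str \<cdot> T1 str)" if f [simp]: "f \<in> Arr A" for f
  \<comment> \<open>Composing with \<open>lam (Cod A f) \<lhd> Mult T L\<close> makes
    \<open>str_cell\<close> applicable to the left side and \<open>lam_mult\<close> to the
    right.\<close>
  proof (rule invertible_cancel_right)
    define X Y where XY: "X = Dom A f" "Y = Cod A f"
    have [simp]: "X \<in> Ob A" "Y \<in> Ob A" "Dom A f = X" "Cod A f = Y" by (simp_all add: XY)
    note cell = str_cell [OF f, folded XY]
    have m: "T2 (q f) \<lhd> Mult T L = Mult T (G Y) \<rhd> T2 (T2 (q f))"
      using mult_natural2 [of "q f"] by simp
    have m': "alg Y \<rhd> (T2 (q f) \<lhd> Mult T L) = (alg Y \<cdot> T1 (alg Y)) \<rhd> T2 (T2 (q f))"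
      using algebra_laws(2) [of "FOb F Y"] by (simp add: m)
    have \<phi>m: "\<phi> f \<lhd> (T1 (p X) \<cdot> Mult T L) = (\<phi> f \<lhd> (T1 (alg X) \<cdot> T1 (T1 (p X)))) \<odot> (alg Y \<rhd> (T2 (\<phi> f) \<lhd> T1 (T1 (p X))))"
      using \<phi>_mult [OF f, of "p X"] by simp
    have "(q f \<lhd> (str \<cdot> Mult T L)) \<odot> (lam Y \<lhd> Mult T L) = ((q f \<lhd> str) \<odot> lam Y) \<lhd> Mult T L"
      by simp
    also have "\<dots> = (Fa f \<rhd> (lam X \<lhd> Mult T L)) \<odot> ((\<phi> f \<lhd> (T1 (p X) \<cdot> Mult T L)) \<odot> (alg Y \<rhd> (T2 (q f) \<lhd> Mult T L)))"
      by (simp add: cell)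
    also have "\<dots> = (Fa f \<rhd> (lam X \<lhd> T1 str)) \<odot> ((((Fa f \<cdot> alg X) \<rhd> T2 (lam X)) \<odot> (\<phi> f \<lhd> (T1 (alg X) \<cdot> T1 (T1 (p X))))) \<odot>
        (alg Y \<rhd> ((T2 (\<phi> f) \<lhd> T1 (T1 (p X))) \<odot> (T1 (alg Y) \<rhd> T2 (T2 (q f))))))"
      by (simp add: lam_mult m' \<phi>m)
    \<comment> \<open>The exchange uncovers a copy of the right side of \<open>str_cell\<close>
      under \<open>T2\<close>. Folding it supplies the factor \<open>T2 (q f)\<close> that completes
      a second, outer copy, whiskered with \<open>T1 str\<close>, which is folded next.\<close>
    also have "((Fa f \<cdot> alg X) \<rhd> T2 (lam X)) \<odot> (\<phi> f \<lhd> (T1 (alg X) \<cdot> T1 (T1 (p X)))) =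
        (\<phi> f \<lhd> (T1 (p X) \<cdot> T1 str)) \<odot> ((alg Y \<cdot> T1 (Fa f)) \<rhd> T2 (lam X))"
      by (rule whisker_exchange [symmetric]) simp_all
    also have "(Fa f \<rhd> (lam X \<lhd> T1 str)) \<odot> ((\<phi> f \<lhd> (T1 (p X) \<cdot> T1 str)) \<odot> ((alg Y \<cdot> T1 (Fa f)) \<rhd> T2 (lam X)) \<odot>
        (alg Y \<rhd> ((T2 (\<phi> f) \<lhd> T1 (T1 (p X))) \<odot> (T1 (alg Y) \<rhd> T2 (T2 (q f)))))) =
        (Fa f \<rhd> (lam X \<lhd> T1 str)) \<odot> ((\<phi> f \<lhd> (T1 (p X) \<cdot> T1 str)) \<odot>
        (alg Y \<rhd> T2 ((Fa f \<rhd> lam X) \<odot> ((\<phi> f \<lhd> T1 (p X)) \<odot> (alg Y \<rhd> T2 (q f))))))"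
      by simp
    also have "\<dots> = (Fa f \<rhd> (lam X \<lhd> T1 str)) \<odot> ((\<phi> f \<lhd> (T1 (p X) \<cdot> T1 str)) \<odot> (alg Y \<rhd> T2 ((q f \<lhd> str) \<odot> lam Y)))"
      by (simp only: cell)
    also have "\<dots> = (((Fa f \<rhd> lam X) \<odot> ((\<phi> f \<lhd> T1 (p X)) \<odot> (alg Y \<rhd> T2 (q f)))) \<lhd> T1 str) \<odot> (alg Y \<rhd> T2 (lam Y))"
      by simp
    also have "\<dots> = (((q f \<lhd> str) \<odot> lam Y) \<lhd> T1 str) \<odot> (alg Y \<rhd> T2 (lam Y))"
      by (simp only: cell)
    also have "\<dots> = (q f \<lhd> (str \<cdot> T1 str)) \<odot> (lam Y \<lhd> Mult T L)"
      by (simp add: lam_mult)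
    finally show "(q f \<lhd> (str \<cdot> Mult T L)) \<odot> (lam (Cod A f) \<lhd> Mult T L) =
      (q f \<lhd> (str \<cdot> T1 str)) \<odot> (lam (Cod A f) \<lhd> Mult T L)" by simp
  qed (simp_all add: leg)
  show "precomp A K \<pi> (str \<cdot> Mult T L) = precomp A K \<pi> (str \<cdot> T1 str)"
    unfolding precomp_def by (auto simp: fun_eq_iff restrict_def leg con)
qed simp_all

section \<open>The lifted cone\<close>

definition lifted_leg :: "'x \<Rightarrow> ('o, 'm, 'c) lax_mor" where
  "lifted_leg X = \<lparr>lax_dom = (L, str), lax_cod = FOb F X, lax_arr = p X, lax_cell = lam X\<rparr>"

lemma lifted_leg_sel [simp]:
  "lax_dom (lifted_leg X) = (L, str)" "lax_cod (lifted_leg X) = FOb F X"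
  "lax_arr (lifted_leg X) = p X" "lax_cell (lifted_leg X) = lam X"
  by (simp_all add: lifted_leg_def)

lemma str_algebra [simp]: "(L, str) \<in> algebras K T"
  by (simp add: algebra_iff str_unit str_mult)

lemma lifted_leg_lax [simp]: "X \<in> Ob A \<Longrightarrow> lifted_leg X \<in> lax_morphisms K T"
  by (simp add: lax_morphism_iff lam_unit lam_mult)

definition lifted :: "('x, 'f, ('o, 'm, 'c) lax_mor, ('o, 'm, 'c) alg_cell) opcone" where
  "lifted = \<lparr>leg = (\<lambda>X\<in>Ob A. lifted_leg X),
    con = (\<lambda>f\<in>Arr A. \<lparr>alg_src = lifted_leg (Cod A f),
      alg_trg = lax_comp K T (FArr F f) (lifted_leg (Dom A f)), alg_under = q f\<rparr>)\<rparr>"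

lemma lifted_sel [simp]:
  "X \<in> Ob A \<Longrightarrow> leg lifted X = lifted_leg X"
  "f \<in> Arr A \<Longrightarrow> con lifted f = \<lparr>alg_src = lifted_leg (Cod A f),
      alg_trg = lax_comp K T (FArr F f) (lifted_leg (Dom A f)), alg_under = q f\<rparr>"
  by (simp_all add: lifted_def)

text \<open>Equality on the nose relies on \<open>\<pi>\<close> being extensional, so that the
  restrictions leave it unchanged.\<close>

lemma map_lifted: "map_opcone A Forget lifted = \<pi>"
proof -
  note ext = D.opcone_ext [OF \<pi>_oplax]
  have "restrict p (Ob A) = p" "restrict q (Arr A) = q"
    using ext by (simp_all add: extensional_restrict)
  then show ?thesis
    by (intro opcone.equality) (simp_all add: map_opcone_def cong: restrict_cong)
qed

text \<open>The cone laws are those of \<open>\<pi>\<close> on underlying cells. Two points are new: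
  \<open>str_cell\<close> makes each \<open>q f\<close> a 2-cell of algebras, and for
  \<open>f\<close> in \<open>S\<close> an identity 2-cell requires its boundary lax morphisms to
  coincide including their 2-cells, which is \<open>lam_S\<close>.\<close>

lemma lifted_sigma: "sigma_opcone A S (Alg_lax K T) F (L, str) lifted"
  unfolding sigma_opcone_def oplax_cone_def
proof (intro conjI ballI impI)
  show "leg lifted \<in> extensional (Ob A)" "con lifted \<in> extensional (Arr A)"
    by (simp_all add: lifted_def)
  show "leg lifted X \<in> Hom (Alg_lax K T) (L, str) (FOb F X)" if "X \<in> Ob A" for X
    using that by simp
  show "con lifted f \<in> Hom2 (Alg_lax K T) (leg lifted (Cod A f)) (FArr F f \<cdot>\<^bsub>Alg_lax K T\<^esub> leg lifted (Dom A f))"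
    if "f \<in> Arr A" for f
    using that by (simp add: alg_cell_iff str_cell)
  show "con lifted (Id A X) = Id2 (Alg_lax K T) (leg lifted X)" if "X \<in> Ob A" for X
    using that D.opcone_laws(1) [OF \<pi>_oplax, of X] by simp
  show "con lifted (g \<cdot>\<^bsub>A\<^esub> f) = (FArr F g \<rhd>\<^bsub>Alg_lax K T\<^esub> con lifted f) \<odot>\<^bsub>Alg_lax K T\<^esub> con lifted g"
    if "f \<in> Arr A" "g \<in> Arr A" "Cod A f = Dom A g" for f g
    using that D.opcone_laws(2) [OF \<pi>_oplax, of f g] by simp
  show "con lifted (Trg A \<gamma>) =
      (FCell F \<gamma> \<lhd>\<^bsub>Alg_lax K T\<^esub> leg lifted (Dom A (Src A \<gamma>))) \<odot>\<^bsub>Alg_lax K T\<^esub> con lifted (Src A \<gamma>)"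
    if "\<gamma> \<in> Cell A" for \<gamma>
    using that D.opcone_laws(3) [OF \<pi>_oplax, of \<gamma>] by simp
  show "identity_cell (Alg_lax K T) (con lifted f)" if f: "f \<in> S" for f
  proof -
    have [simp]: "f \<in> Arr A" using f by simp
    have "lax_comp K T (FArr F f) (lifted_leg (Dom A f)) = lifted_leg (Cod A f)"
      by (rule lax_mor_eqI) (simp_all add: leg_S [OF f] lam_S [OF f])
    then show ?thesis
      using D.sigma_opcone_identity(1) [OF \<pi>_sigma f]
      by (auto simp: identity_cell_def intro!: bexI [of _ "lifted_leg (Cod A f)"])
  qed
qed

section \<open>Lifting arrows and 2-cells through the projections\<close>

lemma lam_exchange:
  assumes "\<alpha> \<in> Cell K" "Cod K (Src K \<alpha>) = T0 L" "X \<in> Ob A"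
  shows "(lam X \<lhd> Trg K \<alpha>) \<odot> ((alg X \<cdot> T1 (p X)) \<rhd> \<alpha>) = ((p X \<cdot> str) \<rhd> \<alpha>) \<odot> (lam X \<lhd> Src K \<alpha>)"
  by (rule whisker_exchange) (use assms in simp_all)

text \<open>Coherence of \<open>\<chi>\<close> is inherited from the composites with all
  projections: each law for a composite is the law for \<open>\<chi>\<close> whiskered with
  \<open>p X\<close>, pasted with the corresponding law for \<open>lam X\<close>.\<close>

lemma lift_lax:
  assumes E: "(E, e) \<in> algebras K T" and h: "h \<in> Arr K" "Dom K h = E" "Cod K h = L"
    and \<chi>: "\<chi> \<in> Cell K" "Src K \<chi> = str \<cdot> T1 h" "Trg K \<chi> = h \<cdot> e"
    and comp: "\<And>X. X \<in> Ob A \<Longrightarrow> \<lparr>lax_dom = (E, e), lax_cod = FOb F X, lax_arr = p X \<cdot> h,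
      lax_cell = (p X \<rhd> \<chi>) \<odot> (lam X \<lhd> T1 h)\<rparr> \<in> lax_morphisms K T"
  shows "\<lparr>lax_dom = (E, e), lax_cod = (L, str), lax_arr = h, lax_cell = \<chi>\<rparr> \<in> lax_morphisms K T"
proof -
  note [simp] = h \<chi> E algebra_typing [OF E, unfolded fst_conv snd_conv]
  have unit: "\<chi> \<lhd> Unit T E = Id2 K h"
  proof (rule D.oplimit_cell_eq [OF lim])
    show "Trg K (\<chi> \<lhd> Unit T E) = Trg K (Id2 K h)"
      using algebra_laws(1) [OF E] by simp
    show "Src K (\<chi> \<lhd> Unit T E) = Src K (Id2 K h)"
      using unit_natural [of h] comp_assoc [of h "Unit T L" str] by (simp add: str_unit)
    fix X assume X [simp]: "X \<in> Ob A"
    have "lam X \<lhd> (T1 h \<cdot> Unit T E) = (lam X \<lhd> Unit T L) \<lhd> h"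
      using unit_natural [of h] by simp
    then have "lam X \<lhd> (T1 h \<cdot> Unit T E) = Id2 K (p X \<cdot> h)" by (simp add: lam_unit)
    moreover have "((p X \<rhd> \<chi>) \<odot> (lam X \<lhd> T1 h)) \<lhd> Unit T E = Id2 K (p X \<cdot> h)"
      using lax_laws(1) [OF comp [OF X]] by simp
    moreover have "p X \<cdot> h = p X \<cdot> (str \<cdot> (T1 h \<cdot> Unit T E))"
      using unit_natural [of h] comp_assoc [of h "Unit T L" str] by (simp add: str_unit)
    ultimately show "p X \<rhd> (\<chi> \<lhd> Unit T E) = p X \<rhd> Id2 K h" by simp
  qed simp_all
  have mult: "\<chi> \<lhd> Mult T E = (\<chi> \<lhd> T1 e) \<odot> (str \<rhd> T2 \<chi>)"
  proof (rule D.oplimit_cell_eq [OF lim])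
    show s: "Src K (\<chi> \<lhd> Mult T E) = Src K ((\<chi> \<lhd> T1 e) \<odot> (str \<rhd> T2 \<chi>))"
      using mult_natural [of h] comp_assoc [of "T1 (T1 h)" "Mult T L" str]
        comp_assoc [of "T1 (T1 h)" "T1 str" str] by (simp add: str_mult)
    show "Trg K (\<chi> \<lhd> Mult T E) = Trg K ((\<chi> \<lhd> T1 e) \<odot> (str \<rhd> T2 \<chi>))"
      using algebra_laws(2) [OF E] by simp
    fix X assume X [simp]: "X \<in> Ob A"
    show "p X \<rhd> (\<chi> \<lhd> Mult T E) = p X \<rhd> ((\<chi> \<lhd> T1 e) \<odot> (str \<rhd> T2 \<chi>))"
    \<comment> \<open>The cell cancelled is \<open>lam X \<lhd> (T1 h \<cdot> Mult T E)\<close>;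
      pasting it on completes the left side to the 2-cell of the composite, whose multiplication law
      is known.\<close>
    proof (rule invertible_cancel_right)
      have m: "lam X \<lhd> (T1 h \<cdot> Mult T E) = ((lam X \<lhd> T1 str) \<odot> (alg X \<rhd> T2 (lam X))) \<lhd> T1 (T1 h)"
        using mult_natural [of h] whisker_right_right [of "lam X" "Mult T L" "T1 (T1 h)"]
        by (simp add: lam_mult)
      have "(p X \<rhd> (\<chi> \<lhd> Mult T E)) \<odot> (lam X \<lhd> (T1 h \<cdot> Mult T E)) =
          ((p X \<rhd> \<chi>) \<odot> (lam X \<lhd> T1 h)) \<lhd> Mult T E"
        by simp
      also have "\<dots> = (((p X \<rhd> \<chi>) \<odot> (lam X \<lhd> T1 h)) \<lhd> T1 e) \<odot>
          (alg X \<rhd> T2 ((p X \<rhd> \<chi>) \<odot> (lam X \<lhd> T1 h)))"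
        using lax_laws(2) [OF comp [OF X]] by (simp only: lax_mor.simps fst_conv snd_conv)
      also have "\<dots> = (p X \<rhd> (\<chi> \<lhd> T1 e)) \<odot>
          (((lam X \<lhd> Trg K (T2 \<chi>)) \<odot> ((alg X \<cdot> T1 (p X)) \<rhd> T2 \<chi>)) \<odot> (alg X \<rhd> (T2 (lam X) \<lhd> T1 (T1 h))))"
        by simp
      \<comment> \<open>Once \<open>T2 \<chi>\<close> has passed \<open>lam X\<close>, the two
        \<open>lam\<close> factors are adjacent and \<open>m\<close> recombines them.\<close>
      also have "\<dots> = (p X \<rhd> (\<chi> \<lhd> T1 e)) \<odot>
          ((((p X \<cdot> str) \<rhd> T2 \<chi>) \<odot> (lam X \<lhd> Src K (T2 \<chi>))) \<odot> (alg X \<rhd> (T2 (lam X) \<lhd> T1 (T1 h))))"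
        by (subst lam_exchange) simp_all
      also have "\<dots> = (p X \<rhd> ((\<chi> \<lhd> T1 e) \<odot> (str \<rhd> T2 \<chi>))) \<odot> (lam X \<lhd> (T1 h \<cdot> Mult T E))"
        unfolding m by simp
      finally show "(p X \<rhd> (\<chi> \<lhd> Mult T E)) \<odot> (lam X \<lhd> (T1 h \<cdot> Mult T E)) =
        (p X \<rhd> ((\<chi> \<lhd> T1 e) \<odot> (str \<rhd> T2 \<chi>))) \<odot> (lam X \<lhd> (T1 h \<cdot> Mult T E))" .
    qed (use s in simp_all)
  qed simp_all
  show ?thesis by (simp add: lax_morphism_iff unit mult)
qed

lemma lifted_arr_ex:
  assumes \<theta>: "sigma_opcone A S (Alg_lax K T) F E \<theta>" and E: "E \<in> algebras K T"
  shows "\<exists>z. z \<in> lax_morphisms K T \<and> lax_dom z = E \<and> lax_cod z = (L, str) \<and>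
    precomp A (Alg_lax K T) lifted z = \<theta>"
proof -
  note o = DA.sigma_opcone_oplax [OF \<theta>]
  note [simp] = Alg_opcone_typing [OF o]
  define e where "e = snd E"
  have Ee: "E = (fst E, e)" by (simp add: e_def)
  have [simp]: "e \<in> Arr K" "Dom K e = T0 (fst E)" "Cod K e = fst E" "fst E \<in> Ob K"
    using E by (simp_all add: e_def)
  note [simp] = e_def [symmetric]
  let ?\<mu> = "\<lambda>X. lax_cell (leg \<theta> X)"
  obtain h where h [simp]: "h \<in> Arr K" "Dom K h = fst E" "Cod K h = L"
    and hp: "precomp A K \<pi> h = map_opcone A Forget \<theta>"
    by (rule D.oplimit_arr_ex [OF lim _ map_opcone_sigma [OF \<theta>]]) (use E in simp_all)
  have leg [simp]: "lax_arr (leg \<theta> X) = p X \<cdot> h" if "X \<in> Ob A" for X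
    using D.precomp_sel(1) [of X \<pi> h] that by (simp add: hp)
  have con [simp]: "alg_under (con \<theta> f) = q f \<lhd> h" if "f \<in> Arr A" for f
    using D.precomp_sel(2) [of f \<pi> h] that by (simp add: hp)
  have \<mu> [simp]: "?\<mu> X \<in> Cell K" "Src K (?\<mu> X) = alg X \<cdot> (T1 (p X) \<cdot> T1 h)" "Trg K (?\<mu> X) = p X \<cdot> (h \<cdot> e)"
    if "X \<in> Ob A" for X
    using that E by simp_all
  \<comment> \<open>The only candidate for \<open>p X \<rhd> \<chi>\<close>: the composite with the
    lifted projection must have the 2-cell \<open>?\<mu> X\<close>.\<close>
  let ?\<alpha> = "\<lambda>X. ?\<mu> X \<odot> inv_cell (lam X \<lhd> T1 h)"
  have nat: "(Fa f \<rhd> ?\<alpha> (Dom A f)) \<odot> (q f \<lhd> (str \<cdot> T1 h)) = (q f \<lhd> (h \<cdot> e)) \<odot> ?\<alpha> (Cod A f)"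
    if f [simp]: "f \<in> Arr A" for f
  \<comment> \<open>Composition with \<open>lam (Cod A f) \<lhd> T1 h\<close> lets
    \<open>str_cell\<close> rewrite the left side and removes the inverse on the right.\<close>
  proof (rule invertible_cancel_right)
    define X Y where XY: "X = Dom A f" "Y = Cod A f"
    have [simp]: "X \<in> Ob A" "Y \<in> Ob A" "Dom A f = X" "Cod A f = Y" by (simp_all add: XY)
    \<comment> \<open>Compatibility of the 2-cell of algebras \<open>con \<theta> f\<close>, whose
      underlying cell is \<open>q f \<lhd> h\<close>, with the lax structures.\<close>
    have law: "(q f \<lhd> (h \<cdot> e)) \<odot> ?\<mu> Y =
      (Fa f \<rhd> ?\<mu> X) \<odot> ((\<phi> f \<lhd> (T1 (p X) \<cdot> T1 h)) \<odot> (alg Y \<rhd> (T2 (q f) \<lhd> T1 h)))"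
      using alg_cell_law [of "con \<theta> f"] by simp
    have "((Fa f \<rhd> ?\<alpha> X) \<odot> (q f \<lhd> (str \<cdot> T1 h))) \<odot> (lam Y \<lhd> T1 h) =
        (Fa f \<rhd> ?\<alpha> X) \<odot> (((q f \<lhd> str) \<odot> lam Y) \<lhd> T1 h)"
      by simp
    also have "\<dots> = (Fa f \<rhd> ?\<mu> X) \<odot> ((Fa f \<rhd> inv_cell (lam X \<lhd> T1 h)) \<odot> ((Fa f \<rhd> (lam X \<lhd> T1 h)) \<odot>
        ((\<phi> f \<lhd> (T1 (p X) \<cdot> T1 h)) \<odot> (alg Y \<rhd> (T2 (q f) \<lhd> T1 h)))))"
      using str_cell [OF f] by simp
    also have "\<dots> = (Fa f \<rhd> ?\<mu> X) \<odot> ((\<phi> f \<lhd> (T1 (p X) \<cdot> T1 h)) \<odot> (alg Y \<rhd> (T2 (q f) \<lhd> T1 h)))"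
      by (subst whisker_inv_cell_cancel) simp_all
    also have "\<dots> = ((q f \<lhd> (h \<cdot> e)) \<odot> ?\<alpha> Y) \<odot> (lam Y \<lhd> T1 h)"
      by (simp flip: law)
    finally show "((Fa f \<rhd> ?\<alpha> (Dom A f)) \<odot> (q f \<lhd> (str \<cdot> T1 h))) \<odot> (lam (Cod A f) \<lhd> T1 h) =
      ((q f \<lhd> (h \<cdot> e)) \<odot> ?\<alpha> (Cod A f)) \<odot> (lam (Cod A f) \<lhd> T1 h)" by simp
  qed simp_all
  obtain \<chi> where \<chi> [simp]: "\<chi> \<in> Cell K" "Src K \<chi> = str \<cdot> T1 h" "Trg K \<chi> = h \<cdot> e"
    and \<chi>p: "\<And>X. X \<in> Ob A \<Longrightarrow> p X \<rhd> \<chi> = ?\<alpha> X"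
    by (rule D.oplimit_cell_ex [OF lim, of "str \<cdot> T1 h" "h \<cdot> e" ?\<alpha>]) (use nat in simp_all)
  have \<chi>\<mu>: "(p X \<rhd> \<chi>) \<odot> (lam X \<lhd> T1 h) = ?\<mu> X" if "X \<in> Ob A" for X
    using that by (simp add: \<chi>p)
  define z where "z = \<lparr>lax_dom = (fst E, e), lax_cod = (L, str), lax_arr = h, lax_cell = \<chi>\<rparr>"
  have comp: "\<lparr>lax_dom = (fst E, e), lax_cod = FOb F X, lax_arr = p X \<cdot> h,
      lax_cell = (p X \<rhd> \<chi>) \<odot> (lam X \<lhd> T1 h)\<rparr> = leg \<theta> X" if "X \<in> Ob A" for X
    by (rule lax_mor_eqI) (use that Ee in \<open>simp_all add: \<chi>\<mu>\<close>)
  have "(fst E, e) \<in> algebras K T" using E Ee by simp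
  then have z: "z \<in> lax_morphisms K T"
    unfolding z_def by (rule lift_lax) (simp_all add: comp)
  have zs: "lax_dom z = E" "lax_cod z = (L, str)" "lax_arr z = h" "lax_cell z = \<chi>"
    using Ee by (simp_all add: z_def)
  have legs: "lax_comp K T (lifted_leg X) z = leg \<theta> X" if "X \<in> Ob A" for X
    by (rule lax_mor_eqI) (use that in \<open>simp_all add: zs \<chi>\<mu>\<close>)
  have "precomp A (Alg_lax K T) lifted z = \<theta>"
  proof (rule DA.opcone_eqI)
    show "oplax_cone A (Alg_lax K T) F E (precomp A (Alg_lax K T) lifted z)"
      using DA.precomp_oplax [OF DA.sigma_opcone_oplax [OF lifted_sigma], of z] z zs by simp
    show "con (precomp A (Alg_lax K T) lifted z) f = con \<theta> f" if "f \<in> Arr A" for f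
      by (rule alg_cell_eqI) (use that in \<open>simp_all add: legs zs z\<close>)
  qed (rule o, simp_all add: legs)
  with z zs show ?thesis by blast
qed

lemma lifted_oplimit: "is_sigma_oplimit A S (Alg_lax K T) F (L, str) lifted"
proof (rule DA.oplimitI; (unfold Alg_sel(1-9))?)
  show "(L, str) \<in> algebras K T" by simp
  show "sigma_opcone A S (Alg_lax K T) F (L, str) lifted" by (rule lifted_sigma)
  show "\<exists>h. h \<in> lax_morphisms K T \<and> lax_dom h = E \<and> lax_cod h = (L, str) \<and>
      precomp A (Alg_lax K T) lifted h = \<theta>"
    if "E \<in> algebras K T" "sigma_opcone A S (Alg_lax K T) F E \<theta>" for E \<theta>
    using lifted_arr_ex that by blast
  show "h = k"
    if h [simp]: "h \<in> lax_morphisms K T" "lax_cod h = (L, str)"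
      and k [simp]: "k \<in> lax_morphisms K T" "lax_cod k = (L, str)" and hk: "lax_dom h = lax_dom k"
      and eq: "precomp A (Alg_lax K T) lifted h = precomp A (Alg_lax K T) lifted k" for h k
  proof -
    \<comment> \<open>Uniqueness in \<open>K\<close> settles the underlying arrows; the lax
      structures are compared afterwards.\<close>
    have "precomp A K \<pi> (lax_arr h) = precomp A K \<pi> (lax_arr k)"
      using arg_cong [OF eq, of "map_opcone A Forget"] by (simp add: map_opcone_precomp map_lifted)
    then have arr: "lax_arr h = lax_arr k"
      by (intro D.oplimit_arr_eq [OF lim]) (simp_all add: hk)
    have "lax_cell h = lax_cell k"
    proof (rule D.oplimit_cell_eq [OF lim])
      fix X assume X: "X \<in> Ob A"
      have "leg (precomp A (Alg_lax K T) lifted h) X = leg (precomp A (Alg_lax K T) lifted k) X"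
        by (simp only: eq)
      then have "lax_comp K T (lifted_leg X) h = lax_comp K T (lifted_leg X) k"
        using X by simp
      from arg_cong [OF this, of lax_cell]
      \<comment> \<open>The 2-cells of both composites share the invertible factor contributed by
        the projection.\<close>
      have "(p X \<rhd> lax_cell h) \<odot> (lam X \<lhd> T1 (lax_arr k)) = (p X \<rhd> lax_cell k) \<odot> (lam X \<lhd> T1 (lax_arr k))"
        by (simp add: arr)
      then show "p X \<rhd> lax_cell h = p X \<rhd> lax_cell k"
        by (rule invertible_cancel_right) (use X in \<open>simp_all add: arr\<close>)
    qed (simp_all add: arr hk)
    with arr hk show ?thesis by (intro lax_mor_eqI) simp_all
  qed
  show "\<exists>\<beta>. \<beta> \<in> alg_cells K T \<and> alg_src \<beta> = h \<and> alg_trg \<beta> = k \<and>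
      (\<forall>X\<in>Ob A. leg lifted X \<rhd>\<^bsub>Alg_lax K T\<^esub> \<beta> = \<alpha> X)"
    if h [simp]: "h \<in> lax_morphisms K T" "lax_cod h = (L, str)"
      and k [simp]: "k \<in> lax_morphisms K T" "lax_cod k = (L, str)" and hk: "lax_dom h = lax_dom k"
      and \<alpha>: "\<And>X. X \<in> Ob A \<Longrightarrow> \<alpha> X \<in> Hom2 (Alg_lax K T) (lax_comp K T (leg lifted X) h) (lax_comp K T (leg lifted X) k)"
      and nat: "\<And>f. f \<in> Arr A \<Longrightarrow>
        (FArr F f \<rhd>\<^bsub>Alg_lax K T\<^esub> \<alpha> (Dom A f)) \<odot>\<^bsub>Alg_lax K T\<^esub> (con lifted f \<lhd>\<^bsub>Alg_lax K T\<^esub> h) =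
        (con lifted f \<lhd>\<^bsub>Alg_lax K T\<^esub> k) \<odot>\<^bsub>Alg_lax K T\<^esub> \<alpha> (Cod A f)" for h k \<alpha>
  proof -
    have \<alpha>' [simp]: "\<alpha> X \<in> alg_cells K T" "alg_src (\<alpha> X) = lax_comp K T (lifted_leg X) h"
      "alg_trg (\<alpha> X) = lax_comp K T (lifted_leg X) k" if "X \<in> Ob A" for X
      using \<alpha> [OF that] that by simp_all
    have nat': "(Fa f \<rhd> alg_under (\<alpha> (Dom A f))) \<odot> (q f \<lhd> lax_arr h) = (q f \<lhd> lax_arr k) \<odot> alg_under (\<alpha> (Cod A f))"
      if "f \<in> Arr A" for f
      using arg_cong [OF nat [OF that], of alg_under] that by simp
    obtain \<beta> where \<beta> [simp]: "\<beta> \<in> Cell K" "Src K \<beta> = lax_arr h" "Trg K \<beta> = lax_arr k"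
      and \<beta>p: "\<And>X. X \<in> Ob A \<Longrightarrow> p X \<rhd> \<beta> = alg_under (\<alpha> X)"
      by (rule D.oplimit_cell_ex [OF lim, of "lax_arr h" "lax_arr k" "\<lambda>X. alg_under (\<alpha> X)"])
        (use nat' hk in simp_all)
    \<comment> \<open>The corresponding law holds for \<open>\<alpha> X\<close>, whose underlying
      cell is \<open>p X \<rhd> \<beta>\<close>; exchanging \<open>lam X\<close> with
      \<open>T2 \<beta>\<close> brings \<open>lam X\<close> to the end, where it cancels.\<close>
    have law: "(\<beta> \<lhd> snd (lax_dom k)) \<odot> lax_cell h = lax_cell k \<odot> (str \<rhd> T2 \<beta>)"
    proof (rule D.oplimit_cell_eq [OF lim])
      fix X assume X [simp]: "X \<in> Ob A"
      show "p X \<rhd> ((\<beta> \<lhd> snd (lax_dom k)) \<odot> lax_cell h) = p X \<rhd> (lax_cell k \<odot> (str \<rhd> T2 \<beta>))"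
      proof (rule invertible_cancel_right)
        have "(p X \<rhd> ((\<beta> \<lhd> snd (lax_dom k)) \<odot> lax_cell h)) \<odot> (lam X \<lhd> T1 (lax_arr h)) =
          ((p X \<rhd> \<beta>) \<lhd> snd (lax_dom k)) \<odot> ((p X \<rhd> lax_cell h) \<odot> (lam X \<lhd> T1 (lax_arr h)))"
          by (simp add: hk)
        also have "\<dots> = ((p X \<rhd> lax_cell k) \<odot> (lam X \<lhd> T1 (lax_arr k))) \<odot> (alg X \<rhd> T2 (p X \<rhd> \<beta>))"
          using alg_cell_law [of "\<alpha> X"] unfolding \<beta>p [OF X] by (simp add: hk)
        also have "\<dots> = (p X \<rhd> lax_cell k) \<odot> ((lam X \<lhd> Trg K (T2 \<beta>)) \<odot> ((alg X \<cdot> T1 (p X)) \<rhd> T2 \<beta>))"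
          by (simp add: hk)
        also have "\<dots> = (p X \<rhd> lax_cell k) \<odot> (((p X \<cdot> str) \<rhd> T2 \<beta>) \<odot> (lam X \<lhd> Src K (T2 \<beta>)))"
          by (subst lam_exchange) simp_all
        also have "\<dots> = (p X \<rhd> (lax_cell k \<odot> (str \<rhd> T2 \<beta>))) \<odot> (lam X \<lhd> T1 (lax_arr h))"
          by (simp add: hk)
        finally show "(p X \<rhd> ((\<beta> \<lhd> snd (lax_dom k)) \<odot> lax_cell h)) \<odot> (lam X \<lhd> T1 (lax_arr h)) =
          (p X \<rhd> (lax_cell k \<odot> (str \<rhd> T2 \<beta>))) \<odot> (lam X \<lhd> T1 (lax_arr h))" .
      qed (simp_all add: hk)
    qed (simp_all add: hk)
    define b where "b = \<lparr>alg_src = h, alg_trg = k, alg_under = \<beta>\<rparr>"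
    have "b \<in> alg_cells K T" by (simp add: b_def alg_cell_iff hk law)
    moreover have "leg lifted X \<rhd>\<^bsub>Alg_lax K T\<^esub> b = \<alpha> X" if "X \<in> Ob A" for X
      by (rule alg_cell_eqI) (use that in \<open>simp_all add: b_def \<beta>p\<close>)
    moreover have "alg_src b = h" "alg_trg b = k" by (simp_all add: b_def)
    ultimately show ?thesis by blast
  qed
  show "\<beta> = \<gamma>" if \<beta>: "\<beta> \<in> alg_cells K T" "lax_cod (alg_src \<beta>) = (L, str)" and \<gamma>: "\<gamma> \<in> alg_cells K T"
    and s: "alg_src \<beta> = alg_src \<gamma>" "alg_trg \<beta> = alg_trg \<gamma>"
    and eq: "\<And>X. X \<in> Ob A \<Longrightarrow> leg lifted X \<rhd>\<^bsub>Alg_lax K T\<^esub> \<beta> = leg lifted X \<rhd>\<^bsub>Alg_lax K T\<^esub> \<gamma>" for \<beta> \<gamma>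
  proof -
    have "alg_under \<beta> = alg_under \<gamma>"
    proof (rule D.oplimit_cell_eq [OF lim])
      show "p X \<rhd> alg_under \<beta> = p X \<rhd> alg_under \<gamma>" if "X \<in> Ob A" for X
        using arg_cong [OF eq [OF that], of alg_under] that by simp
    qed (use \<beta> \<gamma> s in simp_all)
    with s show ?thesis by (intro alg_cell_eqI)
  qed
qed

text \<open>At \<open>io X\<close> the projection is strict, so the composite with it has 2-cell
  \<open>p (io X) \<rhd> lax_cell z\<close>; whiskering with \<open>Fa (ia X)\<close> reaches
  \<open>p X\<close>. Identities and invertible cells survive whiskering, so detection reduces to
  testing on all projections in \<open>K\<close>.\<close>

lemma lifted_leg_cell:
  assumes z: "z \<in> lax_morphisms K T" "lax_cod z = (L, str)" and X: "X \<in> Ob A"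
  shows "p X \<rhd> lax_cell z = Fa (ia X) \<rhd> lax_cell (lax_comp K T (leg lifted (io X)) z)"
  using z X lam_I [OF init_ob_props(1) [OF X]] leg_str_io [OF X, symmetric] leg_ia [OF X]
  by simp

section \<open>Strictness of the initial projections and detection by them\<close>

lemma lifted_strict: "X \<in> I \<Longrightarrow> strict_mor K (leg lifted X)"
  by (auto simp: strict_mor_def identity_cell_def lam_I)

lemma detects_strict: "jointly_detects K T (strict_mor K) (L, str) I (leg lifted)"
  unfolding jointly_detects_def strict_mor_def Alg_sel
proof (intro ballI impI)
  fix z assume z: "z \<in> lax_morphisms K T" "lax_cod z = (L, str)"
    and st: "\<forall>i\<in>I. identity_cell K (lax_cell (lax_comp K T (leg lifted i) z))"
  show "identity_cell K (lax_cell z)"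
  proof (rule D.oplimit_cell_identity [OF lim])
    fix X assume X: "X \<in> Ob A"
    let ?c = "lax_cell (lax_comp K T (leg lifted (io X)) z)"
    obtain h where h: "h \<in> Arr K" "?c = Id2 K h"
      using st init_ob_props(1) [OF X] unfolding identity_cell_def by blast
    have "lax_comp K T (leg lifted (io X)) z \<in> lax_morphisms K T"
      using z X by simp
    \<comment> \<open>With the 2-cell of the composite left folded, its boundary is computed by the
      typing of lax morphisms. This places \<open>h\<close> so that \<open>Fa (ia X)\<close> can be
      whiskered with its identity.\<close>
    then have "Cod K (Src K ?c) = G (io X)" using X z by (simp del: lax_comp_sel(4))
    then have "Cod K h = G (io X)" using h by simp
    then have "p X \<rhd> lax_cell z = Id2 K (Fa (ia X) \<cdot> h)" "Fa (ia X) \<cdot> h \<in> Arr K"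
      unfolding lifted_leg_cell [OF z X] h(2) using h X by simp_all
    then show "identity_cell K (p X \<rhd> lax_cell z)"
      by (auto simp: identity_cell_def)
  qed (use z in simp_all)
qed

lemma detects_pseudo: "jointly_detects K T (pseudo_mor K) (L, str) I (leg lifted)"
  unfolding jointly_detects_def pseudo_mor_def Alg_sel
proof (intro ballI impI)
  fix z assume z: "z \<in> lax_morphisms K T" "lax_cod z = (L, str)"
    and ps: "\<forall>i\<in>I. invertible_cell K (lax_cell (lax_comp K T (leg lifted i) z))"
  show "invertible_cell K (lax_cell z)"
  proof (rule D.oplimit_cell_invertible [OF lim])
    fix X assume X: "X \<in> Ob A"
    have "lax_comp K T (leg lifted (io X)) z \<in> lax_morphisms K T"
      using z X by simp
    then show "invertible_cell K (p X \<rhd> lax_cell z)"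
      unfolding lifted_leg_cell [OF z X] using ps init_ob_props(1) [OF X] X z
      by (intro invertible_whisker_left) (simp_all del: lax_comp_sel(4))
  qed (use z in simp_all)
qed

text \<open>An arbitrary limit cone \<open>\<rho>\<close> is the lifted cone composed with an
  isomorphism \<open>u\<close>, so its image is \<open>\<pi>\<close> composed with the isomorphism
  \<open>lax_arr u\<close> of \<open>K\<close>.\<close>

lemma Forget_preserves:
  assumes M: "is_sigma_oplimit A S (Alg_lax K T) F M \<rho>"
  shows "is_sigma_oplimit A S K F' (fst M) (map_opcone A Forget \<rho>)"
proof -
  obtain u v where u: "u \<in> Hom (Alg_lax K T) M (L, str)" and v: "v \<in> Hom (Alg_lax K T) (L, str) M"
    and uv: "u \<cdot>\<^bsub>Alg_lax K T\<^esub> v = Id (Alg_lax K T) (L, str)"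
    and vu: "v \<cdot>\<^bsub>Alg_lax K T\<^esub> u = Id (Alg_lax K T) M"
    and \<rho>: "precomp A (Alg_lax K T) lifted u = \<rho>"
    by (rule DA.oplimit_iso [OF lifted_oplimit M])
  have "is_sigma_oplimit A S K F' (fst M) (precomp A K \<pi> (lax_arr u))"
  proof (rule D.oplimit_transport [OF lim])
    show "lax_arr u \<in> Hom K (fst M) L" "lax_arr v \<in> Hom K L (fst M)" using u v by auto
    show "lax_arr u \<cdot> lax_arr v = Id K L" "lax_arr v \<cdot> lax_arr u = Id K (fst M)"
      using arg_cong [OF uv, of lax_arr] arg_cong [OF vu, of lax_arr] by simp_all
  qed
  then show ?thesis
    using arg_cong [OF \<rho>, of "map_opcone A Forget"] by (simp add: map_opcone_precomp map_lifted)
qed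

end

text \<open>The assertions about projections concern one lift lying exactly over the given
  \<open>\<pi>\<close>: limit cones are determined up to isomorphism only, and composing with an
  isomorphism of lax morphisms can destroy strictness.\<close>

theorem corollary3p6:
  fixes K :: "('o, 'm, 'c) two_cat"
    and T :: "('o, 'm, 'c) monad_data"
    and A :: "('x, 'f, 'g) two_cat"
    and S :: "'f set"
    and A\<^sub>0 :: "'x set"
    and F :: "('x, 'f, 'g, 'o \<times> 'm, ('o, 'm, 'c) lax_mor, ('o, 'm, 'c) alg_cell) two_fun"
  assumes "two_category K"
    and "two_monad K T"
    and "PIE A S"
    and "initial_family A S A\<^sub>0"
    and "two_functor A (Alg_lax K T) F"
    and "\<And>X. X \<in> Ob A \<Longrightarrow> invertible_cell K (lax_cell (FArr F (init_arr A S A\<^sub>0 X)))"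
  shows "creates_sigma_oplimit A S (Alg_lax K T) K Forget F \<and>
    (\<forall>L \<pi>. is_sigma_oplimit A S K (two_fun_comp Forget F) L \<pi> \<longrightarrow>
      (\<exists>L' \<pi>'. is_sigma_oplimit A S (Alg_lax K T) F L' \<pi>' \<and>
         FOb Forget L' = L \<and> map_opcone A Forget \<pi>' = \<pi> \<and>
         (\<forall>X \<in> A\<^sub>0. strict_mor K (leg \<pi>' X)) \<and>
         jointly_detects K T (strict_mor K) L' A\<^sub>0 (leg \<pi>') \<and>
         jointly_detects K T (pseudo_mor K) L' A\<^sub>0 (leg \<pi>')))"
proof -
  have pair: "indexing_pair A S" using assms(3) by (simp add: PIE_def)
  \<comment> \<open>Stated for all limit cones in \<open>K\<close>, as it is interpreted twice: at
    some limit for creation, and at a prescribed one for the projections.\<close>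
  have lifting: "lifting K T A S F A\<^sub>0 L \<pi>" if "is_sigma_oplimit A S K (two_fun_comp Forget F) L \<pi>" for L \<pi>
    using assms pair that
    by (intro lifting.intro lax_diagram.intro monad_context.intro monad_context_axioms.intro
        lax_diagram_axioms.intro initial_indexing.intro initial_indexing_axioms.intro lifting_axioms.intro)
      (auto simp: indexing_pair_def)
  show ?thesis
    unfolding creates_sigma_oplimit_def
  proof (intro conjI allI impI)
    assume "\<exists>L \<pi>. is_sigma_oplimit A S K (two_fun_comp Forget F) L \<pi>"
    then obtain L \<pi> where lim: "is_sigma_oplimit A S K (two_fun_comp Forget F) L \<pi>" by blast
    interpret lifting K T A S F A\<^sub>0 L \<pi> by (rule lifting [OF lim])
    show "\<exists>L \<pi>. is_sigma_oplimit A S (Alg_lax K T) F L \<pi>"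
      using lifted_oplimit by blast
    show "is_sigma_oplimit A S K (two_fun_comp Forget F) (FOb Forget M) (map_opcone A Forget \<rho>)"
      if "is_sigma_oplimit A S (Alg_lax K T) F M \<rho>" for M \<rho>
      using Forget_preserves [OF that] by simp
  next
    fix L \<pi> assume lim: "is_sigma_oplimit A S K (two_fun_comp Forget F) L \<pi>"
    interpret lifting K T A S F A\<^sub>0 L \<pi> by (rule lifting [OF lim])
    show "\<exists>L' \<pi>'. is_sigma_oplimit A S (Alg_lax K T) F L' \<pi>' \<and>
         FOb Forget L' = L \<and> map_opcone A Forget \<pi>' = \<pi> \<and>
         (\<forall>X \<in> A\<^sub>0. strict_mor K (leg \<pi>' X)) \<and>
         jointly_detects K T (strict_mor K) L' A\<^sub>0 (leg \<pi>') \<and>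
         jointly_detects K T (pseudo_mor K) L' A\<^sub>0 (leg \<pi>')"
      using lifted_oplimit map_lifted lifted_strict detects_strict detects_pseudo
      by (intro exI [of _ "(L, str)"] exI [of _ lifted]) simp
  qed
qed

end
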